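(* Let $I\in J(\mathcal{P})_\lambda$ with $\max I=\{(s_i,\lambda_i)\mid i\in S\}$, $S=\{i_1<\dots<i_t\}$, $t\ge1$. Let $\mathcal{O}_{m',J,K}\subset R_\lambda^{I^*}$ be a $G_\lambda^I$-orbit, let $r_i$ and $x$ be the associated exponents and characteristic element, and let $y_{i_1},\dots,y_{i_t}\in R^*$ be such that $f=((\pi^{s_{i_1}}y_{i_1},\dots,\pi^{s_{i_t}}y_{i_t}),x)\in\mathcal{O}_{m',J,K}$. Let $\mathcal{O}=\{(g\,e(I),gf)\mid g\in G_\lambda\}\subset R_\lambda^{I^*}\times R_\lambda^{I^*}$. Suppose $(\underline a,\underline b)\in R_\lambda^{I^*}\times R_\lambda^{I^*}$ has the same case description as $(e(I),f)$. Then there exists $g\in G_\lambda$ such that $(\underline a,\underline b)=(g\,e(I),gf)$, i.e. $(\underline a,\underline b)\in\mathcal{O}$.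
   Context: Let $R$ be a discrete valuation ring with uniformizer $\pi$, finite residue field $\mathbb{F}_q$ and unit group $R^*$; $val$ is the valuation on $R$, $val(0)=\infty$, $\pi^\infty:=0$, and a minimum over an empty set is $\infty$. Write $R_n=R/\pi^nR$, $R_n^{\rho*}=R_n^\rho\setminus\pi R_n^\rho$ and $\pi^jR_n^{\rho*}=\pi^jR_n^\rho\setminus\pi^{j+1}R_n^\rho$. For $z\in\pi^rR_n^\rho$ with $r<n$, $\pi^{-r}z\ (\mathrm{mod}\ \pi)\in\mathbb{F}_q^\rho$ is the reduction of any $w$ with $\pi^rw=z$. For $\lambda=(\lambda_1^{\rho_1}>\dots>\lambda_k^{\rho_k})$ (positive integers $\lambda_1>\dots>\lambda_k$, multiplicities $\rho_i\ge1$) put $R_\lambda=\bigoplus_{i=1}^kR_{\lambda_i}^{\rho_i}$ and $G_\lambda=\mathrm{Aut}_R(R_\lambda)$. An element $\underline a\in R_\lambda$ has block components $a_i\in R_{\lambda_i}^{\rho_i}$. The fundamental poset is $\mathcal{P}=\{(v,l)\mid l\in\mathbb{N},\,0\le v<l\}$ with $(v,l)\le(v',l')$ iff $v\ge v'$ and $l-v\le l'-v'$. Order ideals are down-closed subsets; $\max(I)$ is the set of maximal elements of $I$. For an element $e$ of a finite $R$-module $M$, fix an isomorphism $M\cong\bigoplus_i(R/\pi^{\mu_i}R)^{\sigma_i}$ ($\mu_i$ distinct); $I(e)$ is the order ideal generated by the pairs $(v_i,\mu_i)$, where $v_i$ is the minimum of the valuations of the coordinates of $e$ in the $i$-th block,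 over the blocks where $e$ is non-zero ($I(e)$ does not depend on the isomorphism; $I(0)=\emptyset$). For an order ideal $I$ put $M^I=\{e\in M\mid I(e)\subset I\}$ and $M^{I^*}=\{e\in M\mid I(e)=I\}$. $J(\mathcal{P})_\lambda$ is the set of order ideals $I$ all of whose maximal elements are of the form $(v,\lambda_i)$; the sets $R_\lambda^{I^*}$, $I\in J(\mathcal{P})_\lambda$, are exactly the $G_\lambda$-orbits of $R_\lambda$. Given $I$ with $\max I=\{(s_i,\lambda_i)\mid i\in S\}$: for $i\notin S$ the boundary valuation is $\partial_{\lambda_i}I=\min\big(\min_{j\in S,\,j<i}s_j,\ \min_{j\in S,\,j>i}(\lambda_i-\lambda_j+s_j)\big)$, which equals $\min\{v\mid(v,\lambda_i)\in I\}$ whenever the latter set is nonempty (otherwise it is $\ge\lambda_i$). The canonical form $e(I)\in R_\lambda^{I^*}$ has first coordinate $\pi^{s_i}$ in the block $R_{\lambda_i}^{\rho_i}$ for each $i\in S$, and all other coordinates $0$; $G_\lambda^I$ is its stabilizer in $G_\lambda$. $R_{\lambda'}\cong\bigoplus_{i\in S}R_{\lambda_i}$ is the direct sum of the first cyclic summands of the blocks $i\in S$, $R_{\lambda''}$ is the direct sum of all remaining cyclic summands; elements of $R_\lambda=R_{\lambda'}\oplus R_{\lambda''}$ are written $m=(m',m'')$ (up to permuting coordinates), and $e(I)'$ is the projection of $e(I)$ to $R_{\lambda'}$. For $m=(m',m'')\in R_\lambda^{I^*}$ let $\bar m'$ be the image of $m'$ in $R_{\lambda'}/R\,e(I)'$,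 $J=I(\bar m')$, $K=I(m'')$; then $$\mathcal{O}_{m',J,K}=\{(l',l'')\mid l'\in m'+R_{\lambda'}^{J\cup K},\ l''\in R_{\lambda''}^{K^*}+R_{\lambda''}^{J}\}$$ is the $G_\lambda^I$-orbit of $m$ (known), and every $G_\lambda^I$-orbit in $R_\lambda^{I^*}$ is of this form. Put $r_i=\min\{v\mid(v,\lambda_i)\in J\cup K\}$ ($\infty$ if there is no such $v$). The characteristic element $x\in R_{\lambda''}$ has block $\pi^{r_i}(1,0,\dots,0)\in R_{\lambda_i}^{\rho_i}$ for $i\notin S$ and block $\pi^{r_i}(1,0,\dots,0)\in R_{\lambda_i}^{\rho_i-1}$ for $i\in S$, $\rho_i>1$ (there is no block in $R_{\lambda''}$ for $i\in S$, $\rho_i=1$). Thus the blocks of $f$ are $f_i=(\pi^{s_i}y_i,\pi^{r_i},0,\dots,0)$ for $i\in S$, $\rho_i>1$; $f_i=\pi^{s_i}y_i$ for $i\in S$, $\rho_i=1$; $f_i=(\pi^{r_i},0,\dots,0)$ for $i\notin S$. For each $i\in\{1,\dots,k\}$ define an index $\iota(i)\in S$: $\iota(i)=i$ if $i\in S$; if $i\notin S$, $\iota(i)$ is a fixed choice of element of $S$ with either $\iota(i)<i$ and $\partial_{\lambda_i}I=s_{\iota(i)}$, or $\iota(i)>i$ and $\partial_{\lambda_i}I=\lambda_i-\lambda_{\iota(i)}+s_{\iota(i)}$. Put $$\begin{aligned}m_i=\min\Big(&\min_{j<i,\,j\in S}(s_j+val(y_j-y_{\iota(i)})),\ \min_{j>i,\,j\in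 S}(\lambda_i-\lambda_j+s_j+val(y_j-y_{\iota(i)})),\\&\min_{j<i,\,j\in S,\,\rho_j>1}r_j,\ \min_{j<i,\,j\notin S}r_j,\ \min_{j>i,\,j\in S,\,\rho_j>1}(\lambda_i-\lambda_j+r_j),\ \min_{j>i,\,j\notin S}(\lambda_i-\lambda_j+r_j)\Big).\end{aligned}$$ The pair $(\underline a,\underline b)\in R_\lambda^{I^*}\times R_\lambda^{I^*}$ has the same case description as $(e(I),f)$ if for every $i$ the following holds. For $i\in S$: (A) if $\rho_i=1$, or $\rho_i>1$ and $m_i\le r_i$, then $b_i-y_ia_i\in\pi^{m_i}R_{\lambda_i}^{\rho_i}$; (B) if $\rho_i>1$ and $m_i>r_i$, then $b_i-y_ia_i\in\pi^{r_i}R_{\lambda_i}^{\rho_i}$ and $\pi^{-r_i}(b_i-y_ia_i)\ (\mathrm{mod}\ \pi)$ is linearly independent with $\pi^{-s_i}a_i\ (\mathrm{mod}\ \pi)$ in $\mathbb{F}_q^{\rho_i}$. For $i\notin S$: (i) if $r_i\ge m_i>\partial_{\lambda_i}I$, then $b_i-y_{\iota(i)}a_i\in\pi^{m_i}R_{\lambda_i}^{\rho_i}$; (ii) if $m_i>r_i\ge\partial_{\lambda_i}I$, then $b_i-y_{\iota(i)}a_i\in\pi^{r_i}R_{\lambda_i}^{\rho_i*}$; (iii) in the remaining case there is no condition beyond $a_i,b_i\in\pi^{\partial_{\lambda_i}I}R_{\lambda_i}^{\rho_i}$. *)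

theory Defs
  imports
    "HOL-Library.Extended_Nat"
    "HOL-Algebra.Module"
    "HOL-Algebra.Bij"
    "HOL-Algebra.QuotRing"
    "HOL-Algebra.Ring_Divisibility"
begin

section \<open>Discrete valuation rings\<close>

definition discrete_valuation_ring :: "('a, 'c) ring_scheme \<Rightarrow> bool" where
  "discrete_valuation_ring R \<longleftrightarrow>
     principal_domain R \<and> \<not> field R \<and> (\<exists>!M. maximalideal M R)"

definition uniformizer :: "('a, 'c) ring_scheme \<Rightarrow> 'a \<Rightarrow> bool" where
  "uniformizer R \<pi> \<longleftrightarrow> \<pi> \<in> carrier R \<and> maximalideal (PIdl\<^bsub>R\<^esub> \<pi>) R"

definition val :: "('a, 'c) ring_scheme \<Rightarrow> 'a \<Rightarrow> 'a \<Rightarrow> enat" where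
  "val R \<pi> x = Sup {enat n | n. (\<pi> [^]\<^bsub>R\<^esub> n) divides\<^bsub>R\<^esub> x}"

definition pi_pow :: "('a, 'c) ring_scheme \<Rightarrow> 'a \<Rightarrow> enat \<Rightarrow> 'a" where
  "pi_pow R \<pi> m = (case m of enat n \<Rightarrow> \<pi> [^]\<^bsub>R\<^esub> n | \<infinity> \<Rightarrow> \<zero>\<^bsub>R\<^esub>)"


section \<open>Modules\<close>

text \<open>
  Module records extend ring records; only the additive group and the scalar
  multiplication are meaningful here, so the fields mult and one of direct sums and
  quotients are left unspecified.
\<close>

definition module_hom ::
  "('a, 'c) ring_scheme \<Rightarrow> ('a, 'm, 'd) module_scheme \<Rightarrow> ('a, 'n, 'e) module_scheme
     \<Rightarrow> ('m \<Rightarrow> 'n) set" where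
  "module_hom R M N =
     {h \<in> hom (add_monoid M) (add_monoid N).
        \<forall>r\<in>carrier R. \<forall>x\<in>carrier M. h (r \<odot>\<^bsub>M\<^esub> x) = r \<odot>\<^bsub>N\<^esub> h x}"

definition module_iso ::
  "('a, 'c) ring_scheme \<Rightarrow> ('a, 'm, 'd) module_scheme \<Rightarrow> ('a, 'n, 'e) module_scheme
     \<Rightarrow> ('m \<Rightarrow> 'n) set" where
  "module_iso R M N = {h \<in> module_hom R M N. bij_betw h (carrier M) (carrier N)}"

definition module_aut ::
  "('a, 'c) ring_scheme \<Rightarrow> ('a, 'm, 'd) module_scheme \<Rightarrow> ('m \<Rightarrow> 'm) set" where
  "module_aut R M = module_hom R M M \<inter> Bij (carrier M)"

definition direct_sum ::
  "'i set \<Rightarrow> ('i \<Rightarrow> ('a, 'm) module) \<Rightarrow> ('a, 'i \<Rightarrow> 'm) module" where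
  "direct_sum A M =
     \<lparr>carrier = (\<Pi>\<^sub>E i\<in>A. carrier (M i)),
      monoid.mult = undefined,
      one = undefined,
      ring.zero = (\<lambda>i\<in>A. \<zero>\<^bsub>M i\<^esub>),
      add = (\<lambda>x y. \<lambda>i\<in>A. x i \<oplus>\<^bsub>M i\<^esub> y i),
      smult = (\<lambda>r x. \<lambda>i\<in>A. r \<odot>\<^bsub>M i\<^esub> x i)\<rparr>"

definition quotient_module ::
  "('a, 'm, 'd) module_scheme \<Rightarrow> 'm set \<Rightarrow> ('a, 'm set) module" where
  "quotient_module M N =
     \<lparr>carrier = a_rcosets\<^bsub>M\<^esub> N,
      monoid.mult = undefined,
      one = undefined,
      ring.zero = N,
      add = set_add M,
      smult = (\<lambda>r C. \<Union>x\<in>C. N +>\<^bsub>M\<^esub> (r \<odot>\<^bsub>M\<^esub> x))\<rparr>"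

definition cyclic_submodule ::
  "('a, 'c) ring_scheme \<Rightarrow> ('a, 'm, 'd) module_scheme \<Rightarrow> 'm \<Rightarrow> 'm set" where
  "cyclic_submodule R M e = {r \<odot>\<^bsub>M\<^esub> e | r. r \<in> carrier R}"

text \<open>The set $\pi^m M$.\<close>

definition pi_multiples ::
  "('a, 'c) ring_scheme \<Rightarrow> 'a \<Rightarrow> ('a, 'm, 'd) module_scheme \<Rightarrow> enat \<Rightarrow> 'm set" where
  "pi_multiples R \<pi> M m = (\<lambda>w. pi_pow R \<pi> m \<odot>\<^bsub>M\<^esub> w) ` carrier M"


section \<open>The modules $R_n$, $R_n^\rho$ and $R_\lambda$\<close>

definition residue_class :: "('a, 'c) ring_scheme \<Rightarrow> 'a \<Rightarrow> nat \<Rightarrow> 'a \<Rightarrow> 'a set" where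
  "residue_class R \<pi> n x = PIdl\<^bsub>R\<^esub> (\<pi> [^]\<^bsub>R\<^esub> n) +>\<^bsub>R\<^esub> x"

definition Rn :: "('a, 'c) ring_scheme \<Rightarrow> 'a \<Rightarrow> nat \<Rightarrow> ('a, 'a set) module" where
  "Rn R \<pi> n =
     (let Q = R Quot PIdl\<^bsub>R\<^esub> (\<pi> [^]\<^bsub>R\<^esub> n) in
      \<lparr>carrier = carrier Q, monoid.mult = monoid.mult Q, one = one Q, ring.zero = ring.zero Q,
       add = add Q,
       smult = (\<lambda>r z. residue_class R \<pi> n r \<otimes>\<^bsub>Q\<^esub> z)\<rparr>)"

definition Rn_pow ::
  "('a, 'c) ring_scheme \<Rightarrow> 'a \<Rightarrow> nat \<Rightarrow> nat \<Rightarrow> ('a, nat \<Rightarrow> 'a set) module" where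
  "Rn_pow R \<pi> n \<rho> = direct_sum {1..\<rho>} (\<lambda>_. Rn R \<pi> n)"

text \<open>
  The cyclic summands of $R_\lambda$ are indexed by the pairs $(i,p)$ with $1 \le i \le k$
  and $1 \le p \le \rho_i$.  The same construction on a subset of these pairs gives
  $R_{\lambda'}$ and $R_{\lambda''}$; the projections are restrictions of functions.
\<close>

definition summands :: "nat \<Rightarrow> (nat \<Rightarrow> nat) \<Rightarrow> (nat \<times> nat) set" where
  "summands k rho = (SIGMA i:{1..k}. {1..rho i})"

definition summands' :: "nat set \<Rightarrow> (nat \<times> nat) set" where
  "summands' S = (\<lambda>i. (i, 1)) ` S"

definition summands'' :: "nat \<Rightarrow> (nat \<Rightarrow> nat) \<Rightarrow> nat set \<Rightarrow> (nat \<times> nat) set" where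
  "summands'' k rho S = summands k rho - summands' S"

definition Rsum ::
  "('a, 'c) ring_scheme \<Rightarrow> 'a \<Rightarrow> (nat \<Rightarrow> nat) \<Rightarrow> (nat \<times> nat) set
     \<Rightarrow> ('a, nat \<times> nat \<Rightarrow> 'a set) module" where
  "Rsum R \<pi> lam A = direct_sum A (\<lambda>(i, p). Rn R \<pi> (lam i))"

definition partition_type :: "nat \<Rightarrow> (nat \<Rightarrow> nat) \<Rightarrow> (nat \<Rightarrow> nat) \<Rightarrow> bool" where
  "partition_type k lam rho \<longleftrightarrow>
     (\<forall>i\<in>{1..k}. 1 \<le> lam i \<and> 1 \<le> rho i) \<and>
     (\<forall>i\<in>{1..k}. \<forall>j\<in>{1..k}. i < j \<longrightarrow> lam j < lam i)"

definition Rlam ::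
  "('a, 'c) ring_scheme \<Rightarrow> 'a \<Rightarrow> nat \<Rightarrow> (nat \<Rightarrow> nat) \<Rightarrow> (nat \<Rightarrow> nat)
     \<Rightarrow> ('a, nat \<times> nat \<Rightarrow> 'a set) module" where
  "Rlam R \<pi> k lam rho = Rsum R \<pi> lam (summands k rho)"

definition Rlam' ::
  "('a, 'c) ring_scheme \<Rightarrow> 'a \<Rightarrow> (nat \<Rightarrow> nat) \<Rightarrow> nat set
     \<Rightarrow> ('a, nat \<times> nat \<Rightarrow> 'a set) module" where
  "Rlam' R \<pi> lam S = Rsum R \<pi> lam (summands' S)"

definition Rlam'' ::
  "('a, 'c) ring_scheme \<Rightarrow> 'a \<Rightarrow> nat \<Rightarrow> (nat \<Rightarrow> nat) \<Rightarrow> (nat \<Rightarrow> nat) \<Rightarrow> nat set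
     \<Rightarrow> ('a, nat \<times> nat \<Rightarrow> 'a set) module" where
  "Rlam'' R \<pi> k lam rho S = Rsum R \<pi> lam (summands'' k rho S)"

definition block :: "(nat \<Rightarrow> nat) \<Rightarrow> nat \<Rightarrow> (nat \<times> nat \<Rightarrow> 'a set) \<Rightarrow> nat \<Rightarrow> 'a set" where
  "block rho i a = (\<lambda>p\<in>{1..rho i}. a (i, p))"


section \<open>The fundamental poset and order ideals\<close>

definition fund_poset :: "(nat \<times> nat) set" where
  "fund_poset = {(v, l). v < l}"

definition fund_le :: "nat \<times> nat \<Rightarrow> nat \<times> nat \<Rightarrow> bool" where
  "fund_le = (\<lambda>(v, l) (v', l'). v \<ge> v' \<and> l - v \<le> l' - v')"

definition order_ideal :: "(nat \<times> nat) set \<Rightarrow> bool" where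
  "order_ideal I \<longleftrightarrow>
     I \<subseteq> fund_poset \<and> (\<forall>x\<in>I. \<forall>y\<in>fund_poset. fund_le y x \<longrightarrow> y \<in> I)"

definition generated_ideal :: "(nat \<times> nat) set \<Rightarrow> (nat \<times> nat) set" where
  "generated_ideal G = {y \<in> fund_poset. \<exists>x\<in>G. fund_le y x}"

definition max_elements :: "(nat \<times> nat) set \<Rightarrow> (nat \<times> nat) set" where
  "max_elements I = {x \<in> I. \<forall>y\<in>I. fund_le x y \<longrightarrow> y = x}"

definition ideals_of_type :: "nat \<Rightarrow> (nat \<Rightarrow> nat) \<Rightarrow> (nat \<times> nat) set set" where
  "ideals_of_type k lam =
     {I. order_ideal I \<and> max_elements I \<subseteq> {(v, lam i) | v i. i \<in> {1..k}}}"

definition coord_val :: "('a, 'c) ring_scheme \<Rightarrow> 'a \<Rightarrow> nat \<Rightarrow> 'a set \<Rightarrow> enat" where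
  "coord_val R \<pi> n z = Sup {enat r | r. z \<in> pi_multiples R \<pi> (Rn R \<pi> n) (enat r)}"

text \<open>A block is zero iff its minimal valuation is infinite, so that it contributes nothing.\<close>

definition block_pairs ::
  "('a, 'c) ring_scheme \<Rightarrow> 'a \<Rightarrow> nat \<Rightarrow> (nat \<Rightarrow> nat) \<Rightarrow> (nat \<Rightarrow> nat)
     \<Rightarrow> (nat \<times> nat \<Rightarrow> 'a set) \<Rightarrow> (nat \<times> nat) set" where
  "block_pairs R \<pi> h mu sigma x =
     {(v, mu i) | v i. i \<in> {1..h} \<and>
        enat v = (INF p\<in>{1..sigma i}. coord_val R \<pi> (mu i) (x (i, p)))}"

definition is_decomposition ::
  "('a, 'c) ring_scheme \<Rightarrow> 'a \<Rightarrow> ('a, 'm, 'd) module_scheme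
     \<Rightarrow> nat \<Rightarrow> (nat \<Rightarrow> nat) \<Rightarrow> (nat \<Rightarrow> nat) \<Rightarrow> ('m \<Rightarrow> nat \<times> nat \<Rightarrow> 'a set) \<Rightarrow> bool" where
  "is_decomposition R \<pi> M h mu sigma \<phi> \<longleftrightarrow>
     inj_on mu {1..h} \<and> (\<forall>i\<in>{1..h}. 1 \<le> mu i \<and> 1 \<le> sigma i) \<and>
     \<phi> \<in> module_iso R M (Rlam R \<pi> h mu sigma)"

text \<open>
  The ideal $I(e)$ is generated by the block pairs of $\phi(e)$ for an arbitrarily chosen
  decomposition $\phi$ of $M$.  All choices give the same ideal, and the definition takes the
  union over all of them.
\<close>

definition ideal_of ::
  "('a, 'c) ring_scheme \<Rightarrow> 'a \<Rightarrow> ('a, 'm, 'd) module_scheme \<Rightarrow> 'm \<Rightarrow> (nat \<times> nat) set" where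
  "ideal_of R \<pi> M e =
     \<Union>{generated_ideal (block_pairs R \<pi> h mu sigma (\<phi> e)) | h mu sigma \<phi>.
          is_decomposition R \<pi> M h mu sigma \<phi>}"

text \<open>The sets $M^I$ and $M^{I^*}$.\<close>

definition below_ideal ::
  "('a, 'c) ring_scheme \<Rightarrow> 'a \<Rightarrow> ('a, 'm, 'd) module_scheme \<Rightarrow> (nat \<times> nat) set \<Rightarrow> 'm set" where
  "below_ideal R \<pi> M I = {e \<in> carrier M. ideal_of R \<pi> M e \<subseteq> I}"

definition at_ideal ::
  "('a, 'c) ring_scheme \<Rightarrow> 'a \<Rightarrow> ('a, 'm, 'd) module_scheme \<Rightarrow> (nat \<times> nat) set \<Rightarrow> 'm set" where
  "at_ideal R \<pi> M I = {e \<in> carrier M. ideal_of R \<pi> M e = I}"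


section \<open>Canonical form and orbits of the stabilizer\<close>

definition canonical_form ::
  "('a, 'c) ring_scheme \<Rightarrow> 'a \<Rightarrow> nat \<Rightarrow> (nat \<Rightarrow> nat) \<Rightarrow> (nat \<Rightarrow> nat)
     \<Rightarrow> nat set \<Rightarrow> (nat \<Rightarrow> nat) \<Rightarrow> nat \<times> nat \<Rightarrow> 'a set" where
  "canonical_form R \<pi> k lam rho S s =
     (\<lambda>(i, p)\<in>summands k rho.
        if i \<in> S \<and> p = 1 then residue_class R \<pi> (lam i) (\<pi> [^]\<^bsub>R\<^esub> s i)
        else \<zero>\<^bsub>Rn R \<pi> (lam i)\<^esub>)"

text \<open>The ideal $J$ of the image of $m'$ in $R_{\lambda'} / R\,e(I)'$.\<close>

definition ideal_J ::
  "('a, 'c) ring_scheme \<Rightarrow> 'a \<Rightarrow> nat \<Rightarrow> (nat \<Rightarrow> nat) \<Rightarrow> (nat \<Rightarrow> nat)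
     \<Rightarrow> nat set \<Rightarrow> (nat \<Rightarrow> nat) \<Rightarrow> (nat \<times> nat \<Rightarrow> 'a set) \<Rightarrow> (nat \<times> nat) set" where
  "ideal_J R \<pi> k lam rho S s m =
     (let M = Rlam' R \<pi> lam S;
          N = cyclic_submodule R M
                (restrict (canonical_form R \<pi> k lam rho S s) (summands' S))
      in ideal_of R \<pi> (quotient_module M N) (N +>\<^bsub>M\<^esub> restrict m (summands' S)))"

definition ideal_K ::
  "('a, 'c) ring_scheme \<Rightarrow> 'a \<Rightarrow> nat \<Rightarrow> (nat \<Rightarrow> nat) \<Rightarrow> (nat \<Rightarrow> nat)
     \<Rightarrow> nat set \<Rightarrow> (nat \<times> nat \<Rightarrow> 'a set) \<Rightarrow> (nat \<times> nat) set" where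
  "ideal_K R \<pi> k lam rho S m =
     ideal_of R \<pi> (Rlam'' R \<pi> k lam rho S) (restrict m (summands'' k rho S))"

text \<open>
  The set $\mathcal{O}_{m',J,K}$.  For $m \in R_\lambda^{I^*}$ with associated ideals $J$ and
  $K$ it is the orbit of $m$ under the stabilizer of the canonical form; this is a theorem
  about the set, not part of its definition.
\<close>

definition stab_orbit ::
  "('a, 'c) ring_scheme \<Rightarrow> 'a \<Rightarrow> nat \<Rightarrow> (nat \<Rightarrow> nat) \<Rightarrow> (nat \<Rightarrow> nat) \<Rightarrow> nat set
     \<Rightarrow> (nat \<times> nat \<Rightarrow> 'a set) \<Rightarrow> (nat \<times> nat) set \<Rightarrow> (nat \<times> nat) set
     \<Rightarrow> (nat \<times> nat \<Rightarrow> 'a set) set" where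
  "stab_orbit R \<pi> k lam rho S m' J K =
     (let M' = Rlam' R \<pi> lam S; M'' = Rlam'' R \<pi> k lam rho S in
      {l \<in> carrier (Rlam R \<pi> k lam rho).
         restrict l (summands' S) \<in> m' <+\<^bsub>M'\<^esub> below_ideal R \<pi> M' (J \<union> K) \<and>
         restrict l (summands'' k rho S) \<in> at_ideal R \<pi> M'' K <+>\<^bsub>M''\<^esub> below_ideal R \<pi> M'' J})"

definition r_exp :: "(nat \<Rightarrow> nat) \<Rightarrow> (nat \<times> nat) set \<Rightarrow> (nat \<times> nat) set \<Rightarrow> nat \<Rightarrow> enat" where
  "r_exp lam J K i = (INF v\<in>{v. (v, lam i) \<in> J \<union> K}. enat v)"

text \<open>
  For $i \in S$ the first summand of the block belongs to $R_{\lambda'}$, so the leading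
  summand of the block in $R_{\lambda''}$ has index 2 (if it exists).
\<close>

definition characteristic_element ::
  "('a, 'c) ring_scheme \<Rightarrow> 'a \<Rightarrow> nat \<Rightarrow> (nat \<Rightarrow> nat) \<Rightarrow> (nat \<Rightarrow> nat)
     \<Rightarrow> nat set \<Rightarrow> (nat \<Rightarrow> enat) \<Rightarrow> nat \<times> nat \<Rightarrow> 'a set" where
  "characteristic_element R \<pi> k lam rho S r =
     (\<lambda>(i, p)\<in>summands'' k rho S.
        if p = (if i \<in> S then 2 else 1) then residue_class R \<pi> (lam i) (pi_pow R \<pi> (r i))
        else \<zero>\<^bsub>Rn R \<pi> (lam i)\<^esub>)"

definition orbit_representative ::
  "('a, 'c) ring_scheme \<Rightarrow> 'a \<Rightarrow> nat \<Rightarrow> (nat \<Rightarrow> nat) \<Rightarrow> (nat \<Rightarrow> nat) \<Rightarrow> nat set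
     \<Rightarrow> (nat \<Rightarrow> nat) \<Rightarrow> (nat \<Rightarrow> 'a) \<Rightarrow> (nat \<times> nat \<Rightarrow> 'a set) \<Rightarrow> nat \<times> nat \<Rightarrow> 'a set" where
  "orbit_representative R \<pi> k lam rho S s y x =
     (\<lambda>(i, p)\<in>summands k rho.
        if (i, p) \<in> summands' S
        then residue_class R \<pi> (lam i) ((\<pi> [^]\<^bsub>R\<^esub> s i) \<otimes>\<^bsub>R\<^esub> y i)
        else x (i, p))"


section \<open>Case descriptions\<close>

text \<open>
  In the following truncated subtractions $\lambda_i - \lambda_j$ one always has $j > i$,
  hence $\lambda_i > \lambda_j$.
\<close>

definition boundary_val ::
  "(nat \<Rightarrow> nat) \<Rightarrow> nat set \<Rightarrow> (nat \<Rightarrow> nat) \<Rightarrow> nat \<Rightarrow> enat" where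
  "boundary_val lam S s i =
     min (INF j\<in>{j \<in> S. j < i}. enat (s j))
         (INF j\<in>{j \<in> S. i < j}. enat (lam i - lam j + s j))"

definition boundary_choice ::
  "nat \<Rightarrow> (nat \<Rightarrow> nat) \<Rightarrow> nat set \<Rightarrow> (nat \<Rightarrow> nat) \<Rightarrow> (nat \<Rightarrow> nat) \<Rightarrow> bool" where
  "boundary_choice k lam S s \<iota> \<longleftrightarrow>
     (\<forall>i\<in>S. \<iota> i = i) \<and>
     (\<forall>i\<in>{1..k} - S. \<iota> i \<in> S \<and>
        (\<iota> i < i \<and> boundary_val lam S s i = enat (s (\<iota> i)) \<or>
         i < \<iota> i \<and> boundary_val lam S s i = enat (lam i - lam (\<iota> i) + s (\<iota> i))))"

definition m_exp ::
  "('a, 'c) ring_scheme \<Rightarrow> 'a \<Rightarrow> nat \<Rightarrow> (nat \<Rightarrow> nat) \<Rightarrow> (nat \<Rightarrow> nat) \<Rightarrow> nat set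
     \<Rightarrow> (nat \<Rightarrow> nat) \<Rightarrow> (nat \<Rightarrow> 'a) \<Rightarrow> (nat \<Rightarrow> nat) \<Rightarrow> (nat \<Rightarrow> enat) \<Rightarrow> nat \<Rightarrow> enat" where
  "m_exp R \<pi> k lam rho S s y \<iota> r i = Min {
     (INF j\<in>{j \<in> S. j < i}. enat (s j) + val R \<pi> (y j \<ominus>\<^bsub>R\<^esub> y (\<iota> i))),
     (INF j\<in>{j \<in> S. i < j}. enat (lam i - lam j + s j) + val R \<pi> (y j \<ominus>\<^bsub>R\<^esub> y (\<iota> i))),
     (INF j\<in>{j \<in> S. j < i \<and> rho j > 1}. r j),
     (INF j\<in>{j \<in> {1..k} - S. j < i}. r j),
     (INF j\<in>{j \<in> S. i < j \<and> rho j > 1}. enat (lam i - lam j) + r j),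
     (INF j\<in>{j \<in> {1..k} - S. i < j}. enat (lam i - lam j) + r j)}"

text \<open>
  The reduction modulo $\pi$ of a vector over $R_n$ (for $n \ge 1$): since
  $\pi^n R \subseteq \pi R$, the residue class modulo $\pi$ containing a class $z$ modulo
  $\pi^n$ is $\pi R + z$.
\<close>

definition reduce_mod_pi ::
  "('a, 'c) ring_scheme \<Rightarrow> 'a \<Rightarrow> nat \<Rightarrow> (nat \<Rightarrow> 'a set) \<Rightarrow> nat \<Rightarrow> 'a set" where
  "reduce_mod_pi R \<pi> \<rho> w = (\<lambda>p\<in>{1..\<rho>}. PIdl\<^bsub>R\<^esub> \<pi> <+>\<^bsub>R\<^esub> w p)"

text \<open>$\pi^{-r} z \pmod \pi$ for $z \in \pi^r R_n^\rho$ and $r < n$; it does not depend on the choice of $w$.\<close>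

definition leading_part ::
  "('a, 'c) ring_scheme \<Rightarrow> 'a \<Rightarrow> nat \<Rightarrow> nat \<Rightarrow> nat \<Rightarrow> (nat \<Rightarrow> 'a set) \<Rightarrow> nat \<Rightarrow> 'a set" where
  "leading_part R \<pi> n \<rho> r z =
     reduce_mod_pi R \<pi> \<rho>
       (SOME w. w \<in> carrier (Rn_pow R \<pi> n \<rho>) \<and> (\<pi> [^]\<^bsub>R\<^esub> r) \<odot>\<^bsub>Rn_pow R \<pi> n \<rho>\<^esub> w = z)"

definition lin_indep_pair ::
  "('a, 'c) ring_scheme \<Rightarrow> 'a \<Rightarrow> nat \<Rightarrow> (nat \<Rightarrow> 'a set) \<Rightarrow> (nat \<Rightarrow> 'a set) \<Rightarrow> bool" where
  "lin_indep_pair R \<pi> \<rho> u v \<longleftrightarrow>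
     (let F = R Quot PIdl\<^bsub>R\<^esub> \<pi> in
      \<forall>c\<in>carrier F. \<forall>d\<in>carrier F.
        (\<forall>p\<in>{1..\<rho>}. c \<otimes>\<^bsub>F\<^esub> u p \<oplus>\<^bsub>F\<^esub> d \<otimes>\<^bsub>F\<^esub> v p = \<zero>\<^bsub>F\<^esub>)
          \<longrightarrow> c = \<zero>\<^bsub>F\<^esub> \<and> d = \<zero>\<^bsub>F\<^esub>)"

definition same_case_description ::
  "('a, 'c) ring_scheme \<Rightarrow> 'a \<Rightarrow> nat \<Rightarrow> (nat \<Rightarrow> nat) \<Rightarrow> (nat \<Rightarrow> nat) \<Rightarrow> nat set
     \<Rightarrow> (nat \<Rightarrow> nat) \<Rightarrow> (nat \<Rightarrow> 'a) \<Rightarrow> (nat \<Rightarrow> nat) \<Rightarrow> (nat \<Rightarrow> enat)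
     \<Rightarrow> (nat \<times> nat \<Rightarrow> 'a set) \<Rightarrow> (nat \<times> nat \<Rightarrow> 'a set) \<Rightarrow> bool" where
  "same_case_description R \<pi> k lam rho S s y \<iota> r a b \<longleftrightarrow>
     (\<forall>i\<in>{1..k}.
        let M = Rn_pow R \<pi> (lam i) (rho i);
            a\<^sub>i = block rho i a;
            b\<^sub>i = block rho i b;
            z = b\<^sub>i \<ominus>\<^bsub>M\<^esub> (y (\<iota> i) \<odot>\<^bsub>M\<^esub> a\<^sub>i);
            m\<^sub>i = m_exp R \<pi> k lam rho S s y \<iota> r i;
            r\<^sub>i = r i;
            d\<^sub>i = boundary_val lam S s i
        in (i \<in> S \<longrightarrow>
              (rho i = 1 \<or> rho i > 1 \<and> m\<^sub>i \<le> r\<^sub>i \<longrightarrow> z \<in> pi_multiples R \<pi> M m\<^sub>i) \<and>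
              (rho i > 1 \<and> m\<^sub>i > r\<^sub>i \<longrightarrow>
                 z \<in> pi_multiples R \<pi> M r\<^sub>i \<and>
                 lin_indep_pair R \<pi> (rho i)
                   (leading_part R \<pi> (lam i) (rho i) (the_enat r\<^sub>i) z)
                   (leading_part R \<pi> (lam i) (rho i) (s i) a\<^sub>i))) \<and>
           (i \<notin> S \<longrightarrow>
              (r\<^sub>i \<ge> m\<^sub>i \<and> m\<^sub>i > d\<^sub>i \<longrightarrow> z \<in> pi_multiples R \<pi> M m\<^sub>i) \<and>
              (m\<^sub>i > r\<^sub>i \<and> r\<^sub>i \<ge> d\<^sub>i \<longrightarrow>
                 z \<in> pi_multiples R \<pi> M r\<^sub>i - pi_multiples R \<pi> M (r\<^sub>i + 1)) \<and>
              (\<not> (r\<^sub>i \<ge> m\<^sub>i \<and> m\<^sub>i > d\<^sub>i) \<and> \<not> (m\<^sub>i > r\<^sub>i \<and> r\<^sub>i \<ge> d\<^sub>i) \<longrightarrow>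
                 a\<^sub>i \<in> pi_multiples R \<pi> M d\<^sub>i \<and> b\<^sub>i \<in> pi_multiples R \<pi> M d\<^sub>i)))"

end

theory Submission
  imports Defs
begin

text \<open>
  An endomorphism of $R_\lambda$ is given by its rows, and the two conditions $g\,e(I) = a$ and
  $g f = b$ constrain the blocks of rows independently of each other.  They say
  $a_i = \sum_{j \in S} \pi^{s_j} g_{ij}^{(1)}$, and, after subtracting $y_{\iota(i)} a_i$ from $b_i$,
  $b_i - y_{\iota(i)} a_i = \sum_{j \in S} \pi^{s_j} (y_j - y_{\iota(i)}) g_{ij}^{(1)} + \sum_j \pi^{r_j} g_{ij}^{(*)}$.
  By definition $m_i$ is the least valuation of a coefficient outside the diagonal block, so a single
  off-diagonal column absorbs any right-hand side in $\pi^{m_i} R$.  The column $\iota(i)$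
  drops out of the second equation; for $i \notin S$ it serves to solve the first one, whereas for
  $i \in S$ the first one is solved by the diagonal column, which changes only modulo $\pi$ since
  the maximal elements of $I$ form an antichain.  The columns of the diagonal block prescribed in
  this way are extended to a matrix that is invertible modulo $\pi$.  Then $g$ is injective on the
  socle, where it is block triangular, hence injective, hence bijective because $R_\lambda$ is finite.
\<close>

section \<open>Extended naturals and the fundamental poset\<close>

text \<open>Everything is computed on lifts to R: an equality in R_n becomes a congruence modulo
  \<open>P n\<close>, and a valuation bound becomes membership in such an ideal, so powers of pi can
  be cancelled in a domain. The ideals J and K enter through one inclusion. They are the ideals of
  homomorphic images of m, so they lie in I; hence r_i is at least the boundary valuation for i
  outside S, and below lambda_i when finite. The obstacle is that J lives on the quotient by R
  e(I)', for which no decomposition is at hand; this is why I(e) is first described without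
  decompositions. The bound on r_i leaves two situations for i outside S. If m_i > r_i, the
  difference b_i - y a_i has exact valuation r_i and itself supplies the diagonal column. If m_i <=
  r_i, it lies in pi^(m_i): by condition (i), or under (iii) because m_i does not exceed the
  boundary valuation, which a_i and b_i already satisfy.\<close>

text \<open>\<open>val\<close> and \<open>coord_val\<close> are suprema of down-closed sets of
  exponents and are used only through this equivalence. If \<open>P v\<close> fails, then v > 0 by
  \<open>P 0\<close>, and v - 1 bounds the set.\<close>

lemma enat_le_Sup_iff:
  assumes "P 0" and "\<And>i j. P j \<Longrightarrow> i \<le> j \<Longrightarrow> P i"
  shows "enat v \<le> Sup {enat n |n. P n} \<longleftrightarrow> P v"
proof
  show "P v \<Longrightarrow> enat v \<le> Sup {enat n |n. P n}"
    by (rule Sup_upper) auto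
  assume le: "enat v \<le> Sup {enat n |n. P n}"
  show "P v"
  proof (rule ccontr)
    assume nP: "\<not> P v"
    then have "v > 0" using assms(1) by (cases v) auto
    have "Sup {enat n |n. P n} \<le> enat (v - 1)"
    proof (rule Sup_least, clarsimp)
      fix n assume "P n"
      then show "n \<le> v - Suc 0" using nP assms(2)[of n v] by (cases "v \<le> n") auto
    qed
    then have "enat v \<le> enat (v - 1)" using le by (rule order_trans[rotated])
    then show False using \<open>v > 0\<close> by simp
  qed
qed

text \<open>Turns an exact valuation into two divisibility statements.\<close>

lemma enat_eq_iff_le:
  fixes X :: enat
  shows "enat v = X \<longleftrightarrow> enat v \<le> X \<and> \<not> enat (Suc v) \<le> X"
  by (cases X) auto

lemma INF_enat_attained:
  fixes h :: "'i \<Rightarrow> enat"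
  assumes "(INF j\<in>A. h j) = enat \<mu>"
  obtains j where "j \<in> A" "h j = enat \<mu>"
proof -
  have "h ` A \<noteq> {}"
    using assms by (auto simp: Inf_enat_def)
  then have "(LEAST z. z \<in> h ` A) \<in> h ` A"
    by (metis LeastI ex_in_conv)
  moreover have "(INF j\<in>A. h j) = (LEAST z. z \<in> h ` A)"
    using \<open>h ` A \<noteq> {}\<close> by (simp add: Inf_enat_def)
  ultimately show ?thesis using assms that by auto
qed

text \<open>A class in $R_n$ lies in $\pi^e R_n$ iff its elements are divisible by $\pi$ to the power \<open>cap n e\<close>.\<close>

definition cap :: "nat \<Rightarrow> enat \<Rightarrow> nat" where
  "cap n e = the_enat (min e (enat n))"

lemma cap_simps [simp]: "cap n (enat v) = min v n" "cap n \<infinity> = n"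
  by (simp_all add: cap_def)

lemma cap_mono: "e \<le> e' \<Longrightarrow> cap n e \<le> cap n e'"
  by (cases e; cases e') auto

section \<open>Order ideals, their maximal elements and the boundary valuation\<close>

lemma fund_le_refl: "fund_le x x"
  by (cases x) (simp add: fund_le_def)

lemma fund_le_trans: "fund_le x y \<Longrightarrow> fund_le y z \<Longrightarrow> fund_le x z"
  by (cases x; cases y; cases z) (simp add: fund_le_def)

lemma generated_ideal_superset: "G \<subseteq> fund_poset \<Longrightarrow> G \<subseteq> generated_ideal G"
  using fund_le_refl by (auto simp: generated_ideal_def)

lemma max_elements_generated: "x \<in> max_elements (generated_ideal G) \<Longrightarrow> G \<subseteq> fund_poset \<Longrightarrow> x \<in> G"
  using generated_ideal_superset[of G] unfolding max_elements_def generated_ideal_def by blast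

lemma below_max_element:
  assumes "finite G" "G \<subseteq> fund_poset" "x \<in> generated_ideal G"
  obtains z where "z \<in> max_elements (generated_ideal G)" "fund_le x z"
proof -
  \<comment> \<open>l - 2v = (l - v) - v increases strictly along \<open>fund_le\<close> on the
    poset. So a generator above x that maximizes it is maximal in the whole ideal.\<close>
  define f where "f = (\<lambda>(v, l). int l - 2 * int v)"
  define B where "B = {g \<in> G. fund_le x g}"
  have "finite B" "B \<noteq> {}" using assms by (auto simp: B_def generated_ideal_def)
  then have "Max (f ` B) \<in> f ` B" by (intro Max_in) auto
  then obtain g where g: "g \<in> B" "f g = Max (f ` B)" by auto
  have gmax: "f h \<le> f g" if "h \<in> B" for h
    using that \<open>finite B\<close> g(2) by simp
  have "z = g" if z: "z \<in> generated_ideal G" "fund_le g z" for z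
  proof -
    obtain h where h: "h \<in> G" "fund_le z h" using z(1) by (auto simp: generated_ideal_def)
    then have "h \<in> B" using g(1) z(2) unfolding B_def by (blast intro: fund_le_trans)
    then have "f h \<le> f g" by (rule gmax)
    moreover have "g \<in> fund_poset" "z \<in> fund_poset" "h \<in> fund_poset"
      using g(1) z(1) h(1) assms(2) by (auto simp: B_def generated_ideal_def)
    ultimately show ?thesis using z(2) h(2)
      by (cases g; cases z; cases h) (auto simp: f_def fund_le_def fund_poset_def)
  qed
  moreover have "g \<in> generated_ideal G" using g(1) generated_ideal_superset[OF assms(2)] by (auto simp: B_def)
  ultimately have "g \<in> max_elements (generated_ideal G)" by (auto simp: max_elements_def)
  then show ?thesis using that g(1) by (auto simp: B_def)
qed

lemma partition_type_inj:
  "partition_type k lam rho \<Longrightarrow> i \<in> {1..k} \<Longrightarrow> j \<in> {1..k} \<Longrightarrow> lam i = lam j \<Longrightarrow> i = j"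
  unfolding partition_type_def by (metis less_irrefl linorder_neqE_nat)

text \<open>If this failed, (s i, lam i) would lie below (s j, lam j), although maximal elements
  form an antichain. Truncated subtraction covers both orders of i and j: for j < i the difference
  is 0.\<close>

lemma max_elements_separated:
  assumes "partition_type k lam rho" "S \<subseteq> {1..k}" "I \<subseteq> fund_poset"
    and mx: "max_elements I = {(s i, lam i) |i. i \<in> S}" and ij: "i \<in> S" "j \<in> S" "i \<noteq> j"
  shows "s i < lam i - lam j + s j"
proof (rule ccontr)
  assume "\<not> s i < lam i - lam j + s j"
  moreover have m: "(s i, lam i) \<in> max_elements I" "(s j, lam j) \<in> max_elements I"
    using mx ij by auto
  then have "s i < lam i" "s j < lam j" using assms(3) by (auto simp: max_elements_def fund_poset_def)
  ultimately have "fund_le (s i, lam i) (s j, lam j)" by (auto simp: fund_le_def)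
  then have "lam i = lam j" using m by (auto simp: max_elements_def)
  then show False using partition_type_inj[OF assms(1), of i j] ij assms(2) by blast
qed

lemma boundary_choice_in:
  "boundary_choice k lam S s \<iota> \<Longrightarrow> i \<in> {1..k} - S \<Longrightarrow> \<iota> i \<in> S"
  by (auto simp: boundary_choice_def)

text \<open>The two alternatives for \<open>\<iota> i\<close> have one formula, since the truncated
  difference is 0 when \<open>\<iota> i < i\<close>.\<close>

lemma boundary_val_choice:
  assumes "partition_type k lam rho" "S \<subseteq> {1..k}" "boundary_choice k lam S s \<iota>" and i: "i \<in> {1..k} - S"
  shows "boundary_val lam S s i = enat (lam i - lam (\<iota> i) + s (\<iota> i))"
proof -
  have j: "\<iota> i \<in> S" "\<iota> i < i \<and> boundary_val lam S s i = enat (s (\<iota> i)) \<or>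
      i < \<iota> i \<and> boundary_val lam S s i = enat (lam i - lam (\<iota> i) + s (\<iota> i))"
    using assms(3) i by (auto simp: boundary_choice_def)
  have "lam i - lam (\<iota> i) = 0" if "\<iota> i < i"
  proof -
    have "lam i < lam (\<iota> i)"
      using assms(1,2) j(1) i that by (auto simp: partition_type_def subset_eq)
    then show ?thesis by simp
  qed
  then show ?thesis using j(2) by auto
qed

lemma boundary_val_le:
  assumes i: "i \<notin> S" and j: "j \<in> S"
  shows "boundary_val lam S s i \<le> enat (lam i - lam j + s j)"
proof (cases "j < i")
  case True
  then have "boundary_val lam S s i \<le> enat (s j)"
    using j unfolding boundary_val_def by (intro min.coboundedI1 INF_lower) simp
  then show ?thesis by (rule order_trans) simp
next
  case False
  then have "i < j" using i j by (cases "i = j") auto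
  then show ?thesis
    using j unfolding boundary_val_def by (intro min.coboundedI2 INF_lower) simp
qed

lemma summands'_subset:
  "partition_type k lam rho \<Longrightarrow> S \<subseteq> {1..k} \<Longrightarrow> summands' S \<subseteq> summands k rho"
  by (auto simp: summands'_def summands_def partition_type_def)

section \<open>Modules\<close>

lemma module_homI:
  assumes "\<And>x. x \<in> carrier M \<Longrightarrow> h x \<in> carrier N"
    and "\<And>x y. x \<in> carrier M \<Longrightarrow> y \<in> carrier M \<Longrightarrow> h (x \<oplus>\<^bsub>M\<^esub> y) = h x \<oplus>\<^bsub>N\<^esub> h y"
    and "\<And>r x. r \<in> carrier R \<Longrightarrow> x \<in> carrier M \<Longrightarrow> h (r \<odot>\<^bsub>M\<^esub> x) = r \<odot>\<^bsub>N\<^esub> h x"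
  shows "h \<in> module_hom R M N"
  using assms by (auto simp: module_hom_def hom_def)

lemma module_homD:
  assumes "h \<in> module_hom R M N"
  shows "x \<in> carrier M \<Longrightarrow> h x \<in> carrier N"
    and "x \<in> carrier M \<Longrightarrow> y \<in> carrier M \<Longrightarrow> h (x \<oplus>\<^bsub>M\<^esub> y) = h x \<oplus>\<^bsub>N\<^esub> h y"
    and "r \<in> carrier R \<Longrightarrow> x \<in> carrier M \<Longrightarrow> h (r \<odot>\<^bsub>M\<^esub> x) = r \<odot>\<^bsub>N\<^esub> h x"
  using assms by (auto simp: module_hom_def hom_def)

lemma module_hom_comp:
  "h \<in> module_hom R M N \<Longrightarrow> g \<in> module_hom R N Q \<Longrightarrow> g \<circ> h \<in> module_hom R M Q"
  by (rule module_homI) (simp_all add: module_homD)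

lemma module_hom_zero:
  assumes "module R M" "module R N" "h \<in> module_hom R M N"
  shows "h \<zero>\<^bsub>M\<^esub> = \<zero>\<^bsub>N\<^esub>"
proof -
  interpret M: module R M by fact
  interpret N: module R N by fact
  have "h (\<zero>\<^bsub>R\<^esub> \<odot>\<^bsub>M\<^esub> \<zero>\<^bsub>M\<^esub>) = \<zero>\<^bsub>R\<^esub> \<odot>\<^bsub>N\<^esub> h \<zero>\<^bsub>M\<^esub>"
    by (rule module_homD(3)[OF assms(3)]) simp_all
  then show ?thesis using module_homD(1)[OF assms(3), of "\<zero>\<^bsub>M\<^esub>"] by simp
qed

lemma module_direct_sum:
  assumes "cring R" "\<And>i. i \<in> A \<Longrightarrow> module R (M i)"
  shows "module R (direct_sum A M)"
proof (rule moduleI)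
  have ag: "abelian_group (M i)" if "i \<in> A" for i
    using assms(2)[OF that] by (rule module.axioms(2))
  show "abelian_group (direct_sum A M)"
  proof (rule abelian_groupI)
    show "\<exists>y\<in>carrier (direct_sum A M). y \<oplus>\<^bsub>direct_sum A M\<^esub> x = \<zero>\<^bsub>direct_sum A M\<^esub>"
      if "x \<in> carrier (direct_sum A M)" for x
      using that
      by (intro bexI[of _ "\<lambda>i\<in>A. \<ominus>\<^bsub>M i\<^esub> x i"])
        (auto simp: direct_sum_def PiE_iff fun_eq_iff abelian_group.l_neg[OF ag] abelian_group.a_inv_closed[OF ag])
    fix x y z
    assume x: "x \<in> carrier (direct_sum A M)" and y: "y \<in> carrier (direct_sum A M)"
    show "x \<oplus>\<^bsub>direct_sum A M\<^esub> y \<in> carrier (direct_sum A M)"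
      "\<zero>\<^bsub>direct_sum A M\<^esub> \<oplus>\<^bsub>direct_sum A M\<^esub> x = x"
      using x y by (auto simp: direct_sum_def PiE_iff fun_eq_iff extensional_def ag
          abelian_groupE(1) abelian_groupE(5))
    show "x \<oplus>\<^bsub>direct_sum A M\<^esub> y = y \<oplus>\<^bsub>direct_sum A M\<^esub> x"
      using x y by (auto simp: direct_sum_def PiE_iff fun_eq_iff abelian_groupE(4)[OF ag])
    assume "z \<in> carrier (direct_sum A M)"
    then show "x \<oplus>\<^bsub>direct_sum A M\<^esub> y \<oplus>\<^bsub>direct_sum A M\<^esub> z =
        x \<oplus>\<^bsub>direct_sum A M\<^esub> (y \<oplus>\<^bsub>direct_sum A M\<^esub> z)"
      using x y by (auto simp: direct_sum_def PiE_iff fun_eq_iff abelian_groupE(3)[OF ag])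
  qed (auto simp: direct_sum_def PiE_iff fun_eq_iff extensional_def abelian_groupE(2)[OF ag])
qed (auto simp: assms(1) direct_sum_def PiE_iff fun_eq_iff extensional_def
    module.smult_closed[OF assms(2)] module.smult_l_distr[OF assms(2)] module.smult_r_distr[OF assms(2)]
    module.smult_assoc1[OF assms(2)] module.smult_one[OF assms(2)])

lemma module_hom_restrict:
  assumes "B \<subseteq> A"
  shows "(\<lambda>x. restrict x B) \<in> module_hom R (direct_sum A M) (direct_sum B M)"
  using assms by (intro module_homI) (auto simp: direct_sum_def PiE_iff fun_eq_iff)

lemma module_hom_quotient:
  assumes "module R M" "abelian_subgroup N M"
    and "\<And>r x. r \<in> carrier R \<Longrightarrow> x \<in> N \<Longrightarrow> r \<odot>\<^bsub>M\<^esub> x \<in> N"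
  shows "(\<lambda>x. N +>\<^bsub>M\<^esub> x) \<in> module_hom R M (quotient_module M N)"
proof (rule module_homI)
  interpret M: module R M by fact
  interpret N: abelian_subgroup N M by fact
  fix x assume x: "x \<in> carrier M"
  show "N +>\<^bsub>M\<^esub> x \<in> carrier (quotient_module M N)"
    using x M.a_rcosetsI[OF N.a_subset] by (simp add: quotient_module_def)
  show "N +>\<^bsub>M\<^esub> (x \<oplus>\<^bsub>M\<^esub> y) = (N +>\<^bsub>M\<^esub> x) \<oplus>\<^bsub>quotient_module M N\<^esub> (N +>\<^bsub>M\<^esub> y)"
    if "y \<in> carrier M" for y
    using x that N.a_rcos_sum by (simp add: quotient_module_def)
  fix r assume r: "r \<in> carrier R"
  \<comment> \<open>Scalar multiplication on the quotient is a union of cosets over all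
    representatives; these cosets coincide.\<close>
  have "N +>\<^bsub>M\<^esub> (r \<odot>\<^bsub>M\<^esub> x') = N +>\<^bsub>M\<^esub> (r \<odot>\<^bsub>M\<^esub> x)" if x': "x' \<in> N +>\<^bsub>M\<^esub> x" for x'
  proof -
    obtain z where z: "z \<in> N" "x' = z \<oplus>\<^bsub>M\<^esub> x" using x' by (auto simp: a_r_coset_def')
    then have "r \<odot>\<^bsub>M\<^esub> x' = r \<odot>\<^bsub>M\<^esub> z \<oplus>\<^bsub>M\<^esub> r \<odot>\<^bsub>M\<^esub> x"
      using x r by (simp add: M.smult_r_distr)
    then have "r \<odot>\<^bsub>M\<^esub> x' \<in> N +>\<^bsub>M\<^esub> (r \<odot>\<^bsub>M\<^esub> x)"
      using assms(3)[OF r z(1)] by (auto simp: a_r_coset_def')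
    then show ?thesis using N.a_repr_independence'[of "r \<odot>\<^bsub>M\<^esub> x'" "r \<odot>\<^bsub>M\<^esub> x"] x r by simp
  qed
  moreover have "x \<in> N +>\<^bsub>M\<^esub> x" using x by (rule N.a_rcos_self)
  ultimately have "(\<Union>x'\<in>N +>\<^bsub>M\<^esub> x. N +>\<^bsub>M\<^esub> (r \<odot>\<^bsub>M\<^esub> x')) = N +>\<^bsub>M\<^esub> (r \<odot>\<^bsub>M\<^esub> x)"
    by (intro UN_constant_eq ballI)
  then show "N +>\<^bsub>M\<^esub> (r \<odot>\<^bsub>M\<^esub> x) = r \<odot>\<^bsub>quotient_module M N\<^esub> (N +>\<^bsub>M\<^esub> x)"
    by (simp add: quotient_module_def)
qed

lemma cyclic_submodule_subgroup:
  assumes "module R M" "e \<in> carrier M"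
  shows "abelian_subgroup (cyclic_submodule R M e) M"
    and "\<And>r x. r \<in> carrier R \<Longrightarrow> x \<in> cyclic_submodule R M e \<Longrightarrow> r \<odot>\<^bsub>M\<^esub> x \<in> cyclic_submodule R M e"
proof -
  interpret M: module R M by fact
  have "additive_subgroup (cyclic_submodule R M e) M"
  proof (rule additive_subgroup.intro, rule M.add.subgroupI)
    show "cyclic_submodule R M e \<subseteq> carrier M" using assms(2) by (auto simp: cyclic_submodule_def)
    show "cyclic_submodule R M e \<noteq> {}" by (auto simp: cyclic_submodule_def)
    show "\<ominus>\<^bsub>M\<^esub> a \<in> cyclic_submodule R M e" if a: "a \<in> cyclic_submodule R M e" for a
    proof -
      obtain r where r: "r \<in> carrier R" "a = r \<odot>\<^bsub>M\<^esub> e" using a by (auto simp: cyclic_submodule_def)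
      then have "\<ominus>\<^bsub>M\<^esub> a = (\<ominus>\<^bsub>R\<^esub> r) \<odot>\<^bsub>M\<^esub> e" using assms(2) by (simp add: M.smult_l_minus)
      moreover have "\<ominus>\<^bsub>R\<^esub> r \<in> carrier R" using r by simp
      ultimately show ?thesis by (auto simp: cyclic_submodule_def)
    qed
    show "a \<oplus>\<^bsub>M\<^esub> b \<in> cyclic_submodule R M e"
      if ab: "a \<in> cyclic_submodule R M e" "b \<in> cyclic_submodule R M e" for a b
    proof -
      obtain r t where r: "r \<in> carrier R" "a = r \<odot>\<^bsub>M\<^esub> e" "t \<in> carrier R" "b = t \<odot>\<^bsub>M\<^esub> e"
        using ab by (auto simp: cyclic_submodule_def)
      then have "a \<oplus>\<^bsub>M\<^esub> b = (r \<oplus>\<^bsub>R\<^esub> t) \<odot>\<^bsub>M\<^esub> e" using assms(2) by (simp add: M.smult_l_distr)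
      moreover have "r \<oplus>\<^bsub>R\<^esub> t \<in> carrier R" using r by simp
      ultimately show ?thesis by (auto simp: cyclic_submodule_def)
    qed
  qed
  then show "abelian_subgroup (cyclic_submodule R M e) M"
    by (rule abelian_subgroupI3) unfold_locales
  fix r x assume r: "r \<in> carrier R" and "x \<in> cyclic_submodule R M e"
  then obtain t where t: "t \<in> carrier R" "x = t \<odot>\<^bsub>M\<^esub> e" by (auto simp: cyclic_submodule_def)
  then have "r \<odot>\<^bsub>M\<^esub> x = (r \<otimes>\<^bsub>R\<^esub> t) \<odot>\<^bsub>M\<^esub> e" using r assms(2) by (simp add: M.smult_assoc1)
  moreover have "r \<otimes>\<^bsub>R\<^esub> t \<in> carrier R" using r t by simp
  ultimately show "r \<odot>\<^bsub>M\<^esub> x \<in> cyclic_submodule R M e" by (auto simp: cyclic_submodule_def)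
qed

section \<open>Discrete valuation rings\<close>

text \<open>The form in which a discrete valuation ring is used from here on: a domain with a
  nonzero nonunit that divides every nonunit.\<close>

locale dvr = domain R for R (structure) +
  fixes \<pi>
  assumes pi_closed [simp, intro]: "\<pi> \<in> carrier R"
    and pi_nonzero: "\<pi> \<noteq> \<zero>"
    and pi_not_unit: "\<pi> \<notin> Units R"
    and unit_if_not_dvd: "x \<in> carrier R \<Longrightarrow> \<not> \<pi> divides x \<Longrightarrow> x \<in> Units R"

text \<open>A nonzero nonunit has an irreducible divisor p. In a principal domain
  \<open>PIdl p\<close> is maximal, so it is the unique maximal ideal \<open>PIdl \<pi>\<close>, and
  p is divisible by the uniformizer.\<close>

lemma (in principal_domain) uniformizer_dvd_nonunit:
  assumes "\<exists>!M. maximalideal M R" "uniformizer R \<pi>" "x \<in> carrier R" "x \<notin> Units R"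
  shows "\<pi> divides x"
proof (cases "x = \<zero>")
  case True
  then show ?thesis using assms(2) by (auto simp: uniformizer_def factor_def intro!: bexI[of _ \<zero>])
next
  case False
  then obtain p where p: "p \<in> carrier R" "ring_irreducible p" "p divides x"
    using exists_irreducible_divisor[of x] assms by blast
  have "maximalideal (PIdl p) R" by (rule irreducible_imp_maximalideal[OF p(1,2)])
  then have "PIdl p = PIdl \<pi>" using assms(1,2) by (auto simp: uniformizer_def)
  then have "\<pi> divides p"
    using p(1) assms(2) to_contain_is_to_divide by (metis subset_refl uniformizer_def)
  then show ?thesis using p(1,3) assms(2,3) divides_trans by (meson uniformizer_def)
qed

lemma dvr_of_discrete_valuation_ring:
  fixes R (structure)
  assumes "discrete_valuation_ring R" "uniformizer R \<pi>"
  shows "dvr R \<pi>"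
proof -
  interpret principal_domain R using assms(1) by (simp add: discrete_valuation_ring_def)
  have pi: "\<pi> \<in> carrier R" "maximalideal (PIdl \<pi>) R" using assms(2) by (auto simp: uniformizer_def)
  show ?thesis
  proof
    show "\<pi> \<in> carrier R" by fact
    show "\<pi> \<noteq> \<zero>"
    proof
      assume "\<pi> = \<zero>"
      then have "PIdl \<pi> = {\<zero>}" by (auto simp: cgenideal_def intro!: exI[of _ \<zero>])
      then show False
        using pi(2) assms(1) zeromaximalideal_eq_field by (simp add: discrete_valuation_ring_def)
    qed
    show "\<pi> \<notin> Units R"
      using ideal_eq_carrier_iff[OF pi(1)] maximalideal.I_notcarr[OF pi(2)] by auto
    show "x \<in> Units R" if "x \<in> carrier R" "\<not> \<pi> divides x" for x
      using that uniformizer_dvd_nonunit assms by (auto simp: discrete_valuation_ring_def)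
  qed
qed

context dvr
begin

section \<open>The ideals generated by the powers of pi\<close>

definition P :: "nat \<Rightarrow> 'a set" where
  "P n = PIdl (\<pi> [^] n)"

lemma P_iff: "x \<in> P n \<longleftrightarrow> (\<exists>w\<in>carrier R. x = \<pi> [^] n \<otimes> w)"
  by (auto simp: P_def cgenideal_def m_comm)

lemma P_ideal: "ideal (P n) R"
  unfolding P_def by (rule cgenideal_ideal) simp

lemma P_carrier: "x \<in> P n \<Longrightarrow> x \<in> carrier R"
  by (auto simp: P_iff)

lemma P_zero [simp]: "\<zero> \<in> P n"
  by (rule additive_subgroup.zero_closed[OF ideal.axioms(1)[OF P_ideal]])

lemma P_add [simp]: "x \<in> P n \<Longrightarrow> y \<in> P n \<Longrightarrow> x \<oplus> y \<in> P n"
  by (rule additive_subgroup.a_closed[OF ideal.axioms(1)[OF P_ideal]])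

lemma P_neg [simp]: "x \<in> P n \<Longrightarrow> \<ominus> x \<in> P n"
  by (rule additive_subgroup.a_inv_closed[OF ideal.axioms(1)[OF P_ideal]])

lemma P_minus [simp]: "x \<in> P n \<Longrightarrow> y \<in> P n \<Longrightarrow> x \<ominus> y \<in> P n"
  by (simp add: minus_eq P_add P_neg)

lemma P_mult_l [simp]: "x \<in> P n \<Longrightarrow> r \<in> carrier R \<Longrightarrow> r \<otimes> x \<in> P n"
  by (rule ideal.I_l_closed[OF P_ideal])

lemma P_mult_r [simp]: "x \<in> P n \<Longrightarrow> r \<in> carrier R \<Longrightarrow> x \<otimes> r \<in> P n"
  by (rule ideal.I_r_closed[OF P_ideal])

lemma P_0 [simp]: "P 0 = carrier R"
  by (auto simp: P_iff intro: bexI[of _ _])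

lemma P_mult: "x \<in> P m \<Longrightarrow> y \<in> P n \<Longrightarrow> x \<otimes> y \<in> P (m + n)"
proof -
  assume "x \<in> P m" "y \<in> P n"
  then obtain v w where "v \<in> carrier R" "w \<in> carrier R" "x = \<pi> [^] m \<otimes> v" "y = \<pi> [^] n \<otimes> w"
    by (auto simp: P_iff)
  then have "x \<otimes> y = \<pi> [^] (m + n) \<otimes> (v \<otimes> w)" by (simp add: nat_pow_mult[symmetric] m_ac)
  then show ?thesis using \<open>v \<in> _\<close> \<open>w \<in> _\<close> by (auto simp: P_iff)
qed

lemma P_pow [simp]: "\<pi> [^] n \<in> P n"
  by (auto simp: P_iff intro!: bexI[of _ \<one>])

lemma P_antimono: "m \<le> n \<Longrightarrow> P n \<subseteq> P m"
proof
  fix x assume "m \<le> n" "x \<in> P n"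
  then obtain w where "w \<in> carrier R" "x = \<pi> [^] n \<otimes> w" by (auto simp: P_iff)
  moreover have "\<pi> [^] n = \<pi> [^] m \<otimes> \<pi> [^] (n - m)" using \<open>m \<le> n\<close> by (simp add: nat_pow_mult)
  ultimately show "x \<in> P m" by (auto simp: P_iff m_assoc)
qed

lemma P_mono_elem: "x \<in> P n \<Longrightarrow> m \<le> n \<Longrightarrow> x \<in> P m"
  by (rule subsetD[OF P_antimono])

lemma P_pow_mult: "m \<le> n \<Longrightarrow> \<pi> [^] m \<otimes> w \<in> P n \<longleftrightarrow> w \<in> P (n - m)" if "w \<in> carrier R"
proof
  assume "m \<le> n"
  then have eq: "\<pi> [^] n = \<pi> [^] m \<otimes> \<pi> [^] (n - m)" by (simp add: nat_pow_mult)
  show "w \<in> P (n - m) \<Longrightarrow> \<pi> [^] m \<otimes> w \<in> P n"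
    using P_mult[OF P_pow, of w "n - m" m] \<open>m \<le> n\<close> by simp
  assume "\<pi> [^] m \<otimes> w \<in> P n"
  then obtain v where v: "v \<in> carrier R" "\<pi> [^] m \<otimes> w = \<pi> [^] m \<otimes> (\<pi> [^] (n - m) \<otimes> v)"
    by (auto simp: P_iff eq m_assoc)
  have "\<pi> [^] m \<noteq> \<zero>" using pi_nonzero
    by (induction m) (auto simp: integral_iff)
  then have "w = \<pi> [^] (n - m) \<otimes> v" using v that by (simp add: m_lcancel)
  then show "w \<in> P (n - m)" using v by (auto simp: P_iff)
qed

lemma P_1_unit: "x \<in> carrier R \<Longrightarrow> x \<in> Units R \<longleftrightarrow> x \<notin> P 1"
proof
  assume x: "x \<in> carrier R"
  show "x \<notin> P 1 \<Longrightarrow> x \<in> Units R"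
    using unit_if_not_dvd[OF x] by (auto simp: P_iff factor_def)
  assume "x \<in> Units R"
  show "x \<notin> P 1"
  proof
    assume "x \<in> P 1"
    then obtain w where "w \<in> carrier R" "x = \<pi> \<otimes> w" by (auto simp: P_iff)
    then have "\<pi> \<in> Units R" using \<open>x \<in> Units R\<close> unit_factor[of \<pi> w] by simp
    then show False using pi_not_unit by simp
  qed
qed

lemma unit_mult_P: "u \<in> Units R \<Longrightarrow> x \<in> carrier R \<Longrightarrow> u \<otimes> x \<in> P n \<longleftrightarrow> x \<in> P n"
proof
  assume u: "u \<in> Units R" and x: "x \<in> carrier R"
  show "x \<in> P n \<Longrightarrow> u \<otimes> x \<in> P n" using u by auto
  assume "u \<otimes> x \<in> P n"
  then have "inv u \<otimes> (u \<otimes> x) \<in> P n" using u by auto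
  then show "x \<in> P n" using u x by (simp add: m_assoc[symmetric] Units_closed)
qed

lemma P_exact_unit:
  assumes "x \<in> P v" "x \<notin> P (Suc v)"
  obtains u where "u \<in> Units R" "x = \<pi> [^] v \<otimes> u"
proof -
  obtain u where u: "u \<in> carrier R" "x = \<pi> [^] v \<otimes> u" using assms(1) by (auto simp: P_iff)
  then have "u \<notin> P 1" using assms(2) P_pow_mult[of u v "Suc v"] by auto
  then show ?thesis using that u P_1_unit by auto
qed

lemma val_iff: "x \<in> carrier R \<Longrightarrow> enat v \<le> val R \<pi> x \<longleftrightarrow> x \<in> P v"
proof -
  assume x: "x \<in> carrier R"
  have eq: "(\<pi> [^] n) divides x \<longleftrightarrow> x \<in> P n" for n by (auto simp: P_iff factor_def)
  show ?thesis unfolding val_def eq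
  proof (rule enat_le_Sup_iff)
    show "x \<in> P 0" using x by simp
    show "x \<in> P i" if "x \<in> P j" "i \<le> j" for i j using that by (rule P_mono_elem)
  qed
qed

lemma add_in_P_iff:
  assumes "x \<in> P n" "y \<in> carrier R"
  shows "x \<oplus> y \<in> P n \<longleftrightarrow> y \<in> P n"
proof
  assume "x \<oplus> y \<in> P n"
  then have "\<ominus> x \<oplus> (x \<oplus> y) \<in> P n" using assms by simp
  then show "y \<in> P n" using assms P_carrier[OF assms(1)] by (simp add: a_assoc[symmetric] l_neg)
qed (use assms in simp)

lemma unit_add_P1:
  assumes "u \<in> Units R" "x \<in> P 1"
  shows "u \<oplus> x \<in> Units R"
proof -
  have c: "u \<in> carrier R" "x \<in> carrier R" using assms P_carrier by (auto simp: Units_closed)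
  then have "u \<oplus> x \<notin> P 1"
    using add_in_P_iff[OF assms(2), of u] P_1_unit[of u] assms(1) by (simp add: a_comm)
  then show ?thesis using c P_1_unit[of "u \<oplus> x"] by simp
qed

lemma val_attained:
  assumes "x \<in> carrier R" "val R \<pi> x = enat v"
  obtains u where "u \<in> Units R" "x = \<pi> [^] v \<otimes> u"
proof (rule P_exact_unit)
  show "x \<in> P v" "x \<notin> P (Suc v)"
    using assms val_iff[of x v] val_iff[of x "Suc v"] by simp_all
qed (rule that)

lemma pi_pow_closed [simp]: "pi_pow R \<pi> e \<in> carrier R"
  by (cases e) (simp_all add: pi_pow_def)

lemma pi_pow_cap: "pi_pow R \<pi> e \<in> P (cap n e)"
  by (cases e) (simp_all add: pi_pow_def P_mono_elem[OF P_pow])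

subsection \<open>Sums of cyclic modules\<close>

text \<open>The class in R_n of a lift x; a short name for \<open>residue_class\<close> with the
  ring and the uniformizer fixed.\<close>

definition cl :: "nat \<Rightarrow> 'a \<Rightarrow> 'a set" where
  "cl n x = residue_class R \<pi> n x"

lemma cl_alt: "cl n x = P n +> x"
  by (simp add: cl_def residue_class_def P_def)

lemma cl_eq_iff: "x \<in> carrier R \<Longrightarrow> y \<in> carrier R \<Longrightarrow> cl n x = cl n y \<longleftrightarrow> x \<ominus> y \<in> P n"
  unfolding cl_alt using P_ideal[of n]
  by (metis abelian_subgroup.a_rcos_module_minus abelian_subgroup.a_rcos_self abelian_subgroup.a_repr_independence' abelian_subgroupI3 abelian_group_axioms ideal.axioms(1) ring_axioms)

abbreviation "Z n \<equiv> Rn R \<pi> n"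

lemma carrier_Rn: "carrier (Z n) = cl n ` carrier R"
  by (auto simp: Rn_def Let_def FactRing_def A_RCOSETS_def' cl_alt P_def)

lemma cl_closed [simp, intro]: "x \<in> carrier R \<Longrightarrow> cl n x \<in> carrier (Z n)"
  by (simp add: carrier_Rn)

lemma RnE: "z \<in> carrier (Z n) \<Longrightarrow> (\<And>x. x \<in> carrier R \<Longrightarrow> z = cl n x \<Longrightarrow> thesis) \<Longrightarrow> thesis"
  by (auto simp: carrier_Rn)

lemma cl_add: "x \<in> carrier R \<Longrightarrow> y \<in> carrier R \<Longrightarrow> cl n x \<oplus>\<^bsub>Z n\<^esub> cl n y = cl n (x \<oplus> y)"
  using ring_hom_add[OF ideal.rcos_ring_hom[OF P_ideal]]
  by (simp add: Rn_def Let_def cl_alt P_def)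

lemma cl_smult: "x \<in> carrier R \<Longrightarrow> y \<in> carrier R \<Longrightarrow> x \<odot>\<^bsub>Z n\<^esub> cl n y = cl n (x \<otimes> y)"
  using ring_hom_mult[OF ideal.rcos_ring_hom[OF P_ideal]]
  by (simp add: Rn_def Let_def cl_alt residue_class_def P_def)

lemma zero_Rn: "\<zero>\<^bsub>Z n\<^esub> = cl n \<zero>"
  by (simp add: Rn_def Let_def cl_alt FactRing_def P_def)
    (metis P_def P_ideal abelian_group.a_coset_add_zero additive_subgroup.a_subset ideal.axioms(1) abelian_group_axioms)

lemma cl_eq_zero: "x \<in> carrier R \<Longrightarrow> cl n x = cl n \<zero> \<longleftrightarrow> x \<in> P n"
  by (simp add: cl_eq_iff minus_eq)

lemma module_Rn: "module R (Z n)"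
proof (rule moduleI)
  show "cring R" by (rule is_cring)
  show "abelian_group (Z n)"
  proof (rule abelian_groupI)
    show "\<exists>y\<in>carrier (Z n). y \<oplus>\<^bsub>Z n\<^esub> x = \<zero>\<^bsub>Z n\<^esub>" if x: "x \<in> carrier (Z n)" for x
      using x
    proof (rule RnE)
      fix w assume "w \<in> carrier R" "x = cl n w"
      then show ?thesis by (intro bexI[of _ "cl n (\<ominus> w)"]) (simp_all add: cl_add l_neg zero_Rn)
    qed
  qed ((elim RnE, simp add: cl_add zero_Rn a_assoc; fail | elim RnE, simp add: cl_add a_comm | simp add: zero_Rn)+)
qed (elim RnE, simp add: cl_add cl_smult l_distr r_distr m_assoc)+

text \<open>X is a lift to R of an element of a sum of cyclic modules. It has values at all indices,
  not only in A, so that closure can be assumed for every index.\<close>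

definition clv :: "(nat \<Rightarrow> nat) \<Rightarrow> (nat \<times> nat) set \<Rightarrow> (nat \<times> nat \<Rightarrow> 'a) \<Rightarrow> nat \<times> nat \<Rightarrow> 'a set" where
  "clv lam A X = (\<lambda>t\<in>A. cl (lam (fst t)) (X t))"

lemma module_Rsum: "module R (Rsum R \<pi> lam A)"
  unfolding Rsum_def by (rule module_direct_sum) (auto simp: module_Rn is_cring)

lemma clv_closed: "(\<And>t. X t \<in> carrier R) \<Longrightarrow> clv lam A X \<in> carrier (Rsum R \<pi> lam A)"
  by (auto simp: clv_def Rsum_def direct_sum_def)

lemma RsumE:
  assumes "x \<in> carrier (Rsum R \<pi> lam A)"
  obtains X where "\<And>t. X t \<in> carrier R" "x = clv lam A X"
proof -
  have x: "x \<in> extensional A" "\<And>t. t \<in> A \<Longrightarrow> x t \<in> carrier (Z (lam (fst t)))"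
    using assms by (auto simp: Rsum_def direct_sum_def PiE_def split_def)
  define X where "X t = (if t \<in> A then SOME w. w \<in> carrier R \<and> x t = cl (lam (fst t)) w else \<zero>)" for t
  have X: "X t \<in> carrier R \<and> x t = cl (lam (fst t)) (X t)" if "t \<in> A" for t
    using someI_ex[of "\<lambda>w. w \<in> carrier R \<and> x t = cl (lam (fst t)) w"] x(2)[OF that] that
    by (auto simp: X_def carrier_Rn)
  have "x = clv lam A X"
  proof
    fix t
    show "x t = clv lam A X t"
      using X[of t] extensional_arb[OF x(1), of t] by (cases "t \<in> A") (simp_all add: clv_def)
  qed
  moreover have "X t \<in> carrier R" for t using X[of t] by (cases "t \<in> A") (simp_all add: X_def)
  ultimately show ?thesis by (rule that[rotated])
qed

lemma clv_eq_iff: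
  assumes "\<And>t. X t \<in> carrier R" "\<And>t. Y t \<in> carrier R"
  shows "clv lam A X = clv lam A Y \<longleftrightarrow> (\<forall>t\<in>A. X t \<ominus> Y t \<in> P (lam (fst t)))"
proof -
  have "clv lam A X = clv lam A Y \<longleftrightarrow> (\<forall>t\<in>A. cl (lam (fst t)) (X t) = cl (lam (fst t)) (Y t))"
    by (auto simp: clv_def fun_eq_iff restrict_def)
  then show ?thesis using assms by (simp add: cl_eq_iff)
qed

lemma clv_add:
  assumes "\<And>t. X t \<in> carrier R" "\<And>t. Y t \<in> carrier R"
  shows "clv lam A X \<oplus>\<^bsub>Rsum R \<pi> lam A\<^esub> clv lam A Y = clv lam A (\<lambda>t. X t \<oplus> Y t)"
  using assms by (auto simp: clv_def Rsum_def direct_sum_def cl_add fun_eq_iff)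

lemma clv_smult:
  assumes "r \<in> carrier R" "\<And>t. X t \<in> carrier R"
  shows "r \<odot>\<^bsub>Rsum R \<pi> lam A\<^esub> clv lam A X = clv lam A (\<lambda>t. r \<otimes> X t)"
  using assms by (auto simp: clv_def Rsum_def direct_sum_def cl_smult fun_eq_iff)

lemma clv_zero: "\<zero>\<^bsub>Rsum R \<pi> lam A\<^esub> = clv lam A (\<lambda>_. \<zero>)"
  by (auto simp: clv_def Rsum_def direct_sum_def zero_Rn fun_eq_iff)

lemma clv_eq_zero:
  assumes "\<And>t. X t \<in> carrier R"
  shows "clv lam A X = \<zero>\<^bsub>Rsum R \<pi> lam A\<^esub> \<longleftrightarrow> (\<forall>t\<in>A. X t \<in> P (lam (fst t)))"
  using assms by (simp add: clv_zero clv_eq_iff minus_eq)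

text \<open>The identity pi^r R + pi^n R = pi^min(r,n) R. It allows membership of a class in pi^r
  R_n to be read off from any lift.\<close>

lemma P_min_iff:
  assumes "x \<in> carrier R"
  shows "x \<in> P (min r n) \<longleftrightarrow> (\<exists>w\<in>carrier R. x \<ominus> \<pi> [^] r \<otimes> w \<in> P n)"
proof
  assume x: "x \<in> P (min r n)"
  show "\<exists>w\<in>carrier R. x \<ominus> \<pi> [^] r \<otimes> w \<in> P n"
  proof (cases "r \<le> n")
    case True
    then obtain w where "w \<in> carrier R" "x = \<pi> [^] r \<otimes> w" using x by (auto simp: P_iff)
    then show ?thesis by (intro bexI[of _ w]) (simp_all add: minus_eq r_neg)
  next
    case False
    then show ?thesis using x assms by (intro bexI[of _ \<zero>]) (simp_all add: minus_eq)
  qed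
next
  assume "\<exists>w\<in>carrier R. x \<ominus> \<pi> [^] r \<otimes> w \<in> P n"
  then obtain w where w: "w \<in> carrier R" "x \<ominus> \<pi> [^] r \<otimes> w \<in> P n" by blast
  have "x = (x \<ominus> \<pi> [^] r \<otimes> w) \<oplus> \<pi> [^] r \<otimes> w"
    using assms w(1) by (simp add: minus_eq a_assoc l_neg)
  moreover have "x \<ominus> \<pi> [^] r \<otimes> w \<in> P (min r n)" by (rule P_mono_elem[OF w(2)]) simp
  moreover have "\<pi> [^] r \<otimes> w \<in> P (min r n)" by (rule P_mono_elem[of _ r]) (simp_all add: w)
  ultimately show "x \<in> P (min r n)" by (metis P_add)
qed

lemma pi_multiples_Rn_iff:
  assumes "x \<in> carrier R"
  shows "cl n x \<in> pi_multiples R \<pi> (Z n) (enat r) \<longleftrightarrow> x \<in> P (min r n)"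
  unfolding P_min_iff[OF assms]
  using assms by (auto simp: pi_multiples_def pi_pow_def carrier_Rn image_iff cl_smult cl_eq_iff)

lemma coord_val_iff:
  assumes "x \<in> carrier R"
  shows "enat v \<le> coord_val R \<pi> n (cl n x) \<longleftrightarrow> x \<in> P (min v n)"
  unfolding coord_val_def pi_multiples_Rn_iff[OF assms]
proof (rule enat_le_Sup_iff)
  show "x \<in> P (min 0 n)" using assms by simp
  show "x \<in> P (min i n)" if "x \<in> P (min j n)" "i \<le> j" for i j
    by (rule P_mono_elem[OF that(1)]) (use that in simp)
qed

lemma INF_coord_val_iff:
  assumes "\<And>p. p \<in> B \<Longrightarrow> X p \<in> carrier R"
  shows "enat v \<le> (INF p\<in>B. coord_val R \<pi> n (cl n (X p))) \<longleftrightarrow> (\<forall>p\<in>B. X p \<in> P (min v n))"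
  using assms by (simp add: le_INF_iff coord_val_iff)

section \<open>Vectors over R_n and their reductions modulo pi\<close>

definition vec :: "nat \<Rightarrow> nat \<Rightarrow> (nat \<Rightarrow> 'a) \<Rightarrow> nat \<Rightarrow> 'a set" where
  "vec n \<rho> X = (\<lambda>p\<in>{1..\<rho>}. cl n (X p))"

lemma module_Rn_pow: "module R (Rn_pow R \<pi> n \<rho>)"
  unfolding Rn_pow_def by (rule module_direct_sum[OF is_cring module_Rn])

lemma vec_closed: "(\<And>p. X p \<in> carrier R) \<Longrightarrow> vec n \<rho> X \<in> carrier (Rn_pow R \<pi> n \<rho>)"
  by (auto simp: vec_def Rn_pow_def direct_sum_def)

lemma Rn_powE:
  assumes "x \<in> carrier (Rn_pow R \<pi> n \<rho>)"
  obtains X where "\<And>p. X p \<in> carrier R" "x = vec n \<rho> X"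
proof -
  have x: "x \<in> extensional {1..\<rho>}" "\<And>p. p \<in> {1..\<rho>} \<Longrightarrow> x p \<in> carrier (Z n)"
    using assms by (auto simp: Rn_pow_def direct_sum_def PiE_def)
  define X where "X p = (if p \<in> {1..\<rho>} then SOME w. w \<in> carrier R \<and> x p = cl n w else \<zero>)" for p
  have X: "X p \<in> carrier R \<and> x p = cl n (X p)" if "p \<in> {1..\<rho>}" for p
    using someI_ex[of "\<lambda>w. w \<in> carrier R \<and> x p = cl n w"] x(2)[OF that] that
    by (auto simp: X_def carrier_Rn)
  have "x = vec n \<rho> X"
  proof
    fix p
    show "x p = vec n \<rho> X p"
      using X[of p] extensional_arb[OF x(1), of p] by (cases "p \<in> {1..\<rho>}") (simp_all add: vec_def)
  qed
  moreover have "X p \<in> carrier R" for p using X[of p] by (cases "p \<in> {1..\<rho>}") (simp_all add: X_def)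
  ultimately show ?thesis by (rule that[rotated])
qed

lemma vec_smult:
  assumes "c \<in> carrier R" "\<And>p. X p \<in> carrier R"
  shows "c \<odot>\<^bsub>Rn_pow R \<pi> n \<rho>\<^esub> vec n \<rho> X = vec n \<rho> (\<lambda>p. c \<otimes> X p)"
  using assms by (auto simp: vec_def Rn_pow_def direct_sum_def cl_smult fun_eq_iff)

lemma vec_eq_iff:
  assumes "\<And>p. X p \<in> carrier R" "\<And>p. Y p \<in> carrier R"
  shows "vec n \<rho> X = vec n \<rho> Y \<longleftrightarrow> (\<forall>p\<in>{1..\<rho>}. X p \<ominus> Y p \<in> P n)"
proof -
  have "vec n \<rho> X = vec n \<rho> Y \<longleftrightarrow> (\<forall>p\<in>{1..\<rho>}. cl n (X p) = cl n (Y p))"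
    by (auto simp: vec_def fun_eq_iff restrict_def)
  then show ?thesis using assms by (simp add: cl_eq_iff)
qed

lemma vec_minus:
  assumes X: "\<And>p. X p \<in> carrier R" and Y: "\<And>p. Y p \<in> carrier R"
  shows "vec n \<rho> X \<ominus>\<^bsub>Rn_pow R \<pi> n \<rho>\<^esub> vec n \<rho> Y = vec n \<rho> (\<lambda>p. X p \<ominus> Y p)"
proof -
  let ?M = "Rn_pow R \<pi> n \<rho>"
  interpret M: module R ?M by (rule module_Rn_pow)
  have "vec n \<rho> X = vec n \<rho> (\<lambda>p. X p \<ominus> Y p) \<oplus>\<^bsub>?M\<^esub> vec n \<rho> Y"
    using X Y by (auto simp: vec_def Rn_pow_def direct_sum_def cl_add fun_eq_iff minus_eq a_assoc l_neg)
  moreover have "vec n \<rho> Y \<in> carrier ?M" "vec n \<rho> (\<lambda>p. X p \<ominus> Y p) \<in> carrier ?M"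
    using X Y by (simp_all add: vec_closed)
  ultimately show ?thesis by (simp add: M.minus_eq M.a_assoc M.r_neg)
qed

lemma P_cap_iff:
  assumes "x \<in> carrier R"
  shows "x \<in> P (cap n e) \<longleftrightarrow> (\<exists>w\<in>carrier R. x \<ominus> pi_pow R \<pi> e \<otimes> w \<in> P n)"
proof (cases e)
  case (enat v)
  then show ?thesis using P_min_iff[OF assms] by (simp add: pi_pow_def)
next
  case infinity
  then show ?thesis using assms by (auto simp: pi_pow_def minus_eq)
qed

lemma pi_multiples_vec_iff:
  assumes X: "\<And>p. X p \<in> carrier R"
  shows "vec n \<rho> X \<in> pi_multiples R \<pi> (Rn_pow R \<pi> n \<rho>) e \<longleftrightarrow> (\<forall>p\<in>{1..\<rho>}. X p \<in> P (cap n e))"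
proof
  assume "vec n \<rho> X \<in> pi_multiples R \<pi> (Rn_pow R \<pi> n \<rho>) e"
  then obtain w where "w \<in> carrier (Rn_pow R \<pi> n \<rho>)"
    "vec n \<rho> X = pi_pow R \<pi> e \<odot>\<^bsub>Rn_pow R \<pi> n \<rho>\<^esub> w" by (auto simp: pi_multiples_def)
  moreover from this(1) obtain W where W: "\<And>p. W p \<in> carrier R" "w = vec n \<rho> W"
    by (rule Rn_powE, intro that)
  ultimately have "vec n \<rho> X = vec n \<rho> (\<lambda>p. pi_pow R \<pi> e \<otimes> W p)" by (simp add: vec_smult)
  then have "\<forall>p\<in>{1..\<rho>}. X p \<ominus> pi_pow R \<pi> e \<otimes> W p \<in> P n"
    using vec_eq_iff[of X "\<lambda>p. pi_pow R \<pi> e \<otimes> W p" n \<rho>] X W(1) by simp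
  then show "\<forall>p\<in>{1..\<rho>}. X p \<in> P (cap n e)"
    using P_cap_iff[OF X] W(1) by meson
next
  assume *: "\<forall>p\<in>{1..\<rho>}. X p \<in> P (cap n e)"
  have "\<forall>p. \<exists>w. w \<in> carrier R \<and> (p \<in> {1..\<rho>} \<longrightarrow> X p \<ominus> pi_pow R \<pi> e \<otimes> w \<in> P n)"
    using * P_cap_iff[OF X] by (meson zero_closed)
  then obtain W where W: "\<And>p. W p \<in> carrier R"
    "\<And>p. p \<in> {1..\<rho>} \<Longrightarrow> X p \<ominus> pi_pow R \<pi> e \<otimes> W p \<in> P n" by metis
  then have "vec n \<rho> X = pi_pow R \<pi> e \<odot>\<^bsub>Rn_pow R \<pi> n \<rho>\<^esub> vec n \<rho> W"
    using vec_eq_iff[of X "\<lambda>p. pi_pow R \<pi> e \<otimes> W p" n \<rho>] X by (simp add: vec_smult)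
  then show "vec n \<rho> X \<in> pi_multiples R \<pi> (Rn_pow R \<pi> n \<rho>) e"
    using vec_closed[of W n \<rho>] W(1) by (auto simp: pi_multiples_def)
qed

text \<open>For n >= 1 the ideal pi^n R lies in pi R, so adding pi R to a class modulo pi^n leaves
  exactly its class modulo pi.\<close>

lemma PIdl_set_add_cl:
  assumes "1 \<le> n" "x \<in> carrier R"
  shows "PIdl \<pi> <+>\<^bsub>R\<^esub> cl n x = cl 1 x"
proof -
  have P1: "PIdl \<pi> = P 1" by (simp add: P_def)
  show ?thesis
  proof
    show "PIdl \<pi> <+>\<^bsub>R\<^esub> cl n x \<subseteq> cl 1 x"
    proof
      fix z assume "z \<in> PIdl \<pi> <+>\<^bsub>R\<^esub> cl n x"
      then obtain u v where uv: "u \<in> P 1" "v \<in> P n" "z = u \<oplus> (v \<oplus> x)"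
        by (auto simp: P1 set_add_def' cl_alt a_r_coset_def')
      then have "v \<in> P 1" using assms(1) P_mono_elem by simp
      then have "u \<oplus> v \<in> P 1" "z = (u \<oplus> v) \<oplus> x"
        using uv assms(2) P_carrier[OF uv(1)] P_carrier[OF uv(2)] by (simp_all add: a_assoc)
      then show "z \<in> cl 1 x" unfolding cl_alt a_r_coset_def' by blast
    qed
    show "cl 1 x \<subseteq> PIdl \<pi> <+>\<^bsub>R\<^esub> cl n x"
    proof
      fix z assume "z \<in> cl 1 x"
      then obtain u where u: "u \<in> P 1" "z = u \<oplus> (\<zero> \<oplus> x)"
        using assms(2) by (auto simp: cl_alt a_r_coset_def')
      moreover have "\<zero> \<oplus> x \<in> cl n x" unfolding cl_alt a_r_coset_def' using P_zero by blast
      ultimately show "z \<in> PIdl \<pi> <+>\<^bsub>R\<^esub> cl n x" unfolding P1 set_add_def' by blast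
    qed
  qed
qed

text \<open>U lifts the very vector picked by \<open>SOME\<close> in \<open>leading_part\<close>.
  One and the same U thus represents the reduction modulo pi and divides X by pi^v modulo pi^n; both
  are needed when it becomes a column of a diagonal block.\<close>

lemma leading_part_vec:
  assumes n: "1 \<le> n" and X: "\<And>p. X p \<in> carrier R" and v: "\<And>p. p \<in> {1..\<rho>} \<Longrightarrow> X p \<in> P (min v n)"
  obtains U where "\<And>p. U p \<in> carrier R" "leading_part R \<pi> n \<rho> v (vec n \<rho> X) = vec 1 \<rho> U"
    "\<And>p. p \<in> {1..\<rho>} \<Longrightarrow> \<pi> [^] v \<otimes> U p \<ominus> X p \<in> P n"
proof -
  let ?M = "Rn_pow R \<pi> n \<rho>"
  define w where "w = (SOME w. w \<in> carrier ?M \<and> (\<pi> [^] v) \<odot>\<^bsub>?M\<^esub> w = vec n \<rho> X)"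
  have "vec n \<rho> X \<in> pi_multiples R \<pi> ?M (enat v)"
    using pi_multiples_vec_iff[of X n \<rho> "enat v"] X v by simp
  then have "\<exists>w. w \<in> carrier ?M \<and> (\<pi> [^] v) \<odot>\<^bsub>?M\<^esub> w = vec n \<rho> X"
    by (auto simp: pi_multiples_def pi_pow_def)
  then have w: "w \<in> carrier ?M" "(\<pi> [^] v) \<odot>\<^bsub>?M\<^esub> w = vec n \<rho> X"
    unfolding w_def by (rule someI2_ex, simp)+
  from w(1) obtain U where U: "\<And>p. U p \<in> carrier R" "w = vec n \<rho> U" by (rule Rn_powE, intro that)
  have "leading_part R \<pi> n \<rho> v (vec n \<rho> X) = reduce_mod_pi R \<pi> \<rho> w"
    by (simp add: leading_part_def w_def)
  also have "\<dots> = vec 1 \<rho> U"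
    using n U by (auto simp: reduce_mod_pi_def vec_def PIdl_set_add_cl fun_eq_iff)
  finally have 1: "leading_part R \<pi> n \<rho> v (vec n \<rho> X) = vec 1 \<rho> U" .
  have "\<forall>p\<in>{1..\<rho>}. \<pi> [^] v \<otimes> U p \<ominus> X p \<in> P n"
    using w(2) vec_eq_iff[of "\<lambda>p. \<pi> [^] v \<otimes> U p" X n \<rho>] X U by (simp add: vec_smult)
  then show ?thesis by (intro that[OF U(1) 1]) simp
qed

text \<open>If every 2x2 minor vanishes modulo pi, then u(p0) and -w(p0) are the coefficients of a
  linear relation between w and u, for each p0. Independence makes u vanish modulo pi, and then the
  coefficients 0 and 1 give a forbidden relation.\<close>

lemma lin_indep_minor:
  assumes ind: "lin_indep_pair R \<pi> \<rho> (vec 1 \<rho> w) (vec 1 \<rho> u)"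
    and w: "\<And>p. w p \<in> carrier R" and u: "\<And>p. u p \<in> carrier R"
  shows "\<exists>p0\<in>{1..\<rho>}. \<exists>p1\<in>{1..\<rho>}. u p0 \<otimes> w p1 \<ominus> u p1 \<otimes> w p0 \<in> Units R"
proof (rule ccontr)
  assume neg: "\<not> ?thesis"
  let ?F = "R Quot PIdl \<pi>"
  have P1: "PIdl \<pi> = P 1" by (simp add: P_def)
  interpret h: ring_hom_ring R ?F "(+>) (PIdl \<pi>)"
    unfolding P1 by (rule ideal.rcos_ring_hom_ring[OF P_ideal])
  have cl1: "cl 1 = (+>) (PIdl \<pi>)" by (rule ext) (simp add: cl_alt P1)
  have z: "cl 1 x = \<zero>\<^bsub>?F\<^esub> \<longleftrightarrow> x \<in> P 1" if "x \<in> carrier R" for x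
    using cl_eq_zero[OF that, of 1] unfolding cl1 by simp
  have I: "c \<in> P 1 \<and> d \<in> P 1"
    if c: "c \<in> carrier R" and d: "d \<in> carrier R" and cd: "\<And>p. p \<in> {1..\<rho>} \<Longrightarrow> c \<otimes> w p \<oplus> d \<otimes> u p \<in> P 1" for c d
  proof -
    have "cl 1 c \<otimes>\<^bsub>?F\<^esub> vec 1 \<rho> w p \<oplus>\<^bsub>?F\<^esub> cl 1 d \<otimes>\<^bsub>?F\<^esub> vec 1 \<rho> u p = \<zero>\<^bsub>?F\<^esub>" if p: "p \<in> {1..\<rho>}" for p
    proof -
      have "cl 1 c \<otimes>\<^bsub>?F\<^esub> cl 1 (w p) \<oplus>\<^bsub>?F\<^esub> cl 1 d \<otimes>\<^bsub>?F\<^esub> cl 1 (u p) = cl 1 (c \<otimes> w p \<oplus> d \<otimes> u p)"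
        unfolding cl1 using c d w u by simp
      then show ?thesis using z[of "c \<otimes> w p \<oplus> d \<otimes> u p"] cd[OF p] c d w u p by (simp add: vec_def)
    qed
    moreover have "cl 1 c \<in> carrier ?F" "cl 1 d \<in> carrier ?F" unfolding cl1 using c d by simp_all
    ultimately have "cl 1 c = \<zero>\<^bsub>?F\<^esub> \<and> cl 1 d = \<zero>\<^bsub>?F\<^esub>"
      using ind unfolding lin_indep_pair_def Let_def by blast
    then show ?thesis using z c d by simp
  qed
  have u1: "u p0 \<in> P 1" if p0: "p0 \<in> {1..\<rho>}" for p0
  proof -
    have "u p0 \<otimes> w p \<oplus> (\<ominus> w p0) \<otimes> u p \<in> P 1" if p: "p \<in> {1..\<rho>}" for p
    proof -
      have "u p0 \<otimes> w p \<ominus> u p \<otimes> w p0 \<in> P 1"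
        using neg p0 p P_1_unit[of "u p0 \<otimes> w p \<ominus> u p \<otimes> w p0"] u w by blast
      then show ?thesis using u w by (simp add: minus_eq l_minus r_minus m_comm)
    qed
    then show ?thesis using I[of "u p0" "\<ominus> w p0"] u w by simp
  qed
  then have "\<zero> \<otimes> w p \<oplus> \<one> \<otimes> u p \<in> P 1" if "p \<in> {1..\<rho>}" for p using that u w by simp
  then have "\<one> \<in> P 1" using I[of \<zero> \<one>] by simp
  then show False using P_1_unit[of \<one>] by simp
qed

subsection \<open>The ideal of an element\<close>

text \<open>
  The set \<open>\<pi>\<^sup>v\<^sup>+\<^sup>1 M + M[\<pi>\<^sup>l\<^sup>-\<^sup>v\<^sup>-\<^sup>1]\<close>.  A pair $(v, l)$ with $v < l$ lies in $I(e)$ iff $e$ is outside this set.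
  This description does not mention a decomposition and is functorial, so it gives both the
  independence of $I(e)$ of the decomposition and the monotonicity of $I$ under homomorphisms.
\<close>

definition power_plus_torsion :: "('a, 'm, 'e) module_scheme \<Rightarrow> nat \<Rightarrow> nat \<Rightarrow> 'm set" where
  "power_plus_torsion M v l = {e. \<exists>w\<in>carrier M. \<exists>u\<in>carrier M.
     e = (\<pi> [^] Suc v) \<odot>\<^bsub>M\<^esub> w \<oplus>\<^bsub>M\<^esub> u \<and> (\<pi> [^] (l - Suc v)) \<odot>\<^bsub>M\<^esub> u = \<zero>\<^bsub>M\<^esub>}"

text \<open>The functoriality from which all comparisons of ideals follow: homomorphisms preserve
  both multiples of a power of pi and torsion.\<close>

lemma power_plus_torsion_hom:
  assumes "module R M" "module R N" "h \<in> module_hom R M N" "e \<in> power_plus_torsion M v l"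
  shows "h e \<in> power_plus_torsion N v l"
proof -
  interpret M: module R M by fact
  obtain w u where w: "w \<in> carrier M" "u \<in> carrier M"
    "e = (\<pi> [^] Suc v) \<odot>\<^bsub>M\<^esub> w \<oplus>\<^bsub>M\<^esub> u" "(\<pi> [^] (l - Suc v)) \<odot>\<^bsub>M\<^esub> u = \<zero>\<^bsub>M\<^esub>"
    using assms(4) by (auto simp: power_plus_torsion_def simp del: nat_pow_Suc)
  have pw: "\<pi> [^] n \<in> carrier R" for n :: nat by simp
  note hh = module_homD[OF assms(3)]
  have "h e = (\<pi> [^] Suc v) \<odot>\<^bsub>N\<^esub> h w \<oplus>\<^bsub>N\<^esub> h u"
    unfolding w(3) using w(1,2) by (simp only: hh pw M.smult_closed)
  moreover have "(\<pi> [^] (l - Suc v)) \<odot>\<^bsub>N\<^esub> h u = \<zero>\<^bsub>N\<^esub>"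
    using hh(3)[OF pw w(2)] w(4) module_hom_zero[OF assms(1-3)] by metis
  ultimately show ?thesis using hh(1) w(1,2) unfolding power_plus_torsion_def by blast
qed

lemma INF_block_iff:
  assumes X: "\<And>t. X t \<in> carrier R" and "i \<in> {1..h}"
  shows "enat v \<le> (INF p\<in>{1..sigma i}. coord_val R \<pi> (mu i) (clv mu (summands h sigma) X (i, p))) \<longleftrightarrow>
    (\<forall>p\<in>{1..sigma i}. X (i, p) \<in> P (min v (mu i)))"
proof -
  have "(INF p\<in>{1..sigma i}. coord_val R \<pi> (mu i) (clv mu (summands h sigma) X (i, p))) =
      (INF p\<in>{1..sigma i}. coord_val R \<pi> (mu i) (cl (mu i) (X (i, p))))"
    using assms(2) by (intro INF_cong) (auto simp: clv_def summands_def)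
  then show ?thesis using INF_coord_val_iff[of "{1..sigma i}" "\<lambda>p. X (i, p)" v "mu i"] X by simp
qed

text \<open>The failing condition at \<open>Suc v\<close> also forces v < \<open>mu i\<close>, since
  otherwise both minima equal \<open>mu i\<close>. So a zero block yields no pair.\<close>

lemma block_pairs_iff:
  assumes X: "\<And>t. X t \<in> carrier R"
  shows "(v, l) \<in> block_pairs R \<pi> h mu sigma (clv mu (summands h sigma) X) \<longleftrightarrow>
     (\<exists>i\<in>{1..h}. l = mu i \<and> (\<forall>p\<in>{1..sigma i}. X (i, p) \<in> P (min v (mu i))) \<and>
        \<not> (\<forall>p\<in>{1..sigma i}. X (i, p) \<in> P (min (Suc v) (mu i))))"
proof -
  have "enat v = (INF p\<in>{1..sigma i}. coord_val R \<pi> (mu i) (clv mu (summands h sigma) X (i, p))) \<longleftrightarrow>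
      (\<forall>p\<in>{1..sigma i}. X (i, p) \<in> P (min v (mu i))) \<and>
      \<not> (\<forall>p\<in>{1..sigma i}. X (i, p) \<in> P (min (Suc v) (mu i)))" if i: "i \<in> {1..h}" for i
    by (simp only: enat_eq_iff_le INF_block_iff[where X = X and sigma = sigma and mu = mu, OF X i])
  then show ?thesis unfolding block_pairs_def by blast
qed

text \<open>Suppose (v, l) lies below a generator (v', l'). In R_l' both pi^(v+1) R_l' and the
  torsion of pi^(l-v-1) lie in pi^(v'+1) R_l', whereas some coordinate of that block has valuation
  exactly v'. If (v, l) is not in the ideal, each coordinate is either divisible by pi^(v+1) or
  killed by pi^(l-v-1), and sorting the coordinates accordingly splits the element.\<close>

lemma generated_block_pairs:
  assumes X: "\<And>t. X t \<in> carrier R" and sg: "\<forall>i\<in>{1..h}. 1 \<le> sigma i"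
  shows "generated_ideal (block_pairs R \<pi> h mu sigma (clv mu (summands h sigma) X)) =
    {(v, l). v < l \<and> clv mu (summands h sigma) X \<notin> power_plus_torsion (Rlam R \<pi> h mu sigma) v l}" (is "?G = ?H")
proof -
  let ?A = "summands h sigma" and ?x = "clv mu (summands h sigma) X"
  note blk = INF_block_iff[where X = X and h = h and sigma = sigma and mu = mu, OF X]
    and bp = block_pairs_iff[where X = X and h = h and sigma = sigma and mu = mu, OF X]
  have "(v, l) \<in> ?G \<longleftrightarrow> (v, l) \<in> ?H" for v l
  proof
    assume "(v, l) \<in> ?G"
    then obtain v' l' where vl: "v < l" "(v', l') \<in> block_pairs R \<pi> h mu sigma ?x" "v' \<le> v" "l - v \<le> l' - v'"
      by (auto simp: generated_ideal_def fund_poset_def fund_le_def)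
    then obtain i p where i: "i \<in> {1..h}" "l' = mu i" and p: "p \<in> {1..sigma i}"
      "X (i, p) \<in> P (min v' l')" "X (i, p) \<notin> P (min (Suc v') l')"
      unfolding bp by blast
    have "v' < l'" using vl by simp
    show "(v, l) \<in> ?H"
    proof (clarsimp simp: vl(1))
      assume "?x \<in> power_plus_torsion (Rlam R \<pi> h mu sigma) v l"
      then obtain w' u' where wu: "w' \<in> carrier (Rsum R \<pi> mu ?A)" "u' \<in> carrier (Rsum R \<pi> mu ?A)"
        "?x = (\<pi> [^] Suc v) \<odot>\<^bsub>Rsum R \<pi> mu ?A\<^esub> w' \<oplus>\<^bsub>Rsum R \<pi> mu ?A\<^esub> u'"
        "(\<pi> [^] (l - Suc v)) \<odot>\<^bsub>Rsum R \<pi> mu ?A\<^esub> u' = \<zero>\<^bsub>Rsum R \<pi> mu ?A\<^esub>"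
        unfolding power_plus_torsion_def Rlam_def by blast
      obtain W where W: "\<And>t. W t \<in> carrier R" "w' = clv mu ?A W" by (rule RsumE[OF wu(1)], rule that)
      obtain U where U: "\<And>t. U t \<in> carrier R" "u' = clv mu ?A U" by (rule RsumE[OF wu(2)], rule that)
      have ip: "(i, p) \<in> ?A" using i p by (auto simp: summands_def)
      have pw: "\<pi> [^] n \<in> carrier R" for n :: nat by simp
      have "?x = clv mu ?A (\<lambda>t. \<pi> [^] Suc v \<otimes> W t \<oplus> U t)"
        using wu(3) W U pw by (simp add: clv_smult clv_add del: nat_pow_Suc)
      then have 1: "X (i, p) \<ominus> (\<pi> [^] Suc v \<otimes> W (i, p) \<oplus> U (i, p)) \<in> P l'"
        using bspec[OF iffD1[OF clv_eq_iff], of X "\<lambda>t. \<pi> [^] Suc v \<otimes> W t \<oplus> U t" mu ?A "(i, p)"]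
          W(1) U(1) X ip i(2) pw by (simp del: nat_pow_Suc)
      have "\<pi> [^] (l - Suc v) \<otimes> U (i, p) \<in> P l'"
        using bspec[OF iffD1[OF clv_eq_zero], of "\<lambda>t. \<pi> [^] (l - Suc v) \<otimes> U t" mu ?A "(i, p)"]
          wu(4) U pw ip i(2) by (simp add: clv_smult)
      then have "U (i, p) \<in> P (l' - (l - Suc v))"
        by (subst (asm) P_pow_mult) (use vl \<open>v' < l'\<close> U in auto)
      \<comment> \<open>Here l - v <= l' - v' enters: it says l' - (l - v - 1) >= v' + 1.\<close>
      then have 2: "U (i, p) \<in> P (Suc v')" by (rule P_mono_elem) (use vl in simp)
      have 3: "\<pi> [^] Suc v \<otimes> W (i, p) \<in> P (Suc v')"
        by (rule P_mono_elem[OF P_mult_r[OF P_pow]]) (use vl W in auto)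
      have 4: "X (i, p) \<ominus> (\<pi> [^] Suc v \<otimes> W (i, p) \<oplus> U (i, p)) \<in> P (Suc v')"
        by (rule P_mono_elem[OF 1]) (use \<open>v' < l'\<close> in simp)
      define c where "c = \<pi> [^] Suc v \<otimes> W (i, p) \<oplus> U (i, p)"
      have c: "c \<in> P (Suc v')" "X (i, p) \<ominus> c \<in> P (Suc v')" using 2 3 4 by (auto simp: c_def simp del: nat_pow_Suc)
      have "X (i, p) = (X (i, p) \<ominus> c) \<oplus> c"
        using X P_carrier[OF c(1)] by (simp add: minus_eq a_assoc l_neg)
      then have "X (i, p) \<in> P (Suc v')" using c by (metis P_add)
      then show False using p(3) \<open>v' < l'\<close> by (simp add: min_def)
    qed
  next
    assume "(v, l) \<in> ?H"
    then have vl: "v < l" "?x \<notin> power_plus_torsion (Rlam R \<pi> h mu sigma) v l" by auto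
    show "(v, l) \<in> ?G"
    proof (rule ccontr)
      assume nG: "(v, l) \<notin> ?G"
      have key: "\<pi> [^] (l - Suc v) \<otimes> X (i, p) \<in> P (mu i)"
        if ip: "(i, p) \<in> ?A" "X (i, p) \<notin> P (Suc v)" for i p
      proof (cases "X (i, p) \<in> P (mu i)")
        case False
        have i: "i \<in> {1..h}" "p \<in> {1..sigma i}" using ip by (auto simp: summands_def)
        let ?Y = "INF p\<in>{1..sigma i}. coord_val R \<pi> (mu i) (?x (i, p))"
        have "\<not> enat (Suc v) \<le> ?Y"
          using blk[OF i(1), of "Suc v"] i(2) ip(2) False by (metis min_def)
        \<comment> \<open>v' is the exact valuation of block i, so (v', mu i) is a generator. As (v,
          l) is not below it, mu i - v' < l - v, and pi^(l-v-1) kills the whole block.\<close>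
        then obtain v' where v': "?Y = enat v'" "v' \<le> v" by (cases ?Y) auto
        then have "(v', mu i) \<in> block_pairs R \<pi> h mu sigma ?x"
          using i unfolding block_pairs_def by force
        then have "\<not> (l - v \<le> mu i - v')"
          using nG vl v' unfolding generated_ideal_def fund_poset_def fund_le_def by force
        moreover have "X (i, p) \<in> P (min v' (mu i))" using blk[OF i(1), of v'] v' i(2) by simp
        then have "X (i, p) \<in> P v'" using False by (metis min_def)
        then have "\<pi> [^] (l - Suc v) \<otimes> X (i, p) \<in> P (l - Suc v + v')" by (intro P_mult) simp_all
        ultimately show ?thesis by (elim P_mono_elem) simp
      qed (simp)
      have "\<forall>t. \<exists>w. w \<in> carrier R \<and> (X t \<in> P (Suc v) \<longrightarrow> X t = \<pi> [^] Suc v \<otimes> w)"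
        by (intro allI) (auto simp: P_iff simp del: nat_pow_Suc)
      then obtain W0 where W0: "\<And>t. W0 t \<in> carrier R" "\<And>t. X t \<in> P (Suc v) \<Longrightarrow> X t = \<pi> [^] Suc v \<otimes> W0 t"
        by metis
      define W where "W t = (if X t \<in> P (Suc v) then W0 t else \<zero>)" for t
      define U where "U t = (if X t \<in> P (Suc v) then \<zero> else X t)" for t
      have WU: "W t \<in> carrier R" "U t \<in> carrier R" for t using W0 X by (auto simp: W_def U_def)
      have "X = (\<lambda>t. \<pi> [^] Suc v \<otimes> W t \<oplus> U t)"
        using W0 X by (auto simp: W_def U_def fun_eq_iff simp del: nat_pow_Suc)
      then have "?x = (\<pi> [^] Suc v) \<odot>\<^bsub>Rsum R \<pi> mu ?A\<^esub> clv mu ?A W \<oplus>\<^bsub>Rsum R \<pi> mu ?A\<^esub> clv mu ?A U"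
        using WU nat_pow_closed[OF pi_closed, of "Suc v"] by (simp add: clv_smult clv_add del: nat_pow_Suc)
      moreover have "(\<pi> [^] (l - Suc v)) \<odot>\<^bsub>Rsum R \<pi> mu ?A\<^esub> clv mu ?A U = \<zero>\<^bsub>Rsum R \<pi> mu ?A\<^esub>"
        using WU key by (simp add: clv_smult clv_eq_zero) (auto simp: U_def)
      ultimately have "?x \<in> power_plus_torsion (Rlam R \<pi> h mu sigma) v l"
        unfolding power_plus_torsion_def Rlam_def using clv_closed[of W mu ?A] clv_closed[of U mu ?A] WU by blast
      then show False using vl by simp
    qed
  qed
  then show ?thesis by auto
qed

text \<open>For any decomposition phi of Q the composite of h and phi is a homomorphism into a sum
  of cyclic modules, to which \<open>power_plus_torsion_hom\<close> applies. Only M is assumed to be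
  a module, so Q can be a quotient as soon as the projection to it is known to be a
  homomorphism.\<close>

lemma ideal_of_hom_image:
  assumes "module R M" "h \<in> module_hom R M Q" "e \<in> carrier M"
  shows "ideal_of R \<pi> Q (h e) \<subseteq> {(v, l). v < l \<and> e \<notin> power_plus_torsion M v l}"
proof
  fix z assume "z \<in> ideal_of R \<pi> Q (h e)"
  then obtain n mu sigma \<phi> where d: "is_decomposition R \<pi> Q n mu sigma \<phi>"
    and z: "z \<in> generated_ideal (block_pairs R \<pi> n mu sigma (\<phi> (h e)))"
    by (auto simp: ideal_of_def)
  then have "\<phi> \<in> module_hom R Q (Rlam R \<pi> n mu sigma)"
    by (auto simp: is_decomposition_def module_iso_def)
  then have c: "\<phi> \<circ> h \<in> module_hom R M (Rlam R \<pi> n mu sigma)" by (rule module_hom_comp[OF assms(2)])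
  have "\<phi> (h e) \<in> carrier (Rsum R \<pi> mu (summands n sigma))"
    using module_homD(1)[OF c assms(3)] by (simp add: Rlam_def)
  then obtain X where X: "\<And>t. X t \<in> carrier R" "\<phi> (h e) = clv mu (summands n sigma) X"
    by (rule RsumE, intro that)
  have "e \<notin> power_plus_torsion M v l" if "(\<phi> \<circ> h) e \<notin> power_plus_torsion (Rlam R \<pi> n mu sigma) v l" for v l
    using power_plus_torsion_hom[OF assms(1) _ c, of e v l] module_Rsum that by (auto simp: Rlam_def)
  then show "z \<in> {(v, l). v < l \<and> e \<notin> power_plus_torsion M v l}"
    using z generated_block_pairs[OF X(1), of n sigma mu] d X(2) by (auto simp: is_decomposition_def)
qed

text \<open>A sandwich: the identity is one of the decompositions in the union,
  \<open>ideal_of_hom_image\<close> for the identity bounds the union from above, and both bounds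
  agree by \<open>generated_block_pairs\<close>.\<close>

lemma ideal_of_Rlam:
  assumes "partition_type k lam rho" and X: "\<And>t. X t \<in> carrier R"
  defines "x \<equiv> clv lam (summands k rho) X"
  shows "ideal_of R \<pi> (Rlam R \<pi> k lam rho) x = generated_ideal (block_pairs R \<pi> k lam rho x)"
    and "ideal_of R \<pi> (Rlam R \<pi> k lam rho) x = {(v, l). v < l \<and> x \<notin> power_plus_torsion (Rlam R \<pi> k lam rho) v l}"
proof -
  let ?M = "Rlam R \<pi> k lam rho"
  have m: "module R ?M" by (simp add: Rlam_def module_Rsum)
  have id: "id \<in> module_hom R ?M ?M" by (rule module_homI) auto
  have "inj_on lam {1..k}"
    using assms(1) unfolding partition_type_def
    by (intro linorder_inj_onI') (metis less_irrefl)
  then have "is_decomposition R \<pi> ?M k lam rho id"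
    using assms(1) id by (auto simp: is_decomposition_def partition_type_def module_iso_def)
  then have "generated_ideal (block_pairs R \<pi> k lam rho (id x)) \<subseteq> ideal_of R \<pi> ?M x"
    unfolding ideal_of_def by blast
  moreover have "ideal_of R \<pi> ?M (id x) \<subseteq> {(v, l). v < l \<and> x \<notin> power_plus_torsion ?M v l}"
    using clv_closed[OF X] by (intro ideal_of_hom_image[OF m id]) (simp add: x_def Rlam_def)
  moreover have "generated_ideal (block_pairs R \<pi> k lam rho x) = {(v, l). v < l \<and> x \<notin> power_plus_torsion ?M v l}"
    unfolding x_def using assms(1) by (intro generated_block_pairs X) (auto simp: partition_type_def)
  ultimately show "ideal_of R \<pi> ?M x = generated_ideal (block_pairs R \<pi> k lam rho x)"
    "ideal_of R \<pi> ?M x = {(v, l). v < l \<and> x \<notin> power_plus_torsion ?M v l}" by auto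
qed

lemma finite_block_pairs: "finite (block_pairs R \<pi> h mu sigma x)"
proof (rule finite_subset)
  show "block_pairs R \<pi> h mu sigma x \<subseteq>
    (\<lambda>i. (the_enat (INF p\<in>{1..sigma i}. coord_val R \<pi> (mu i) (x (i, p))), mu i)) ` {1..h}"
    by (force simp: block_pairs_def eq_commute[of "enat _"])
qed simp

lemma block_pairs_fund_poset:
  assumes X: "\<And>t. X t \<in> carrier R"
  shows "block_pairs R \<pi> h mu sigma (clv mu (summands h sigma) X) \<subseteq> fund_poset"
proof (rule subrelI)
  fix v l assume "(v, l) \<in> block_pairs R \<pi> h mu sigma (clv mu (summands h sigma) X)"
  then obtain i p where "i \<in> {1..h}" "l = mu i" "X (i, p) \<in> P (min v (mu i))" "X (i, p) \<notin> P (min (Suc v) (mu i))"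
    unfolding block_pairs_iff[where X = X, OF X] by blast
  then show "(v, l) \<in> fund_poset" by (cases "v < l") (auto simp: fund_poset_def min_def split: if_splits)
qed

text \<open>Collects what membership in the orbit of I says about lifts. A maximal element of I is a
  generator, and its second entry determines the block; so each block i in S has minimal valuation
  exactly \<open>s i\<close>. The pair of any other nonzero block lies below some maximal element,
  which bounds its valuation. N stands for a lower bound of the numbers whose minimum is the
  boundary valuation, and \<open>min\<close> allows for a bound beyond \<open>lam i\<close>.\<close>

lemma at_ideal_lifts:
  assumes part: "partition_type k lam rho" and X: "\<And>t. X t \<in> carrier R"
    and I: "clv lam (summands k rho) X \<in> at_ideal R \<pi> (Rlam R \<pi> k lam rho) I"
    and S: "S \<subseteq> {1..k}" "max_elements I = {(s i, lam i) |i. i \<in> S}"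
  shows at_ideal_fund_poset: "I \<subseteq> fund_poset"
    and at_ideal_in_S: "i \<in> S \<Longrightarrow> p \<in> {1..rho i} \<Longrightarrow> X (i, p) \<in> P (s i)"
    and at_ideal_in_S_exact: "i \<in> S \<Longrightarrow> \<exists>p\<in>{1..rho i}. X (i, p) \<notin> P (Suc (s i))"
    and at_ideal_below: "(v, lam i) \<in> I \<Longrightarrow> i \<in> {1..k} - S \<Longrightarrow> \<exists>j\<in>S. lam i - lam j + s j \<le> v"
    and at_ideal_notin_S: "i \<in> {1..k} - S \<Longrightarrow> (\<And>j. j \<in> S \<Longrightarrow> N \<le> lam i - lam j + s j) \<Longrightarrow>
      p \<in> {1..rho i} \<Longrightarrow> X (i, p) \<in> P (min N (lam i))"
proof -
  let ?x = "clv lam (summands k rho) X"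
  define G where "G = block_pairs R \<pi> k lam rho ?x"
  have Ig: "I = generated_ideal G"
    using I ideal_of_Rlam(1)[OF part, of X, OF X] by (simp add: at_ideal_def G_def)
  have G: "finite G" "G \<subseteq> fund_poset"
    unfolding G_def by (rule finite_block_pairs, rule block_pairs_fund_poset[where X = X, OF X])
  show Ifp: "I \<subseteq> fund_poset" by (auto simp: Ig generated_ideal_def)
  note bp = block_pairs_iff[where X = X and h = k and sigma = rho and mu = lam, OF X, folded G_def]
  have in_S: "(\<forall>p\<in>{1..rho i}. X (i, p) \<in> P (s i)) \<and> (\<exists>p\<in>{1..rho i}. X (i, p) \<notin> P (Suc (s i)))" if i: "i \<in> S" for i
  proof -
    have "(s i, lam i) \<in> G" using S(2) i G(2) max_elements_generated Ig by blast
    then obtain i' where i': "i' \<in> {1..k}" "lam i = lam i'"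
      "\<forall>p\<in>{1..rho i'}. X (i', p) \<in> P (min (s i) (lam i'))"
      "\<not> (\<forall>p\<in>{1..rho i'}. X (i', p) \<in> P (min (Suc (s i)) (lam i')))" unfolding bp by blast
    then have "i' = i" using partition_type_inj[OF part, of i' i] i S(1) by auto
    moreover have "s i < lam i" using \<open>(s i, lam i) \<in> G\<close> G(2) by (auto simp: fund_poset_def)
    ultimately show ?thesis using i'(3,4) by (simp add: min_def)
  qed
  then show "i \<in> S \<Longrightarrow> p \<in> {1..rho i} \<Longrightarrow> X (i, p) \<in> P (s i)"
    and "i \<in> S \<Longrightarrow> \<exists>p\<in>{1..rho i}. X (i, p) \<notin> P (Suc (s i))" by blast+
  have below: "\<exists>j\<in>S. lam i - lam j + s j \<le> v" if vi: "(v, lam i) \<in> I" "i \<in> {1..k} - S" for v i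
  proof -
    obtain z where z: "z \<in> max_elements I" "fund_le (v, lam i) z"
      using below_max_element[OF G] vi(1) unfolding Ig by blast
    then obtain j where j: "j \<in> S" "z = (s j, lam j)" using S(2) by blast
    have "s j < lam j" "v < lam i" using z(1) j(2) vi(1) Ifp by (auto simp: max_elements_def fund_poset_def)
    then have "lam i - lam j + s j \<le> v" using z(2) j(2) by (auto simp: fund_le_def)
    then show ?thesis using j(1) by blast
  qed
  then show "(v, lam i) \<in> I \<Longrightarrow> i \<in> {1..k} - S \<Longrightarrow> \<exists>j\<in>S. lam i - lam j + s j \<le> v" .
  assume i: "i \<in> {1..k} - S" and N: "\<And>j. j \<in> S \<Longrightarrow> N \<le> lam i - lam j + s j" and p: "p \<in> {1..rho i}"
  let ?Y = "INF p\<in>{1..rho i}. coord_val R \<pi> (lam i) (?x (i, p))"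
  have ik: "i \<in> {1..k}" using i by simp
  note blk = INF_block_iff[where X = X and h = k and sigma = rho and mu = lam, OF X ik]
  show "X (i, p) \<in> P (min N (lam i))"
  proof (cases ?Y)
    case (enat v)
    then have "(v, lam i) \<in> G" unfolding G_def block_pairs_def using ik by force
    then have "(v, lam i) \<in> I" using generated_ideal_superset[OF G(2)] Ig by blast
    then have "N \<le> v" using below i N le_trans by blast
    then have "\<forall>p\<in>{1..rho i}. X (i, p) \<in> P (min N (lam i))"
      using blk[of N] enat by simp
    then show ?thesis using p by blast
  next
    case infinity
    then show ?thesis using blk[of N] p by simp
  qed
qed

text \<open>J is the ideal of the image of m under projection to R_lambda' followed by the quotient
  map, and K that of its projection to R_lambda''. A homomorphism can only shrink the ideal.\<close>

lemma ideal_J_K_subset: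
  assumes part: "partition_type k lam rho" and S: "S \<subseteq> {1..k}"
    and m: "m \<in> at_ideal R \<pi> (Rlam R \<pi> k lam rho) I"
  shows "ideal_J R \<pi> k lam rho S s m \<union> ideal_K R \<pi> k lam rho S m \<subseteq> I"
proof -
  let ?M = "Rlam R \<pi> k lam rho" and ?M' = "Rlam' R \<pi> lam S"
  have mc: "m \<in> carrier ?M" using m by (simp add: at_ideal_def)
  then obtain X where X: "\<And>t. X t \<in> carrier R" "m = clv lam (summands k rho) X"
    unfolding Rlam_def by (rule RsumE, intro that)
  have I: "I = {(v, l). v < l \<and> m \<notin> power_plus_torsion ?M v l}"
    using m ideal_of_Rlam(2)[OF part, of X, OF X(1)] X(2) by (simp add: at_ideal_def)
  have mod: "module R ?M" "module R ?M'" by (simp_all add: Rlam_def Rlam'_def module_Rsum)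
  define e where "e = restrict (canonical_form R \<pi> k lam rho S s) (summands' S)"
  have "canonical_form R \<pi> k lam rho S s \<in> carrier ?M"
    by (auto simp: canonical_form_def Rlam_def Rsum_def direct_sum_def zero_Rn cl_def[symmetric])
  then have e: "e \<in> carrier ?M'"
    using summands'_subset[OF part S] unfolding e_def
    by (auto simp: Rlam_def Rlam'_def Rsum_def direct_sum_def PiE_iff)
  define N where "N = cyclic_submodule R ?M' e"
  have res: "(\<lambda>x. restrict x (summands' S)) \<in> module_hom R ?M ?M'"
    unfolding Rlam_def Rlam'_def Rsum_def by (rule module_hom_restrict[OF summands'_subset[OF part S]])
  have res'': "(\<lambda>x. restrict x (summands'' k rho S)) \<in> module_hom R ?M (Rlam'' R \<pi> k lam rho S)"
    unfolding Rlam_def Rlam''_def Rsum_def by (rule module_hom_restrict) (auto simp: summands''_def)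
  have quo: "(\<lambda>x. N +>\<^bsub>?M'\<^esub> x) \<in> module_hom R ?M' (quotient_module ?M' N)"
    unfolding N_def by (intro module_hom_quotient mod cyclic_submodule_subgroup e)
  have "ideal_J R \<pi> k lam rho S s m \<subseteq> I"
    using ideal_of_hom_image[OF mod(1) module_hom_comp[OF res quo] mc]
    by (simp add: ideal_J_def Let_def I N_def e_def)
  moreover have "ideal_K R \<pi> k lam rho S m \<subseteq> I"
    using ideal_of_hom_image[OF mod(1) res'' mc] by (simp add: ideal_K_def I)
  ultimately show ?thesis by simp
qed

subsection \<open>Automorphisms given by rows\<close>

text \<open>A row of a matrix, taken as a linear functional on families of lifts; no finite sum over
  the columns has to be written out.\<close>

definition linfun :: "(('i \<Rightarrow> 'a) \<Rightarrow> 'a) \<Rightarrow> bool" where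
  "linfun F \<longleftrightarrow>
     (\<forall>X. (\<forall>t. X t \<in> carrier R) \<longrightarrow> F X \<in> carrier R) \<and>
     (\<forall>X Y. (\<forall>t. X t \<in> carrier R) \<longrightarrow> (\<forall>t. Y t \<in> carrier R) \<longrightarrow>
        F (\<lambda>t. X t \<oplus> Y t) = F X \<oplus> F Y) \<and>
     (\<forall>r X. r \<in> carrier R \<longrightarrow> (\<forall>t. X t \<in> carrier R) \<longrightarrow> F (\<lambda>t. r \<otimes> X t) = r \<otimes> F X)"

lemma linfunD:
  assumes "linfun F"
  shows "(\<And>t. X t \<in> carrier R) \<Longrightarrow> F X \<in> carrier R"
    and "(\<And>t. X t \<in> carrier R) \<Longrightarrow> (\<And>t. Y t \<in> carrier R) \<Longrightarrow> F (\<lambda>t. X t \<oplus> Y t) = F X \<oplus> F Y"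
    and "r \<in> carrier R \<Longrightarrow> (\<And>t. X t \<in> carrier R) \<Longrightarrow> F (\<lambda>t. r \<otimes> X t) = r \<otimes> F X"
  using assms[unfolded linfun_def, THEN conjunct1, THEN spec[of _ X]]
    assms[unfolded linfun_def, THEN conjunct2, THEN conjunct1, THEN spec[of _ X], THEN spec[of _ Y]]
    assms[unfolded linfun_def, THEN conjunct2, THEN conjunct2, THEN spec[of _ r], THEN spec[of _ X]]
  by simp_all

lemma linfunI:
  assumes "\<And>X. (\<And>t. X t \<in> carrier R) \<Longrightarrow> F X \<in> carrier R"
    and "\<And>X Y. (\<And>t. X t \<in> carrier R) \<Longrightarrow> (\<And>t. Y t \<in> carrier R) \<Longrightarrow> F (\<lambda>t. X t \<oplus> Y t) = F X \<oplus> F Y"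
    and "\<And>r X. r \<in> carrier R \<Longrightarrow> (\<And>t. X t \<in> carrier R) \<Longrightarrow> F (\<lambda>t. r \<otimes> X t) = r \<otimes> F X"
  shows "linfun F"
  unfolding linfun_def by (intro conjI allI impI; rule assms; simp)

lemma linfun_coord: "c \<in> carrier R \<Longrightarrow> linfun (\<lambda>X. c \<otimes> X t)"
  by (rule linfunI) (simp_all add: r_distr m_lcomm)

lemma linfun_zero: "linfun (\<lambda>X. \<zero>)"
  by (rule linfunI) simp_all

lemma linfun_add:
  fixes F G :: "('i \<Rightarrow> 'a) \<Rightarrow> 'a"
  assumes "linfun F" "linfun G"
  shows "linfun (\<lambda>X. F X \<oplus> G X)"
proof (rule linfunI)
  fix X Y :: "'i \<Rightarrow> 'a" and r
  assume X: "\<And>t. X t \<in> carrier R"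
  have c: "F X \<in> carrier R" "G X \<in> carrier R" using X by (simp_all add: linfunD(1) assms)
  show "F X \<oplus> G X \<in> carrier R" using c by simp
  show "F (\<lambda>t. r \<otimes> X t) \<oplus> G (\<lambda>t. r \<otimes> X t) = r \<otimes> (F X \<oplus> G X)" if "r \<in> carrier R"
    using X c that by (simp add: linfunD(3) assms r_distr)
  assume Y: "\<And>t. Y t \<in> carrier R"
  have d: "F Y \<in> carrier R" "G Y \<in> carrier R" using Y by (simp_all add: linfunD(1) assms)
  show "F (\<lambda>t. X t \<oplus> Y t) \<oplus> G (\<lambda>t. X t \<oplus> Y t) = F X \<oplus> G X \<oplus> (F Y \<oplus> G Y)"
    using X Y c d by (simp add: linfunD(2) assms a_ac)
qed

lemma linfun_reindex:
  fixes F :: "('i \<Rightarrow> 'a) \<Rightarrow> 'a" and h :: "'i \<Rightarrow> 'j"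
  assumes "linfun F"
  shows "linfun (\<lambda>X. F (\<lambda>q. X (h q)))"
proof (rule linfunI)
  fix X :: "'j \<Rightarrow> 'a" assume X: "\<And>t. X t \<in> carrier R"
  show "F (\<lambda>q. X (h q)) \<in> carrier R" by (rule linfunD(1)[OF assms]) (rule X)
  show "F (\<lambda>q. r \<otimes> X (h q)) = r \<otimes> F (\<lambda>q. X (h q))" if "r \<in> carrier R" for r
    by (rule linfunD(3)[OF assms that]) (rule X)
  show "F (\<lambda>q. X (h q) \<oplus> Y (h q)) = F (\<lambda>q. X (h q)) \<oplus> F (\<lambda>q. Y (h q))"
    if "\<And>t. Y t \<in> carrier R" for Y
    by (rule linfunD(2)[OF assms]) (rule X that)+
qed

lemma linfun_if: "linfun F \<Longrightarrow> linfun G \<Longrightarrow> linfun (\<lambda>X. if b then F X else G X)"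
  by (cases b) simp_all

section \<open>Diagonal blocks with prescribed columns\<close>

text \<open>The role of an invertible square matrix over R, stated as preservation and reflection of
  divisibility by every power of pi, so that neither determinants nor inverse matrices
  appear.\<close>

definition block_iso :: "nat \<Rightarrow> (nat \<Rightarrow> (nat \<Rightarrow> 'a) \<Rightarrow> 'a) \<Rightarrow> bool" where
  "block_iso \<rho> D \<longleftrightarrow> (\<forall>p. linfun (D p)) \<and>
     (\<forall>n X. (\<forall>q. X q \<in> carrier R) \<longrightarrow>
        (\<forall>q\<in>{1..\<rho>}. X q \<in> P n) \<longleftrightarrow> (\<forall>p\<in>{1..\<rho>}. D p X \<in> P n))"

lemma block_isoD:
  assumes "block_iso \<rho> D" "\<And>q. X q \<in> carrier R"
  shows "(\<forall>q\<in>{1..\<rho>}. X q \<in> P n) \<longleftrightarrow> (\<forall>p\<in>{1..\<rho>}. D p X \<in> P n)"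
proof -
  have "\<forall>n X. (\<forall>q. X q \<in> carrier R) \<longrightarrow>
      (\<forall>q\<in>{1..\<rho>}. X q \<in> P n) \<longleftrightarrow> (\<forall>p\<in>{1..\<rho>}. D p X \<in> P n)"
    using assms(1) unfolding block_iso_def by (rule conjunct2)
  from this[THEN spec[of _ n], THEN spec[of _ X], THEN mp] assms(2) show ?thesis by simp
qed

text \<open>The column u is completed by the unit vectors of the rows other than p0. Row p0 recovers
  X 1 because \<open>u p0\<close> is a unit, and every other row then recovers one further
  coordinate.\<close>

lemma block_iso_one_column:
  assumes u: "\<And>p. u p \<in> carrier R" and p0: "p0 \<in> {1..\<rho>}" "u p0 \<in> Units R"
  shows "\<exists>D. block_iso \<rho> D \<and>
    (\<forall>p X. (\<forall>q. X q \<in> carrier R) \<longrightarrow> (\<forall>q\<in>{2..\<rho>}. X q = \<zero>) \<longrightarrow> D p X = u p \<otimes> X 1)"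
proof -
  have "card ({1..\<rho>} - {p0}) = card {2..\<rho>}" using p0 by simp
  \<comment> \<open>\<open>\<tau>\<close> tells which of the remaining columns is the unit vector of
    row p.\<close>
  then obtain \<tau> where \<tau>: "bij_betw \<tau> ({1..\<rho>} - {p0}) {2..\<rho>}"
    using finite_same_card_bij[of "{1..\<rho>} - {p0}" "{2..\<rho>}"] by auto
  define D where "D p X = u p \<otimes> X 1 \<oplus> (if p \<in> {1..\<rho>} - {p0} then \<one> \<otimes> X (\<tau> p) else \<zero>)" for p and X :: "nat \<Rightarrow> 'a"
  have lin: "linfun (D p)" for p
    unfolding D_def by (intro linfun_add linfun_if linfun_coord linfun_zero u one_closed)
  have "(\<forall>q\<in>{1..\<rho>}. X q \<in> P n) \<longleftrightarrow> (\<forall>p\<in>{1..\<rho>}. D p X \<in> P n)" if X: "\<forall>q. X q \<in> carrier R" for X n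
  proof
    assume L: "\<forall>q\<in>{1..\<rho>}. X q \<in> P n"
    show "\<forall>p\<in>{1..\<rho>}. D p X \<in> P n"
    proof
      fix p assume p: "p \<in> {1..\<rho>}"
      have "X 1 \<in> P n" using L p0 by simp
      moreover have "X (\<tau> p) \<in> P n" if "p \<in> {1..\<rho>} - {p0}"
        using bij_betwE[OF \<tau>] that L by force
      ultimately show "D p X \<in> P n" using u X by (auto simp: D_def)
    qed
  next
    assume R: "\<forall>p\<in>{1..\<rho>}. D p X \<in> P n"
    have "D p0 X \<in> P n" using R p0 by simp
    then have X1: "X 1 \<in> P n" using u X unit_mult_P[OF p0(2)] by (simp add: D_def)
    show "\<forall>q\<in>{1..\<rho>}. X q \<in> P n"
    proof
      fix q assume q: "q \<in> {1..\<rho>}"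
      show "X q \<in> P n"
      proof (cases "q = 1")
        case False
        then have "q \<in> \<tau> ` ({1..\<rho>} - {p0})" using q \<tau> by (auto simp: bij_betw_def)
        then obtain p where p: "p \<in> {1..\<rho>} - {p0}" "q = \<tau> p" by blast
        then have "D p X \<in> P n" using R by simp
        then show ?thesis using p X u X1 by (simp add: D_def add_in_P_iff)
      qed (use X1 in simp)
    qed
  qed
  then have "block_iso \<rho> D" using lin by (simp add: block_iso_def)
  moreover have "D p X = u p \<otimes> X 1" if "\<forall>q. X q \<in> carrier R" "\<forall>q\<in>{2..\<rho>}. X q = \<zero>" for p X
    using that u bij_betwE[OF \<tau>, rule_format, of p] by (auto simp: D_def)
  ultimately show ?thesis by blast
qed

lemma cramer:
  assumes "a \<in> carrier R" "b \<in> carrier R" "c \<in> carrier R" "d \<in> carrier R" "x \<in> carrier R" "y \<in> carrier R"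
  shows "d \<otimes> (a \<otimes> x \<oplus> b \<otimes> y) \<ominus> b \<otimes> (c \<otimes> x \<oplus> d \<otimes> y) = (a \<otimes> d \<ominus> c \<otimes> b) \<otimes> x"
    and "a \<otimes> (c \<otimes> x \<oplus> d \<otimes> y) \<ominus> c \<otimes> (a \<otimes> x \<oplus> b \<otimes> y) = (a \<otimes> d \<ominus> c \<otimes> b) \<otimes> y"
  using assms by algebra+

text \<open>As for one column: Cramer's rule for the unit minor in rows p0 and p1 recovers X 1 and X
  2, and the completing unit vectors give the rest.\<close>

lemma block_iso_two_columns:
  assumes u: "\<And>p. u p \<in> carrier R" and w: "\<And>p. w p \<in> carrier R"
    and p0: "p0 \<in> {1..\<rho>}" "p1 \<in> {1..\<rho>}" "u p0 \<otimes> w p1 \<ominus> u p1 \<otimes> w p0 \<in> Units R"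
  shows "\<exists>D. block_iso \<rho> D \<and>
    (\<forall>p X. (\<forall>q. X q \<in> carrier R) \<longrightarrow> (\<forall>q\<in>{3..\<rho>}. X q = \<zero>) \<longrightarrow> D p X = u p \<otimes> X 1 \<oplus> w p \<otimes> X 2)"
proof -
  have "p0 \<noteq> p1"
  proof
    assume "p0 = p1"
    then have "u p0 \<otimes> w p1 \<ominus> u p1 \<otimes> w p0 = \<zero>" using u w by (simp add: minus_eq r_neg)
    then show False using p0(3) P_1_unit[of \<zero>] by simp
  qed
  then have "card ({1..\<rho>} - {p0, p1}) = card {3..\<rho>}" using p0 by (simp add: card_Diff_subset)
  then obtain \<tau> where \<tau>: "bij_betw \<tau> ({1..\<rho>} - {p0, p1}) {3..\<rho>}"
    using finite_same_card_bij[of "{1..\<rho>} - {p0, p1}" "{3..\<rho>}"] by auto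
  have \<rho>: "2 \<le> \<rho>" using p0 \<open>p0 \<noteq> p1\<close> by auto
  define D where "D p X = (u p \<otimes> X 1 \<oplus> w p \<otimes> X 2) \<oplus>
    (if p \<in> {1..\<rho>} - {p0, p1} then \<one> \<otimes> X (\<tau> p) else \<zero>)" for p and X :: "nat \<Rightarrow> 'a"
  have lin: "linfun (D p)" for p
    unfolding D_def by (intro linfun_add linfun_if linfun_coord linfun_zero u w one_closed)
  have "(\<forall>q\<in>{1..\<rho>}. X q \<in> P n) \<longleftrightarrow> (\<forall>p\<in>{1..\<rho>}. D p X \<in> P n)" if X: "\<forall>q. X q \<in> carrier R" for X n
  proof
    assume L: "\<forall>q\<in>{1..\<rho>}. X q \<in> P n"
    show "\<forall>p\<in>{1..\<rho>}. D p X \<in> P n"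
    proof
      fix p assume p: "p \<in> {1..\<rho>}"
      have "X 1 \<in> P n" "X 2 \<in> P n" using L \<rho> by simp_all
      moreover have "X (\<tau> p) \<in> P n" if "p \<in> {1..\<rho>} - {p0, p1}"
        using bij_betwE[OF \<tau>] that L by force
      ultimately show "D p X \<in> P n" using u w X by (auto simp: D_def)
    qed
  next
    assume R: "\<forall>p\<in>{1..\<rho>}. D p X \<in> P n"
    have D01: "D p0 X = u p0 \<otimes> X 1 \<oplus> w p0 \<otimes> X 2" "D p1 X = u p1 \<otimes> X 1 \<oplus> w p1 \<otimes> X 2"
      using u w X by (simp_all add: D_def)
    have "D p0 X \<in> P n" "D p1 X \<in> P n" using R p0 by simp_all
    then have "w p1 \<otimes> D p0 X \<ominus> w p0 \<otimes> D p1 X \<in> P n" "u p0 \<otimes> D p1 X \<ominus> u p1 \<otimes> D p0 X \<in> P n"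
      using u w by simp_all
    then have X12: "X 1 \<in> P n" "X 2 \<in> P n"
      unfolding D01 using u w X unit_mult_P[OF p0(3)] by (simp_all add: cramer)
    show "\<forall>q\<in>{1..\<rho>}. X q \<in> P n"
    proof
      fix q assume q: "q \<in> {1..\<rho>}"
      show "X q \<in> P n"
      proof (cases "q = 1 \<or> q = 2")
        case False
        then have "q \<in> \<tau> ` ({1..\<rho>} - {p0, p1})" using q \<tau> by (auto simp: bij_betw_def)
        then obtain p where p: "p \<in> {1..\<rho>} - {p0, p1}" "q = \<tau> p" by blast
        then have "D p X \<in> P n" using R by simp
        then show ?thesis using p X u w X12 by (simp add: D_def add_in_P_iff)
      qed (use X12 in auto)
    qed
  qed
  then have "block_iso \<rho> D" using lin by (simp add: block_iso_def)
  moreover have "D p X = u p \<otimes> X 1 \<oplus> w p \<otimes> X 2"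
    if "\<forall>q. X q \<in> carrier R" "\<forall>q\<in>{3..\<rho>}. X q = \<zero>" for p X
    using that u w bij_betwE[OF \<tau>, rule_format, of p] by (auto simp: D_def)
  ultimately show ?thesis by blast
qed

section \<open>Rows that define automorphisms\<close>

text \<open>The first condition makes the rows well defined on classes. The second concerns X
  representing an element of the socle: if the blocks of larger index (smaller \<open>lam\<close>)
  vanish and the rows of block i vanish on X, then so does block i of X.\<close>

definition admissible_rows ::
  "(nat \<Rightarrow> nat) \<Rightarrow> (nat \<times> nat) set \<Rightarrow> nat \<Rightarrow> nat \<Rightarrow> (nat \<Rightarrow> (nat \<times> nat \<Rightarrow> 'a) \<Rightarrow> 'a) \<Rightarrow> bool" where
  "admissible_rows lam A i \<rho> F \<longleftrightarrow>
     (\<forall>p\<in>{1..\<rho>}. linfun (F p) \<and>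
        (\<forall>X. (\<forall>t. X t \<in> carrier R) \<longrightarrow> (\<forall>t\<in>A. X t \<in> P (lam (fst t))) \<longrightarrow> F p X \<in> P (lam i))) \<and>
     (\<forall>X. (\<forall>t. X t \<in> carrier R) \<longrightarrow> (\<forall>t\<in>A. X t \<in> P (lam (fst t) - 1)) \<longrightarrow>
        (\<forall>t\<in>A. i < fst t \<longrightarrow> X t \<in> P (lam (fst t))) \<longrightarrow>
        (\<forall>p\<in>{1..\<rho>}. F p X \<in> P (lam i)) \<longrightarrow> (\<forall>q\<in>{1..\<rho>}. X (i, q) \<in> P (lam i)))"

text \<open>
  Truncated subtraction makes the condition on \<open>d\<close> vacuous when $\lambda_i$ is smaller than the
  length of the source, where indeed every scalar defines a homomorphism.
\<close>

definition off_diagonal ::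
  "(nat \<Rightarrow> nat) \<Rightarrow> (nat \<times> nat) set \<Rightarrow> nat \<Rightarrow> nat \<times> nat \<Rightarrow> (nat \<Rightarrow> 'a) \<Rightarrow> bool" where
  "off_diagonal lam A i t d \<longleftrightarrow> t \<in> A \<and> (\<forall>p. d p \<in> P (lam i - lam (fst t))) \<and>
     (fst t = i \<longrightarrow> (\<forall>p. d p = \<zero>))"

lemma off_diagonal_closed: "off_diagonal lam A i t d \<Longrightarrow> d p \<in> carrier R"
  by (rule P_carrier[of _ "lam i - lam (fst t)"]) (simp add: off_diagonal_def)

lemma off_diagonal_P:
  assumes "off_diagonal lam A i t d" "X t \<in> P (lam (fst t))"
  shows "d p \<otimes> X t \<in> P (lam i)"
proof -
  have "d p \<otimes> X t \<in> P (lam i - lam (fst t) + lam (fst t))"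
    using assms by (intro P_mult) (auto simp: off_diagonal_def)
  then show ?thesis by (rule P_mono_elem) simp
qed

text \<open>On the socle an off-diagonal column contributes nothing: from a longer cyclic summand X
  t already lies in pi^lam_i, for a shorter one X t vanishes by assumption, and inside block i the
  column is zero.\<close>

lemma off_diagonal_P':
  assumes "partition_type k lam rho" "i \<in> {1..k}"
    and "off_diagonal lam (summands k rho) i t d" "X t \<in> carrier R" "X t \<in> P (lam (fst t) - 1)"
    "i < fst t \<Longrightarrow> X t \<in> P (lam (fst t))"
  shows "d p \<otimes> X t \<in> P (lam i)"
proof (cases "fst t" i rule: linorder_cases)
  case equal
  then show ?thesis using assms by (simp add: off_diagonal_def)
next
  case greater
  then show ?thesis using assms off_diagonal_P by blast
next
  case less
  have "fst t \<in> {1..k}" using assms(3) by (auto simp: off_diagonal_def summands_def)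
  then have "lam i \<le> lam (fst t) - 1"
    using less assms(1,2) by (fastforce simp: partition_type_def)
  then have "X t \<in> P (lam i)" using P_mono_elem[OF assms(5)] by simp
  then show ?thesis using off_diagonal_closed[OF assms(3)] by simp
qed

text \<open>Two off-diagonal columns besides the diagonal block are enough for all later cases: one
  absorbs the residual of the second equation, the other is the column \<open>\<iota> i\<close> that
  solves the first equation when i is outside S.\<close>

lemma admissible_rowsI:
  assumes "partition_type k lam rho" "i \<in> {1..k}" "block_iso (rho i) D"
    "off_diagonal lam (summands k rho) i t d" "off_diagonal lam (summands k rho) i t' d'"
  shows "admissible_rows lam (summands k rho) i (rho i)
    (\<lambda>p X. (d p \<otimes> X t \<oplus> d' p \<otimes> X t') \<oplus> D p (\<lambda>q. X (i, q)))" (is "admissible_rows lam ?A i ?\<rho> ?F")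
proof -
  have d: "d p \<in> carrier R" "d' p \<in> carrier R" for p
    by (rule off_diagonal_closed[OF assms(4)], rule off_diagonal_closed[OF assms(5)])
  have lin: "linfun (\<lambda>X. D p (\<lambda>q. X (i, q)))" for p
    using assms(3) by (intro linfun_reindex[of "D p" "Pair i"]) (simp add: block_iso_def)
  have Dc: "D p (\<lambda>q. X (i, q)) \<in> carrier R" if "\<forall>t. X t \<in> carrier R" for p X
    using linfunD(1)[OF lin[of p]] that by blast
  have Diff: "(\<forall>q\<in>{1..?\<rho>}. X (i, q) \<in> P n) \<longleftrightarrow> (\<forall>p\<in>{1..?\<rho>}. D p (\<lambda>q. X (i, q)) \<in> P n)"
    if "\<forall>t. X t \<in> carrier R" for X n
    by (rule block_isoD[OF assms(3)]) (use that in simp)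
  have ip: "(i, q) \<in> ?A" if "q \<in> {1..?\<rho>}" for q using that assms(2) by (simp add: summands_def)
  show ?thesis unfolding admissible_rows_def
  proof (intro conjI ballI allI impI)
    show "linfun (?F p)" for p by (intro linfun_add linfun_coord d lin)
    show "?F p X \<in> P (lam i)"
      if "\<forall>t. X t \<in> carrier R" "\<forall>t\<in>?A. X t \<in> P (lam (fst t))" "p \<in> {1..?\<rho>}" for p X
    proof -
      have "\<forall>q\<in>{1..?\<rho>}. X (i, q) \<in> P (lam i)" using that(2) ip by fastforce
      then have "D p (\<lambda>q. X (i, q)) \<in> P (lam i)" using Diff that(1,3) by blast
      moreover have "t \<in> ?A" "t' \<in> ?A" using assms(4,5) by (auto simp: off_diagonal_def)
      ultimately show ?thesis using that(2) assms(4,5) by (intro P_add off_diagonal_P) auto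
    qed
    fix X q
    assume X: "\<forall>t. X t \<in> carrier R" "\<forall>t\<in>?A. X t \<in> P (lam (fst t) - 1)"
      "\<forall>t\<in>?A. i < fst t \<longrightarrow> X t \<in> P (lam (fst t))" "\<forall>p\<in>{1..?\<rho>}. ?F p X \<in> P (lam i)"
      and q: "q \<in> {1..?\<rho>}"
    have "t \<in> ?A" "t' \<in> ?A" using assms(4,5) by (auto simp: off_diagonal_def)
    then have "d p \<otimes> X t \<oplus> d' p \<otimes> X t' \<in> P (lam i)" for p
      using X by (intro P_add off_diagonal_P'[OF assms(1,2)] assms(4,5)) (simp_all del: split_paired_All)
    then have "\<forall>p\<in>{1..?\<rho>}. D p (\<lambda>q. X (i, q)) \<in> P (lam i)"
      using X(4) add_in_P_iff[OF _ Dc[OF X(1)]] by simp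
    then have "\<forall>q\<in>{1..?\<rho>}. X (i, q) \<in> P (lam i)" by (rule iffD2[OF Diff[OF X(1)]])
    then show "X (i, q) \<in> P (lam i)" using q by (rule bspec)
  qed
qed

text \<open>Expansion in digits: representatives t modulo pi^n and finitely many residue
  representatives c give representatives t + pi^n c modulo pi^(n+1).\<close>

lemma finite_carrier_Rn:
  assumes "finite (carrier (R Quot PIdl \<pi>))"
  shows "finite (carrier (Z n))"
proof -
  have "finite (cl 1 ` carrier R)"
    using assms carrier_Rn[of 1] by (simp add: Rn_def Let_def)
  then obtain C where C: "C \<subseteq> carrier R" "finite C" "cl 1 ` carrier R = cl 1 ` C"
    using finite_subset_image[of "cl 1 ` carrier R" "cl 1" "carrier R"] by blast
  have "\<exists>T. finite T \<and> T \<subseteq> carrier R \<and> (\<forall>x\<in>carrier R. \<exists>t\<in>T. x \<ominus> t \<in> P n)"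
  proof (induction n)
    case 0
    show ?case by (intro exI[of _ "{\<zero>}"]) simp
  next
    case (Suc n)
    then obtain T where T: "finite T" "T \<subseteq> carrier R" "\<And>x. x \<in> carrier R \<Longrightarrow> \<exists>t\<in>T. x \<ominus> t \<in> P n"
      by blast
    have "\<exists>t'\<in>(\<lambda>(t, c). t \<oplus> \<pi> [^] n \<otimes> c) ` (T \<times> C). x \<ominus> t' \<in> P (Suc n)" if x: "x \<in> carrier R" for x
    proof -
      obtain t where t: "t \<in> T" "x \<ominus> t \<in> P n" using T(3)[OF x] by blast
      then obtain w where w: "w \<in> carrier R" "x \<ominus> t = \<pi> [^] n \<otimes> w" by (auto simp: P_iff)
      then have "cl 1 w \<in> cl 1 ` C" using C(3) by blast
      then obtain c where c: "c \<in> C" "cl 1 w = cl 1 c" by blast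
      have tc: "t \<in> carrier R" "c \<in> carrier R" using t c T(2) C(1) by auto
      have "w \<ominus> c \<in> P 1" using c(2) cl_eq_iff[OF w(1) tc(2)] by simp
      then have "\<pi> [^] n \<otimes> (w \<ominus> c) \<in> P (n + 1)" by (intro P_mult P_pow)
      moreover have "x \<ominus> (t \<oplus> \<pi> [^] n \<otimes> c) = (x \<ominus> t) \<ominus> \<pi> [^] n \<otimes> c"
        using x tc by (simp add: minus_eq minus_add a_ac)
      moreover have "\<dots> = \<pi> [^] n \<otimes> (w \<ominus> c)"
        unfolding w(2) using w(1) tc by (simp add: minus_eq r_distr r_minus)
      ultimately have "x \<ominus> (t \<oplus> \<pi> [^] n \<otimes> c) \<in> P (Suc n)" by simp
      then show ?thesis using t(1) c(1) by force
    qed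
    then show ?case using T(1) C(2) subsetD[OF T(2)] subsetD[OF C(1)]
      by (intro exI[of _ "(\<lambda>(t, c). t \<oplus> \<pi> [^] n \<otimes> c) ` (T \<times> C)"]) auto
  qed
  then obtain T where T: "finite T" "T \<subseteq> carrier R" "\<And>x. x \<in> carrier R \<Longrightarrow> \<exists>t\<in>T. x \<ominus> t \<in> P n"
    by blast
  have "cl n x \<in> cl n ` T" if x: "x \<in> carrier R" for x
  proof -
    obtain t where "t \<in> T" "x \<ominus> t \<in> P n" using T(3)[OF x] by blast
    then have "cl n x = cl n t" using cl_eq_iff[OF x] subsetD[OF T(2)] by simp
    then show ?thesis using \<open>t \<in> T\<close> by blast
  qed
  then have "carrier (Z n) \<subseteq> cl n ` T" by (auto simp: carrier_Rn)
  then show ?thesis using T(1) finite_surj by blast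
qed

lemma admissible_rowsD:
  assumes "admissible_rows lam A i \<rho> F"
  shows "p \<in> {1..\<rho>} \<Longrightarrow> linfun (F p)"
    and "p \<in> {1..\<rho>} \<Longrightarrow> (\<And>t. X t \<in> carrier R) \<Longrightarrow> (\<And>t. t \<in> A \<Longrightarrow> X t \<in> P (lam (fst t))) \<Longrightarrow> F p X \<in> P (lam i)"
    and "(\<And>t. X t \<in> carrier R) \<Longrightarrow> (\<And>t. t \<in> A \<Longrightarrow> X t \<in> P (lam (fst t) - 1)) \<Longrightarrow>
      (\<And>t. t \<in> A \<Longrightarrow> i < fst t \<Longrightarrow> X t \<in> P (lam (fst t))) \<Longrightarrow>
      (\<And>p. p \<in> {1..\<rho>} \<Longrightarrow> F p X \<in> P (lam i)) \<Longrightarrow> q \<in> {1..\<rho>} \<Longrightarrow> X (i, q) \<in> P (lam i)"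
  using assms unfolding admissible_rows_def by blast+

text \<open>If the class of X were nonzero, multiplying X by the last power of pi that does not
  annihilate it would give a nonzero Y in the socle, still in the kernel. The block of largest index
  where Y is nonzero contradicts admissibility.\<close>

lemma admissible_rows_kernel:
  assumes part: "partition_type k lam rho"
    and adm: "\<And>i. i \<in> {1..k} \<Longrightarrow> admissible_rows lam (summands k rho) i (rho i) (F i)"
    and X: "\<And>t. X t \<in> carrier R"
    and FX: "\<And>t. t \<in> summands k rho \<Longrightarrow> F (fst t) (snd t) X \<in> P (lam (fst t))"
    and t: "t \<in> summands k rho"
  shows "X t \<in> P (lam (fst t))"
proof (rule ccontr)
  let ?A = "summands k rho"
  assume nt: "X t \<notin> P (lam (fst t))"
  define Q where "Q N \<longleftrightarrow> (\<forall>t\<in>?A. \<pi> [^] N \<otimes> X t \<in> P (lam (fst t)))" for N :: nat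
  \<comment> \<open>The sum of all \<open>lam i\<close> is just a convenient exponent that
    annihilates every block.\<close>
  have "Q (\<Sum>i\<in>{1..k}. lam i)"
    unfolding Q_def
  proof
    fix t assume "t \<in> ?A"
    then have "lam (fst t) \<le> (\<Sum>i\<in>{1..k}. lam i)" by (intro member_le_sum) (auto simp: summands_def)
    then have "\<pi> [^] (\<Sum>i\<in>{1..k}. lam i) \<in> P (lam (fst t))" by (rule P_mono_elem[OF P_pow])
    then show "\<pi> [^] (\<Sum>i\<in>{1..k}. lam i) \<otimes> X t \<in> P (lam (fst t))" using X by simp
  qed
  moreover define N where "N = (LEAST N. Q N)"
  ultimately have N: "Q N" by (metis LeastI)
  have "\<not> Q 0" using nt t X by (auto simp: Q_def)
  then obtain N' where N': "N = Suc N'" using N by (cases N) auto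
  then have nQ: "\<not> Q N'" unfolding N_def using not_less_Least[of N' Q] by simp
  define Y where "Y t = \<pi> [^] N' \<otimes> X t" for t
  have Y: "Y t \<in> carrier R" for t using X by (simp add: Y_def)
  have lam1: "1 \<le> lam (fst t)" if "t \<in> ?A" for t
    using that part by (auto simp: summands_def partition_type_def)
  have Y1: "Y t \<in> P (lam (fst t) - 1)" if "t \<in> ?A" for t
  proof -
    have "\<pi> [^] (1::nat) \<otimes> Y t = \<pi> [^] N \<otimes> X t"
      using X by (simp add: Y_def N' m_ac)
    then have "\<pi> [^] (1::nat) \<otimes> Y t \<in> P (lam (fst t))" using N that by (simp add: Q_def)
    then show ?thesis using P_pow_mult[OF Y lam1[OF that]] by simp
  qed
  define B where "B = {i\<in>{1..k}. \<exists>q\<in>{1..rho i}. Y (i, q) \<notin> P (lam i)}"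
  have "B \<noteq> {}" using nQ by (force simp: Q_def B_def Y_def summands_def)
  moreover have "finite B" by (simp add: B_def)
  ultimately have M: "Max B \<in> B" "\<And>j. j \<in> B \<Longrightarrow> j \<le> Max B" by (auto intro: Max_in)
  let ?i = "Max B"
  have i: "?i \<in> {1..k}" using M by (simp add: B_def)
  have "Y (?i, q) \<in> P (lam ?i)" if "q \<in> {1..rho ?i}" for q
  proof (rule admissible_rowsD(3)[OF adm[OF i] Y Y1 _ _ that])
    fix t assume "t \<in> ?A" "?i < fst t"
    then show "Y t \<in> P (lam (fst t))" using M(2)[of "fst t"] by (fastforce simp: B_def summands_def)
  next
    fix p assume p: "p \<in> {1..rho ?i}"
    have "F ?i p Y = \<pi> [^] N' \<otimes> F ?i p X"
      unfolding Y_def using X by (intro linfunD(3)[OF admissible_rowsD(1)[OF adm[OF i] p]]) simp_all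
    moreover have "F ?i p X \<in> P (lam ?i)" using FX[of "(?i, p)"] i p by (simp add: summands_def)
    ultimately show "F ?i p Y \<in> P (lam ?i)" by simp
  qed
  then show False using M(1) by (auto simp: B_def)
qed

text \<open>The rows act on lifts. The equivalence \<open>inj\<close> read from right to left is
  independence of the chosen lifts, and from left to right it is injectivity on classes.\<close>

lemma module_aut_of_rows:
  assumes fin: "finite (carrier (R Quot PIdl \<pi>))"
    and part: "partition_type k lam rho"
    and adm: "\<And>i. i \<in> {1..k} \<Longrightarrow> admissible_rows lam (summands k rho) i (rho i) (F i)"
  shows "\<exists>g\<in>module_aut R (Rlam R \<pi> k lam rho). \<forall>X. (\<forall>t. X t \<in> carrier R) \<longrightarrow>
    g (clv lam (summands k rho) X) = clv lam (summands k rho) (\<lambda>t. F (fst t) (snd t) X)"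
proof -
  let ?A = "summands k rho"
  let ?M = "Rsum R \<pi> lam ?A"
  \<comment> \<open>The value 0 outside the index set keeps G X a family in R at every
    index.\<close>
  define G where "G X t = (if t \<in> ?A then F (fst t) (snd t) X else \<zero>)" for X t
  have clvG: "clv lam ?A (\<lambda>t. F (fst t) (snd t) X) = clv lam ?A (G X)" for X
    by (auto simp: clv_def G_def fun_eq_iff)
  have lin: "linfun (F (fst t) (snd t))" if "t \<in> ?A" for t
    using that admissible_rowsD(1)[OF adm] by (auto simp: summands_def)
  have Gc: "G X t \<in> carrier R" if "\<And>t. X t \<in> carrier R" for X t
    using linfunD(1)[OF lin] that by (auto simp: G_def)
  have Gadd: "G (\<lambda>t. X t \<oplus> Y t) t = G X t \<oplus> G Y t"
    if "\<And>t. X t \<in> carrier R" "\<And>t. Y t \<in> carrier R" for X Y t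
    using linfunD(2)[OF lin, of t X Y] that by (auto simp: G_def)
  have Gsmult: "G (\<lambda>t. r \<otimes> X t) t = r \<otimes> G X t"
    if "r \<in> carrier R" "\<And>t. X t \<in> carrier R" for X t r
    using linfunD(3)[OF lin, of t r X] that by (auto simp: G_def)
  have Gdiff: "G X t \<ominus> G Y t = G (\<lambda>t. X t \<ominus> Y t) t"
    if X: "\<And>t. X t \<in> carrier R" and Y: "\<And>t. Y t \<in> carrier R" for X Y t
  proof -
    have "G X t = G (\<lambda>t. Y t \<oplus> (X t \<ominus> Y t)) t"
      using X Y by (simp add: minus_eq a_ac r_neg r_neg2)
    also have "\<dots> = G Y t \<oplus> G (\<lambda>t. X t \<ominus> Y t) t" using X Y by (intro Gadd) simp_all
    finally show ?thesis using Gc[of Y t] Gc[of "\<lambda>t. X t \<ominus> Y t" t] X Y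
      by (simp add: minus_eq a_ac r_neg r_neg2)
  qed
  have ker: "(\<forall>t\<in>?A. G X t \<in> P (lam (fst t))) \<longleftrightarrow> (\<forall>t\<in>?A. X t \<in> P (lam (fst t)))"
    if X: "\<And>t. X t \<in> carrier R" for X
  proof
    assume "\<forall>t\<in>?A. G X t \<in> P (lam (fst t))"
    then show "\<forall>t\<in>?A. X t \<in> P (lam (fst t))"
      using admissible_rows_kernel[OF part adm, of X] X by (simp add: G_def)
  next
    assume *: "\<forall>t\<in>?A. X t \<in> P (lam (fst t))"
    show "\<forall>t\<in>?A. G X t \<in> P (lam (fst t))"
    proof
      fix t assume t: "t \<in> ?A"
      then have "fst t \<in> {1..k}" "snd t \<in> {1..rho (fst t)}" by (auto simp: summands_def)
      then show "G X t \<in> P (lam (fst t))"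
        using admissible_rowsD(2)[OF adm, of "fst t" "snd t" X] X * t by (simp add: G_def)
    qed
  qed
  have inj: "clv lam ?A (G X) = clv lam ?A (G Y) \<longleftrightarrow> clv lam ?A X = clv lam ?A Y"
    if X: "\<And>t. X t \<in> carrier R" and Y: "\<And>t. Y t \<in> carrier R" for X Y
  proof -
    have "clv lam ?A (G X) = clv lam ?A (G Y) \<longleftrightarrow> (\<forall>t\<in>?A. G X t \<ominus> G Y t \<in> P (lam (fst t)))"
      by (intro clv_eq_iff Gc) (simp_all add: X Y)
    also have "\<dots> \<longleftrightarrow> (\<forall>t\<in>?A. G (\<lambda>t. X t \<ominus> Y t) t \<in> P (lam (fst t)))"
      by (simp only: Gdiff X Y)
    also have "\<dots> \<longleftrightarrow> (\<forall>t\<in>?A. X t \<ominus> Y t \<in> P (lam (fst t)))"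
      by (rule ker) (simp add: X Y)
    also have "\<dots> \<longleftrightarrow> clv lam ?A X = clv lam ?A Y"
      using X Y by (intro clv_eq_iff[symmetric])
    finally show ?thesis .
  qed
  define L where "L x = (SOME X. (\<forall>t. X t \<in> carrier R) \<and> x = clv lam ?A X)" for x
  have L: "L x t \<in> carrier R" "clv lam ?A (L x) = x" if x: "x \<in> carrier ?M" for x t
  proof -
    have "\<exists>X. (\<forall>t. X t \<in> carrier R) \<and> x = clv lam ?A X"
      using x by (rule RsumE) blast
    then have "(\<forall>t. L x t \<in> carrier R) \<and> x = clv lam ?A (L x)" unfolding L_def by (rule someI_ex)
    then show "L x t \<in> carrier R" "clv lam ?A (L x) = x" by (simp_all del: split_paired_All)
  qed
  \<comment> \<open>The restriction to the carrier makes g extensional, as \<open>Bij\<close>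
    requires.\<close>
  define g where "g = (\<lambda>x\<in>carrier ?M. clv lam ?A (G (L x)))"
  have g: "g (clv lam ?A X) = clv lam ?A (G X)" if X: "\<And>t. X t \<in> carrier R" for X
  proof -
    have c: "clv lam ?A X \<in> carrier ?M" using X by (rule clv_closed)
    then show ?thesis using inj[of "L (clv lam ?A X)" X] L(1)[OF c] X L(2)[OF c] by (simp add: g_def)
  qed
  have gc: "g x \<in> carrier ?M" if x: "x \<in> carrier ?M" for x
    using x by (simp add: g_def clv_closed Gc L(1))
  have "g \<in> module_hom R ?M ?M"
  proof (rule module_homI)
    fix x r assume x: "x \<in> carrier ?M"
    show "g x \<in> carrier ?M" by (rule gc[OF x])
    note Lx = L(1)[OF x]
    have gx: "g x = clv lam ?A (G (L x))" using x by (simp add: g_def)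
    show "g (r \<odot>\<^bsub>?M\<^esub> x) = r \<odot>\<^bsub>?M\<^esub> g x" if r: "r \<in> carrier R"
    proof -
      have "r \<odot>\<^bsub>?M\<^esub> x = clv lam ?A (\<lambda>t. r \<otimes> L x t)"
        using clv_smult[of r "L x" lam ?A] r Lx L(2)[OF x] by simp
      then have "g (r \<odot>\<^bsub>?M\<^esub> x) = clv lam ?A (G (\<lambda>t. r \<otimes> L x t))" using Lx r by (simp add: g)
      also have "G (\<lambda>t. r \<otimes> L x t) = (\<lambda>t. r \<otimes> G (L x) t)" using Gsmult[of r "L x"] r Lx by (simp add: fun_eq_iff)
      finally show ?thesis using clv_smult[of r "G (L x)" lam ?A] r Gc[of "L x"] Lx gx by simp
    qed
    fix y assume y: "y \<in> carrier ?M"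
    note Ly = L(1)[OF y]
    have gy: "g y = clv lam ?A (G (L y))" using y by (simp add: g_def)
    have "x \<oplus>\<^bsub>?M\<^esub> y = clv lam ?A (\<lambda>t. L x t \<oplus> L y t)"
      using clv_add[of "L x" "L y" lam ?A] Lx Ly L(2)[OF x] L(2)[OF y] by simp
    then have "g (x \<oplus>\<^bsub>?M\<^esub> y) = clv lam ?A (G (\<lambda>t. L x t \<oplus> L y t))" using Lx Ly by (simp add: g)
    also have "G (\<lambda>t. L x t \<oplus> L y t) = (\<lambda>t. G (L x) t \<oplus> G (L y) t)" using Gadd[of "L x" "L y"] Lx Ly by (simp add: fun_eq_iff)
    finally show "g (x \<oplus>\<^bsub>?M\<^esub> y) = g x \<oplus>\<^bsub>?M\<^esub> g y"
      using clv_add[of "G (L x)" "G (L y)" lam ?A] Gc[of "L x"] Gc[of "L y"] Lx Ly gx gy by simp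
  qed
  moreover have "inj_on g (carrier ?M)"
  proof (rule inj_onI)
    fix x y assume x: "x \<in> carrier ?M" and y: "y \<in> carrier ?M" and "g x = g y"
    then have "clv lam ?A (G (L x)) = clv lam ?A (G (L y))" by (simp add: g_def)
    then have "clv lam ?A (L x) = clv lam ?A (L y)" using inj[of "L x" "L y"] L(1) x y by simp
    then show "x = y" using L(2) x y by simp
  qed
  moreover have "finite (carrier ?M)"
    unfolding Rsum_def direct_sum_def
    using finite_carrier_Rn[OF fin] by (auto intro!: finite_PiE simp: summands_def)
  ultimately have "bij_betw g (carrier ?M) (carrier ?M)"
    using gc by (simp add: bij_betw_def endo_inj_surj image_subsetI)
  then have "g \<in> module_aut R (Rlam R \<pi> k lam rho)"
    using \<open>g \<in> module_hom R ?M ?M\<close> by (auto simp: module_aut_def Bij_def Rlam_def g_def)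
  then show ?thesis using g by (intro bexI[of _ g]) (simp_all add: clvG del: split_paired_All)
qed

end

section \<open>Solving one block of rows\<close>

text \<open>The numerical content of the hypotheses: \<open>s_less\<close> is the antichain property
  and \<open>iota_le\<close> the minimality of the boundary valuation at \<open>\<iota> i\<close>.
  The exponents r are arbitrary here; J and K come in at the end.\<close>

locale pair_data = dvr R \<pi> for R (structure) and \<pi> +
  fixes k :: nat and lam rho s \<iota> :: "nat \<Rightarrow> nat" and S :: "nat set"
    and y :: "nat \<Rightarrow> 'a" and r :: "nat \<Rightarrow> enat"
  assumes part: "partition_type k lam rho"
    and S_sub: "S \<subseteq> {1..k}"
    and y_closed: "j \<in> S \<Longrightarrow> y j \<in> carrier R"
    and s_less: "i \<in> S \<Longrightarrow> j \<in> S \<Longrightarrow> i \<noteq> j \<Longrightarrow> s i < lam i - lam j + s j"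
    and iota_S: "i \<in> S \<Longrightarrow> \<iota> i = i"
    and iota: "i \<in> {1..k} - S \<Longrightarrow> \<iota> i \<in> S"
    and iota_le: "i \<in> {1..k} - S \<Longrightarrow> j \<in> S \<Longrightarrow> lam i - lam (\<iota> i) + s (\<iota> i) \<le> lam i - lam j + s j"
begin

abbreviation "A \<equiv> summands k rho"

text \<open>Lifts to $R$ of the coordinates of $e(I)$ and of $f$.\<close>

definition E :: "nat \<times> nat \<Rightarrow> 'a" where
  "E t = (if fst t \<in> S \<and> snd t = 1 then \<pi> [^] s (fst t) else \<zero>)"

definition F :: "nat \<times> nat \<Rightarrow> 'a" where
  "F t = (if fst t \<in> S \<and> snd t = 1 then \<pi> [^] s (fst t) \<otimes> y (fst t)
     else if snd t = (if fst t \<in> S then 2 else 1) then pi_pow R \<pi> (r (fst t)) else \<zero>)"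

definition mm :: "nat \<Rightarrow> enat" where
  "mm = m_exp R \<pi> k lam rho S s y \<iota> r"

lemma E_closed [simp]: "E t \<in> carrier R"
  by (simp add: E_def)

lemma F_closed [simp]: "F t \<in> carrier R"
  using y_closed by (simp add: F_def)

lemma y_iota_closed: "i \<in> {1..k} \<Longrightarrow> y (\<iota> i) \<in> carrier R"
  using iota iota_S y_closed by (cases "i \<in> S") simp_all

lemma rho_pos: "i \<in> {1..k} \<Longrightarrow> 1 \<le> rho i"
  using part by (simp add: partition_type_def)

lemma lam_less: "i \<in> {1..k} \<Longrightarrow> j \<in> {1..k} \<Longrightarrow> i < j \<Longrightarrow> lam j < lam i"
  using part by (simp add: partition_type_def)

section \<open>The off-diagonal column that absorbs a residual\<close>

text \<open>Each of the six families in \<open>m_exp\<close> lists valuations of coefficients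
  outside block i, raised by the exponent \<open>lam i - lam j\<close> that a map from R_lam_j to
  R_lam_i must carry (0 for j < i). The two families with y are the first columns of blocks in S,
  with coefficient pi^s_j (y_j - y_iota); the other four are the leading columns of x, at position 2
  for j in S and 1 otherwise. For \<open>\<iota> i\<close> the difference of the y's is 0, of
  infinite valuation, so its first column never attains a finite minimum.\<close>

lemma m_exp_attained:
  assumes i: "i \<in> {1..k}" and m: "mm i = enat \<mu>"
  shows "\<exists>t\<in>A. \<exists>v. \<exists>u\<in>Units R. fst t \<noteq> i \<and> F t \<ominus> y (\<iota> i) \<otimes> E t = \<pi> [^] v \<otimes> u \<and>
    lam i - lam (fst t) + v = \<mu>"
proof -
  note Y = y_iota_closed[OF i]
  have first: ?thesis if j: "j \<in> S" "j \<noteq> i"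
    "enat (lam i - lam j + s j) + val R \<pi> (y j \<ominus> y (\<iota> i)) = enat \<mu>" for j
  proof -
    have c: "y j \<ominus> y (\<iota> i) \<in> carrier R" using y_closed[OF j(1)] Y by simp
    obtain v where v: "val R \<pi> (y j \<ominus> y (\<iota> i)) = enat v" "lam i - lam j + s j + v = \<mu>"
      using j(3) by (cases "val R \<pi> (y j \<ominus> y (\<iota> i))") auto
    obtain u where u: "u \<in> Units R" "y j \<ominus> y (\<iota> i) = \<pi> [^] v \<otimes> u"
      using val_attained[OF c v(1)] by blast
    have "F (j, 1) \<ominus> y (\<iota> i) \<otimes> E (j, 1) = \<pi> [^] s j \<otimes> (y j \<ominus> y (\<iota> i))"
      using j(1) y_closed[OF j(1)] Y by (simp add: F_def E_def minus_eq r_distr r_minus m_comm)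
    also have "\<dots> = \<pi> [^] (s j + v) \<otimes> u"
      using u by (simp add: nat_pow_mult[symmetric] m_assoc Units_closed)
    finally have "F (j, 1) \<ominus> y (\<iota> i) \<otimes> E (j, 1) = \<pi> [^] (s j + v) \<otimes> u" .
    moreover have "(j, 1) \<in> A" using j(1) S_sub rho_pos by (auto simp: summands_def)
    ultimately show ?thesis using u(1) v(2) j(2)
      by (intro bexI[of _ "(j, 1)"] exI[of _ "s j + v"] bexI[of _ u]) auto
  qed
  have second: ?thesis if j: "(j, q) \<in> A" "j \<noteq> i" "q = (if j \<in> S then 2 else 1)"
    "enat (lam i - lam j) + r j = enat \<mu>" for j q
  proof -
    obtain v where v: "r j = enat v" "lam i - lam j + v = \<mu>"
      using j(4) by (cases "r j") auto
    have "F (j, q) \<ominus> y (\<iota> i) \<otimes> E (j, q) = \<pi> [^] v \<otimes> \<one>"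
      using j(3) v(1) Y by (simp add: F_def E_def pi_pow_def minus_eq)
    then show ?thesis using v(2) j(1,2)
      by (intro bexI[of _ "(j, q)"] exI[of _ v] bexI[of _ \<one>]) auto
  qed
  have zero: "lam i - lam j = 0" if "j \<in> {1..k}" "j < i" for j
    using lam_less[OF that(1) i that(2)] by simp
  have inA: "(j, q) \<in> A" if "j \<in> {1..k}" "q = (if j \<in> S then 2 else 1)" "j \<in> S \<longrightarrow> 1 < rho j" for j q
    using that rho_pos[OF that(1)] by (auto simp: summands_def)
  let ?Q = "{
     (INF j\<in>{j \<in> S. j < i}. enat (s j) + val R \<pi> (y j \<ominus> y (\<iota> i))),
     (INF j\<in>{j \<in> S. i < j}. enat (lam i - lam j + s j) + val R \<pi> (y j \<ominus> y (\<iota> i))),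
     (INF j\<in>{j \<in> S. j < i \<and> rho j > 1}. r j),
     (INF j\<in>{j \<in> {1..k} - S. j < i}. r j),
     (INF j\<in>{j \<in> S. i < j \<and> rho j > 1}. enat (lam i - lam j) + r j),
     (INF j\<in>{j \<in> {1..k} - S. i < j}. enat (lam i - lam j) + r j)}"
  have "Min ?Q \<in> ?Q" by (rule Min_in) simp_all
  moreover have "Min ?Q = enat \<mu>" using m unfolding mm_def m_exp_def .
  ultimately have "enat \<mu> \<in> ?Q" by (simp only:)
  then consider
    "enat \<mu> = (INF j\<in>{j \<in> S. j < i}. enat (s j) + val R \<pi> (y j \<ominus> y (\<iota> i)))" |
    "enat \<mu> = (INF j\<in>{j \<in> S. i < j}. enat (lam i - lam j + s j) + val R \<pi> (y j \<ominus> y (\<iota> i)))" |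
    "enat \<mu> = (INF j\<in>{j \<in> S. j < i \<and> rho j > 1}. r j)" |
    "enat \<mu> = (INF j\<in>{j \<in> {1..k} - S. j < i}. r j)" |
    "enat \<mu> = (INF j\<in>{j \<in> S. i < j \<and> rho j > 1}. enat (lam i - lam j) + r j)" |
    "enat \<mu> = (INF j\<in>{j \<in> {1..k} - S. i < j}. enat (lam i - lam j) + r j)"
    unfolding insert_iff empty_iff by (elim disjE FalseE)
  then show ?thesis
  proof cases
    case 1
    from sym[OF 1] obtain j where "j \<in> S" "j < i" "enat (s j) + val R \<pi> (y j \<ominus> y (\<iota> i)) = enat \<mu>"
      by (rule INF_enat_attained) (rule that; simp)
    then show ?thesis using first[of j] zero[of j] S_sub by auto
  next
    case 2
    from sym[OF 2] obtain j where "j \<in> S" "i < j" "enat (lam i - lam j + s j) + val R \<pi> (y j \<ominus> y (\<iota> i)) = enat \<mu>"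
      by (rule INF_enat_attained) (rule that; simp)
    then show ?thesis using first[of j] by simp
  next
    case 3
    from sym[OF 3] obtain j where "j \<in> S" "j < i" "1 < rho j" "r j = enat \<mu>"
      by (rule INF_enat_attained) (rule that; simp)
    then show ?thesis using second[of j 2] zero[of j] inA[of j 2] S_sub by (auto simp: zero_enat_def[symmetric])
  next
    case 4
    from sym[OF 4] obtain j where "j \<in> {1..k} - S" "j < i" "r j = enat \<mu>"
      by (rule INF_enat_attained) (rule that; simp)
    then show ?thesis using second[of j 1] zero[of j] inA[of j 1] by (auto simp: zero_enat_def[symmetric])
  next
    case 5
    from sym[OF 5] obtain j where "j \<in> S" "i < j" "1 < rho j" "enat (lam i - lam j) + r j = enat \<mu>"
      by (rule INF_enat_attained) (rule that; simp)
    then show ?thesis using second[of j 2] inA[of j 2] S_sub by auto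
  next
    case 6
    from sym[OF 6] obtain j where "j \<in> {1..k} - S" "i < j" "enat (lam i - lam j) + r j = enat \<mu>"
      by (rule INF_enat_attained) (rule that; simp)
    then show ?thesis using second[of j 1] inA[of j 1] by auto
  qed
qed

text \<open>The zero column is allowed at every index, even inside block i; at (i, 1) it serves as a
  dummy when nothing has to be absorbed.\<close>

lemma off_diagonal_zero: "t \<in> A \<Longrightarrow> off_diagonal lam A i t (\<lambda>_. \<zero>)"
  by (simp add: off_diagonal_def)

text \<open>If m_i >= lam_i, then W is already 0 modulo pi^lam_i. Otherwise the column that attains
  m_i has coefficient pi^v times a unit, and W can be divided by it.\<close>

lemma off_diagonal_absorbs:
  assumes i: "i \<in> {1..k}" and Zp: "\<And>p. p \<in> {1..rho i} \<Longrightarrow> W p \<in> P (cap (lam i) (mm i))"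
  shows "\<exists>t d. off_diagonal lam A i t d \<and>
    (\<forall>p\<in>{1..rho i}. d p \<otimes> (F t \<ominus> y (\<iota> i) \<otimes> E t) \<ominus> W p \<in> P (lam i))"
proof (cases "cap (lam i) (mm i) = lam i")
  case True
  have "(i, 1) \<in> A" using i rho_pos[OF i] by (simp add: summands_def)
  then show ?thesis using Zp True y_iota_closed[OF i] P_carrier
    by (intro exI[of _ "(i, 1)"] exI[of _ "\<lambda>_. \<zero>"]) (simp add: off_diagonal_zero minus_eq)
next
  case False
  then obtain \<mu> where \<mu>: "mm i = enat \<mu>" "\<mu> < lam i" by (cases "mm i") auto
  then have Zp: "W p \<in> P \<mu>" if "p \<in> {1..rho i}" for p using Zp[OF that] by (simp add: min_def)
  obtain t v u where t: "t \<in> A" "u \<in> Units R" "fst t \<noteq> i"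
    "F t \<ominus> y (\<iota> i) \<otimes> E t = \<pi> [^] v \<otimes> u" "lam i - lam (fst t) + v = \<mu>"
    using m_exp_attained[OF i \<mu>(1)] by blast
  have "\<exists>w. w \<in> carrier R \<and> (p \<in> {1..rho i} \<longrightarrow> W p = \<pi> [^] \<mu> \<otimes> w)" for p
    using Zp[of p] by (cases "p \<in> {1..rho i}") (auto simp: P_iff)
  then obtain w where w: "\<And>p. w p \<in> carrier R" "\<And>p. p \<in> {1..rho i} \<Longrightarrow> W p = \<pi> [^] \<mu> \<otimes> w p"
    by metis
  \<comment> \<open>The quotient of W p by the coefficient pi^v u: the first factor makes the column
    a homomorphism and completes pi^v to pi^mu.\<close>
  define d where "d p = \<pi> [^] (lam i - lam (fst t)) \<otimes> (w p \<otimes> inv u)" for p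
  have "off_diagonal lam A i t d"
    using t w(1) by (simp add: off_diagonal_def d_def)
  moreover have "d p \<otimes> (F t \<ominus> y (\<iota> i) \<otimes> E t) \<ominus> W p \<in> P (lam i)" if p: "p \<in> {1..rho i}" for p
  proof -
    have uc: "u \<in> carrier R" "inv u \<in> carrier R" "inv u \<otimes> u = \<one>" using t(2) by (simp_all add: Units_closed)
    have "d p \<otimes> (\<pi> [^] v \<otimes> u) = \<pi> [^] (lam i - lam (fst t)) \<otimes> \<pi> [^] v \<otimes> (w p \<otimes> (inv u \<otimes> u))"
      using w(1)[of p] uc(1,2) by (simp add: d_def m_ac)
    also have "\<dots> = W p" using w uc p t(5) by (simp add: nat_pow_mult)
    finally show ?thesis unfolding t(4) using w p by (simp add: minus_eq r_neg)
  qed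
  ultimately show ?thesis by blast
qed

text \<open>Bounds the side effect of the absorbing column on the equation for a_i. N will be
  \<open>Suc (s i)\<close> for i in S and the boundary valuation otherwise.\<close>

lemma off_diagonal_E:
  assumes "off_diagonal lam A i t d" "\<And>j. j \<in> S \<Longrightarrow> j \<noteq> i \<Longrightarrow> N \<le> lam i - lam j + s j"
  shows "d p \<otimes> E t \<in> P N"
proof (cases "fst t \<in> S \<and> snd t = 1 \<and> fst t \<noteq> i")
  case True
  have "d p \<otimes> E t \<in> P (lam i - lam (fst t) + s (fst t))"
    using assms(1) True by (intro P_mult) (auto simp: off_diagonal_def E_def)
  then show ?thesis by (rule P_mono_elem) (use assms(2) True in blast)
next
  case False
  then show ?thesis using assms(1) off_diagonal_closed[OF assms(1), of p]
    by (auto simp: off_diagonal_def E_def)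
qed

text \<open>The values at \<open>F\<close> are reached once those at \<open>E\<close> and at \<open>F - y\<^sub>\<iota> E\<close> are.\<close>

lemma combine_congruences:
  assumes c: "d \<in> carrier R" "e \<in> carrier R" "f \<in> carrier R" "g \<in> carrier R" "h \<in> carrier R"
      "a \<in> carrier R" "b \<in> carrier R" "c \<in> carrier R"
    and 1: "d \<otimes> e \<oplus> g \<ominus> a \<in> P n"
    and 2: "d \<otimes> (f \<ominus> c \<otimes> e) \<oplus> h \<ominus> (b \<ominus> c \<otimes> a) \<in> P n"
  shows "d \<otimes> f \<oplus> (g \<otimes> c \<oplus> h) \<ominus> b \<in> P n"
proof -
  have "d \<otimes> f \<oplus> (g \<otimes> c \<oplus> h) \<ominus> b =
      (d \<otimes> (f \<ominus> c \<otimes> e) \<oplus> h \<ominus> (b \<ominus> c \<otimes> a)) \<oplus> c \<otimes> (d \<otimes> e \<oplus> g \<ominus> a)"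
    using c by algebra
  then show ?thesis using 1 2 c by simp
qed

section \<open>Rows with prescribed values at E and F\<close>

definition row_solution :: "nat \<Rightarrow> (nat \<Rightarrow> 'a) \<Rightarrow> (nat \<Rightarrow> 'a) \<Rightarrow> bool" where
  "row_solution i a b \<longleftrightarrow> (\<exists>G. admissible_rows lam A i (rho i) G \<and>
     (\<forall>p\<in>{1..rho i}. G p E \<ominus> a p \<in> P (lam i) \<and> G p F \<ominus> b p \<in> P (lam i)))"

text \<open>u and w are the first two columns of the diagonal block; they meet pi^s_i and pi^r_i.
  Beyond these positions block i of E and F vanishes, so the completing columns do not disturb the
  equations. For \<open>rho i = 1\<close> there is no second column.\<close>

lemma row_solution_in:
  assumes i: "i \<in> S" and ab: "\<And>p. a p \<in> carrier R" "\<And>p. b p \<in> carrier R"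
    and uw: "\<And>p. u p \<in> carrier R" "\<And>p. w p \<in> carrier R"
    and blk: "rho i = 1 \<and> u 1 \<in> Units R \<or> 1 < rho i \<and>
      (\<exists>p0\<in>{1..rho i}. \<exists>p1\<in>{1..rho i}. u p0 \<otimes> w p1 \<ominus> u p1 \<otimes> w p0 \<in> Units R)"
    and off: "off_diagonal lam A i t d"
    and 1: "\<And>p. p \<in> {1..rho i} \<Longrightarrow> d p \<otimes> E t \<oplus> u p \<otimes> \<pi> [^] s i \<ominus> a p \<in> P (lam i)"
    and 2: "\<And>p. p \<in> {1..rho i} \<Longrightarrow> d p \<otimes> (F t \<ominus> y i \<otimes> E t) \<oplus>
      (if rho i = 1 then \<zero> else w p \<otimes> pi_pow R \<pi> (r i)) \<ominus> (b p \<ominus> y i \<otimes> a p) \<in> P (lam i)"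
  shows "row_solution i a b"
proof -
  have ik: "i \<in> {1..k}" using i S_sub by blast
  let ?E = "\<lambda>q. E (i, q)" and ?F = "\<lambda>q. F (i, q)"
  have E1: "E (i, 1) = \<pi> [^] s i" "F (i, 1) = \<pi> [^] s i \<otimes> y i" "F (i, 2) = pi_pow R \<pi> (r i)" "E (i, 2) = \<zero>"
    using i by (simp_all add: E_def F_def)
  have E0: "\<forall>q\<in>{2..rho i}. E (i, q) = \<zero>" "\<forall>q\<in>{3..rho i}. E (i, q) = \<zero>" "\<forall>q\<in>{3..rho i}. F (i, q) = \<zero>"
    by (auto simp: E_def F_def)
  have "\<exists>D. block_iso (rho i) D \<and> (\<forall>p. D p ?E = u p \<otimes> \<pi> [^] s i) \<and>
     (\<forall>p. D p ?F = u p \<otimes> \<pi> [^] s i \<otimes> y i \<oplus> (if rho i = 1 then \<zero> else w p \<otimes> pi_pow R \<pi> (r i)))"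
  proof (cases "rho i = 1")
    case True
    then have "u 1 \<in> Units R" using blk by simp
    then obtain D where D: "block_iso (rho i) D"
      "\<And>p X. (\<forall>q. X q \<in> carrier R) \<Longrightarrow> (\<forall>q\<in>{2..rho i}. X q = \<zero>) \<Longrightarrow> D p X = u p \<otimes> X 1"
      using block_iso_one_column[of u 1 "rho i"] uw True by auto
    have "D p ?E = u p \<otimes> E (i, 1)" "D p ?F = u p \<otimes> F (i, 1)" for p
      by (rule D(2); simp add: True)+
    then show ?thesis using D(1) True uw y_closed[OF i] unfolding E1
      by (intro exI[of _ D]) (simp add: m_assoc)
  next
    case False
    then obtain p0 p1 where p: "p0 \<in> {1..rho i}" "p1 \<in> {1..rho i}"
      "u p0 \<otimes> w p1 \<ominus> u p1 \<otimes> w p0 \<in> Units R" using blk by blast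
    obtain D where D: "block_iso (rho i) D"
      "\<And>p X. (\<forall>q. X q \<in> carrier R) \<Longrightarrow> (\<forall>q\<in>{3..rho i}. X q = \<zero>) \<Longrightarrow>
         D p X = u p \<otimes> X 1 \<oplus> w p \<otimes> X 2"
      using block_iso_two_columns[of u w p0 "rho i" p1] uw p by auto
    have "D p ?E = u p \<otimes> E (i, 1) \<oplus> w p \<otimes> E (i, 2)" "D p ?F = u p \<otimes> F (i, 1) \<oplus> w p \<otimes> F (i, 2)" for p
      by (rule D(2); use E0 in simp)+
    then show ?thesis using D(1) False uw y_closed[OF i] unfolding E1
      by (intro exI[of _ D]) (simp add: m_assoc)
  qed
  then obtain D where D: "block_iso (rho i) D" "\<And>p. D p ?E = u p \<otimes> \<pi> [^] s i"
    "\<And>p. D p ?F = u p \<otimes> \<pi> [^] s i \<otimes> y i \<oplus> (if rho i = 1 then \<zero> else w p \<otimes> pi_pow R \<pi> (r i))" by blast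
  have t: "t \<in> A" using off by (simp add: off_diagonal_def)
  note dc = off_diagonal_closed[OF off]
  have adm: "admissible_rows lam A i (rho i) (\<lambda>p X. d p \<otimes> X t \<oplus> \<zero> \<otimes> X t \<oplus> D p (\<lambda>q. X (i, q)))"
    by (rule admissible_rowsI[OF part ik D(1) off off_diagonal_zero[OF t]])
  show ?thesis unfolding row_solution_def
  proof (intro exI conjI ballI, rule adm)
    fix p assume p: "p \<in> {1..rho i}"
    show "d p \<otimes> E t \<oplus> \<zero> \<otimes> E t \<oplus> D p ?E \<ominus> a p \<in> P (lam i)"
      using 1[OF p] dc uw by (simp add: D)
    have "d p \<otimes> F t \<oplus> (u p \<otimes> \<pi> [^] s i \<otimes> y i \<oplus> (if rho i = 1 then \<zero> else w p \<otimes> pi_pow R \<pi> (r i))) \<ominus> b p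
        \<in> P (lam i)"
      by (rule combine_congruences[OF _ _ _ _ _ _ _ _ 1[OF p] 2[OF p]]) (use dc uw ab y_closed[OF i] in simp_all)
    then show "d p \<otimes> F t \<oplus> \<zero> \<otimes> F t \<oplus> D p ?F \<ominus> b p \<in> P (lam i)"
      using dc uw by (simp add: D)
  qed
qed

text \<open>Block i of E is zero, so the diagonal column u meets only pi^r_i in the second equation.
  The first equation is left to the column \<open>\<iota> i\<close>, whose coefficient in the second
  one is 0.\<close>

lemma row_solution_notin:
  assumes i: "i \<in> {1..k} - S" and ab: "\<And>p. a p \<in> carrier R" "\<And>p. b p \<in> carrier R"
    and u: "\<And>p. u p \<in> carrier R" "p0 \<in> {1..rho i}" "u p0 \<in> Units R"
    and off: "off_diagonal lam A i t d"
    and a: "\<And>p. p \<in> {1..rho i} \<Longrightarrow> a p \<in> P (min (lam i - lam (\<iota> i) + s (\<iota> i)) (lam i))"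
    and 2: "\<And>p. p \<in> {1..rho i} \<Longrightarrow> d p \<otimes> (F t \<ominus> y (\<iota> i) \<otimes> E t) \<oplus> u p \<otimes> pi_pow R \<pi> (r i) \<ominus>
      (b p \<ominus> y (\<iota> i) \<otimes> a p) \<in> P (lam i)"
  shows "row_solution i a b"
proof -
  let ?j = "\<iota> i"
  let ?\<delta> = "lam i - lam ?j" let ?E = "\<lambda>q. E (i, q)" and ?F = "\<lambda>q. F (i, q)"
  have ik: "i \<in> {1..k}" and iS: "i \<notin> S" using i by auto
  have j: "?j \<in> S" "?j \<in> {1..k}" using iota[OF i] S_sub by auto
  note dc = off_diagonal_closed[OF off]
  have "\<exists>c. c \<in> carrier R \<and> (p \<in> {1..rho i} \<longrightarrow> a p \<ominus> d p \<otimes> E t \<ominus> \<pi> [^] (?\<delta> + s ?j) \<otimes> c \<in> P (lam i))" for p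
  proof (cases "p \<in> {1..rho i}")
    case True
    have "d p \<otimes> E t \<in> P (?\<delta> + s ?j)" by (rule off_diagonal_E[OF off]) (rule iota_le[OF i])
    then have "d p \<otimes> E t \<in> P (min (?\<delta> + s ?j) (lam i))" by (rule P_mono_elem) simp
    then have "a p \<ominus> d p \<otimes> E t \<in> P (min (?\<delta> + s ?j) (lam i))" using a[OF True] by simp
    then show ?thesis using P_min_iff[of "a p \<ominus> d p \<otimes> E t"] ab dc by auto
  qed (auto)
  then obtain c where c: "\<And>p. c p \<in> carrier R"
    "\<And>p. p \<in> {1..rho i} \<Longrightarrow> a p \<ominus> d p \<otimes> E t \<ominus> \<pi> [^] (?\<delta> + s ?j) \<otimes> c p \<in> P (lam i)" by metis
  \<comment> \<open>The column \<open>\<iota> i\<close> supplies what the absorbing column leaves of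
    a_i. The factor pi^delta makes it a homomorphism, and with pi^s_iota it gives exactly the
    boundary valuation.\<close>
  define d' where "d' p = \<pi> [^] ?\<delta> \<otimes> c p" for p
  have d'c: "d' p \<in> carrier R" for p using c(1) by (simp add: d'_def)
  have "(?j, 1) \<in> A" using j rho_pos by (simp add: summands_def)
  then have off': "off_diagonal lam A i (?j, 1) d'"
    using j iS c(1) by (auto simp: off_diagonal_def d'_def)
  obtain D where D: "block_iso (rho i) D"
    "\<And>p X. (\<forall>q. X q \<in> carrier R) \<Longrightarrow> (\<forall>q\<in>{2..rho i}. X q = \<zero>) \<Longrightarrow> D p X = u p \<otimes> X 1"
    using block_iso_one_column[of u p0 "rho i"] u by auto
  have "D p ?E = u p \<otimes> E (i, 1)" "D p ?F = u p \<otimes> F (i, 1)" for p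
    by (rule D(2); auto simp: E_def F_def iS)+
  then have DEF: "D p ?E = \<zero>" "D p ?F = u p \<otimes> pi_pow R \<pi> (r i)" for p
    using u(1) iS by (simp_all add: E_def F_def)
  have EFj: "E (?j, 1) = \<pi> [^] s ?j" "F (?j, 1) = \<pi> [^] s ?j \<otimes> y ?j"
    using j by (simp_all add: E_def F_def)
  have yc: "y ?j \<in> carrier R" by (rule y_closed[OF j(1)])
  have 1: "d p \<otimes> E t \<oplus> d' p \<otimes> \<pi> [^] s ?j \<ominus> a p \<in> P (lam i)" if p: "p \<in> {1..rho i}" for p
  proof -
    have "\<pi> [^] (?\<delta> + s ?j) \<otimes> c p = d' p \<otimes> \<pi> [^] s ?j"
      using c(1)[of p] by (simp add: d'_def nat_pow_mult[symmetric] m_ac)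
    then have "\<ominus> (a p \<ominus> d p \<otimes> E t \<ominus> d' p \<otimes> \<pi> [^] s ?j) \<in> P (lam i)" using c(2)[OF p] by simp
    moreover have "\<ominus> (a p \<ominus> d p \<otimes> E t \<ominus> d' p \<otimes> \<pi> [^] s ?j) = d p \<otimes> E t \<oplus> d' p \<otimes> \<pi> [^] s ?j \<ominus> a p"
      using ab(1)[of p] dc[of p] d'c[of p] E_closed[of t] nat_pow_closed[OF pi_closed, of "s ?j"] by algebra
    ultimately show ?thesis by simp
  qed
  show ?thesis unfolding row_solution_def
  proof (intro exI conjI ballI, rule admissible_rowsI[OF part ik D(1) off off'])
    fix p assume p: "p \<in> {1..rho i}"
    show "d p \<otimes> E t \<oplus> d' p \<otimes> E (?j, 1) \<oplus> D p ?E \<ominus> a p \<in> P (lam i)"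
      unfolding EFj DEF using 1[OF p] dc d'c by simp
    have "d p \<otimes> F t \<oplus> (d' p \<otimes> \<pi> [^] s ?j \<otimes> y ?j \<oplus> u p \<otimes> pi_pow R \<pi> (r i)) \<ominus> b p \<in> P (lam i)"
      by (rule combine_congruences[OF _ _ _ _ _ _ _ _ 1[OF p] 2[OF p]]) (use dc d'c u ab yc in simp_all)
    then show "d p \<otimes> F t \<oplus> d' p \<otimes> F (?j, 1) \<oplus> D p ?F \<ominus> b p \<in> P (lam i)"
      unfolding EFj DEF using dc d'c u yc by (simp add: a_assoc m_assoc)
  qed
qed

lemma row_solution_S:
  assumes i: "i \<in> S" and ab: "\<And>p. a p \<in> carrier R" "\<And>p. b p \<in> carrier R"
    and a: "\<And>p. p \<in> {1..rho i} \<Longrightarrow> a p \<in> P (s i)" "p0 \<in> {1..rho i}" "a p0 \<notin> P (Suc (s i))"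
    and 1: "\<And>p. rho i = 1 \<or> mm i \<le> r i \<Longrightarrow> p \<in> {1..rho i} \<Longrightarrow>
      b p \<ominus> y i \<otimes> a p \<in> P (cap (lam i) (mm i))"
    and 2: "1 < rho i \<Longrightarrow> r i < mm i \<Longrightarrow>
      \<exists>u w. (\<forall>p. u p \<in> carrier R) \<and> (\<forall>p. w p \<in> carrier R) \<and>
        (\<forall>p\<in>{1..rho i}. \<pi> [^] s i \<otimes> u p \<ominus> a p \<in> P (lam i) \<and>
          pi_pow R \<pi> (r i) \<otimes> w p \<ominus> (b p \<ominus> y i \<otimes> a p) \<in> P (lam i)) \<and>
        (\<exists>p0\<in>{1..rho i}. \<exists>p1\<in>{1..rho i}. u p0 \<otimes> w p1 \<ominus> u p1 \<otimes> w p0 \<in> Units R)"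
  shows "row_solution i a b"
proof -
  have ik: "i \<in> {1..k}" using i S_sub by blast
  have yc: "y i \<in> carrier R" by (rule y_closed[OF i])
  have iA: "(i, 1) \<in> A" using rho_pos[OF ik] ik by (simp add: summands_def)
  show ?thesis
  proof (cases "rho i = 1 \<or> mm i \<le> r i")
    \<comment> \<open>Condition (B): the diagonal block alone solves both equations, with u and w
      lifting the two independent leading parts; the off-diagonal column is zero.\<close>
    case False
    then obtain u w where uw: "\<forall>p. u p \<in> carrier R" "\<forall>p. w p \<in> carrier R"
      "\<forall>p\<in>{1..rho i}. \<pi> [^] s i \<otimes> u p \<ominus> a p \<in> P (lam i) \<and>
          pi_pow R \<pi> (r i) \<otimes> w p \<ominus> (b p \<ominus> y i \<otimes> a p) \<in> P (lam i)"
      "\<exists>p0\<in>{1..rho i}. \<exists>p1\<in>{1..rho i}. u p0 \<otimes> w p1 \<ominus> u p1 \<otimes> w p0 \<in> Units R"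
      using 2 rho_pos[OF ik] by (metis le_neq_implies_less not_le)
    show ?thesis
    proof (rule row_solution_in[OF i ab _ _ _ off_diagonal_zero[OF iA], of u w])
      show "rho i = 1 \<and> u 1 \<in> Units R \<or> 1 < rho i \<and>
        (\<exists>p0\<in>{1..rho i}. \<exists>p1\<in>{1..rho i}. u p0 \<otimes> w p1 \<ominus> u p1 \<otimes> w p0 \<in> Units R)"
        using False uw(4) rho_pos[OF ik] by auto
      fix p
      show "u p \<in> carrier R" "w p \<in> carrier R" using uw(1,2) by auto
      assume p: "p \<in> {1..rho i}"
      show "\<zero> \<otimes> E (i, 1) \<oplus> u p \<otimes> \<pi> [^] s i \<ominus> a p \<in> P (lam i)"
        using uw(1) bspec[OF uw(3) p] by (simp add: m_comm)
      show "\<zero> \<otimes> (F (i, 1) \<ominus> y i \<otimes> E (i, 1)) \<oplus> (if rho i = 1 then \<zero> else w p \<otimes> pi_pow R \<pi> (r i)) \<ominus>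
          (b p \<ominus> y i \<otimes> a p) \<in> P (lam i)"
        using uw(2) bspec[OF uw(3) p] False yc by (simp add: m_comm)
    qed
  next
    case True
    have "\<exists>c. c \<in> carrier R \<and> (p \<in> {1..rho i} \<longrightarrow> a p = \<pi> [^] s i \<otimes> c)" for p
      using a(1)[of p] by (cases "p \<in> {1..rho i}") (auto simp: P_iff)
    then obtain c where c: "\<And>p. c p \<in> carrier R" "\<And>p. p \<in> {1..rho i} \<Longrightarrow> a p = \<pi> [^] s i \<otimes> c p"
      by metis
    have c0: "c p0 \<in> Units R"
      using a(2,3) c(2)[OF a(2)] P_pow_mult[OF c(1)[of p0], of "s i" "Suc (s i)"] P_1_unit[OF c(1)[of p0]] by simp
    \<comment> \<open>Condition (A): p1 is any row other than p0. With w the unit vector of row p1,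
      the minor in rows p0, p1 is simply \<open>u p0\<close>.\<close>
    define p1 where "p1 = (if p0 = 1 then 2 else (1::nat))"
    define w where "w p = (if p = p1 then \<one> else \<zero>)" for p
    \<comment> \<open>The contribution e of this arbitrary second column is divisible by pi^m_i,
      because m_i <= r_i; it is subtracted from the residual before absorption.\<close>
    have wc: "w p \<in> carrier R" for p by (simp add: w_def)
    define e where "e p = (if rho i = 1 then \<zero> else w p \<otimes> pi_pow R \<pi> (r i))" for p
    have ec: "e p \<in> carrier R" for p by (simp add: e_def wc)
    have "e p \<in> P (cap (lam i) (mm i))" for p
    proof (cases "rho i = 1")
      case False
      then have "pi_pow R \<pi> (r i) \<in> P (cap (lam i) (mm i))"
        using True by (intro P_mono_elem[OF pi_pow_cap[of "r i" "lam i"]] cap_mono) simp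
      then show ?thesis using wc by (simp add: e_def)
    qed (simp add: e_def)
    then have "b p \<ominus> y i \<otimes> a p \<ominus> e p \<in> P (cap (lam i) (mm i))" if "p \<in> {1..rho i}" for p
      using 1[OF True that] by simp
    then obtain t d where td: "off_diagonal lam A i t d"
      "\<And>p. p \<in> {1..rho i} \<Longrightarrow> d p \<otimes> (F t \<ominus> y (\<iota> i) \<otimes> E t) \<ominus> (b p \<ominus> y i \<otimes> a p \<ominus> e p) \<in> P (lam i)"
      using off_diagonal_absorbs[OF ik, of "\<lambda>p. b p \<ominus> y i \<otimes> a p \<ominus> e p"] by blast
    have dc: "d p \<in> carrier R" for p by (rule off_diagonal_closed[OF td(1)])
    have "d p \<otimes> E t \<in> P (Suc (s i))" for p
      by (rule off_diagonal_E[OF td(1)]) (use s_less[OF i] in \<open>auto simp: Suc_le_eq\<close>)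
    then have "\<forall>p. \<exists>g. g \<in> carrier R \<and> d p \<otimes> E t = \<pi> [^] Suc (s i) \<otimes> g"
      unfolding P_iff by blast
    then obtain g where g: "\<And>p. g p \<in> carrier R" "\<And>p. d p \<otimes> E t = \<pi> [^] Suc (s i) \<otimes> g p" by metis
    \<comment> \<open>c would solve the first equation alone; the absorbing column adds pi^(s_i + 1)
      g, which u compensates. Since u and c agree modulo pi, the unit entry in row p0
      survives.\<close>
    define u where "u p = c p \<ominus> \<pi> \<otimes> g p" for p
    have uc: "u p \<in> carrier R" for p using c g by (simp add: u_def)
    have pg: "\<ominus> (\<pi> \<otimes> x) \<in> P 1" if "x \<in> carrier R" for x
      using P_mult_r[OF P_pow[of 1] that] by simp
    have u0: "u p0 \<in> Units R"
      unfolding u_def minus_eq by (rule unit_add_P1[OF c0 pg[OF g(1)]])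
    have blk: "rho i = 1 \<and> u 1 \<in> Units R \<or> 1 < rho i \<and>
      (\<exists>p0\<in>{1..rho i}. \<exists>p1\<in>{1..rho i}. u p0 \<otimes> w p1 \<ominus> u p1 \<otimes> w p0 \<in> Units R)"
    proof (cases "rho i = 1")
      case True
      then show ?thesis using u0 a(2) by simp
    next
      case False
      then have "1 < rho i" using rho_pos[OF ik] by simp
      moreover have "p1 \<in> {1..rho i}" using \<open>1 < rho i\<close> by (simp add: p1_def)
      moreover have "p0 \<noteq> p1" by (simp add: p1_def)
      then have "u p0 \<otimes> w p1 \<ominus> u p1 \<otimes> w p0 \<in> Units R"
        using u0 uc by (simp add: w_def minus_eq)
      ultimately show ?thesis using a(2) by blast
    qed
    show ?thesis
    proof (rule row_solution_in[OF i ab uc wc blk td(1)])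
      fix p assume p: "p \<in> {1..rho i}"
      have "d p \<otimes> E t \<oplus> u p \<otimes> \<pi> [^] s i = a p"
        unfolding g(2) c(2)[OF p] u_def nat_pow_Suc
        using g(1)[of p] c(1)[of p] nat_pow_closed[OF pi_closed, of "s i"] pi_closed by algebra
      then show "d p \<otimes> E t \<oplus> u p \<otimes> \<pi> [^] s i \<ominus> a p \<in> P (lam i)"
        using ab by (simp add: minus_eq r_neg)
      have "d p \<otimes> (F t \<ominus> y i \<otimes> E t) \<oplus> e p \<ominus> (b p \<ominus> y i \<otimes> a p) =
          d p \<otimes> (F t \<ominus> y i \<otimes> E t) \<ominus> (b p \<ominus> y i \<otimes> a p \<ominus> e p)"
        using dc[of p] ec[of p] ab(1)[of p] ab(2)[of p] yc E_closed[of t] F_closed[of t] by algebra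
      then show "d p \<otimes> (F t \<ominus> y i \<otimes> E t) \<oplus> (if rho i = 1 then \<zero> else w p \<otimes> pi_pow R \<pi> (r i)) \<ominus>
          (b p \<ominus> y i \<otimes> a p) \<in> P (lam i)"
        using td(2)[OF p] iota_S[OF i] by (simp add: e_def)
    qed
  qed
qed

lemma row_solution_not_S:
  assumes i: "i \<in> {1..k} - S" and ab: "\<And>p. a p \<in> carrier R" "\<And>p. b p \<in> carrier R"
    and a: "\<And>p. p \<in> {1..rho i} \<Longrightarrow> a p \<in> P (min (lam i - lam (\<iota> i) + s (\<iota> i)) (lam i))"
    and b: "\<And>p. p \<in> {1..rho i} \<Longrightarrow> b p \<in> P (min (lam i - lam (\<iota> i) + s (\<iota> i)) (lam i))"
    and r: "enat (lam i - lam (\<iota> i) + s (\<iota> i)) \<le> r i" "r i \<noteq> \<infinity> \<Longrightarrow> r i < enat (lam i)"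
    and 1: "\<And>p. mm i \<le> r i \<Longrightarrow> enat (lam i - lam (\<iota> i) + s (\<iota> i)) < mm i \<Longrightarrow> p \<in> {1..rho i} \<Longrightarrow>
      b p \<ominus> y (\<iota> i) \<otimes> a p \<in> P (cap (lam i) (mm i))"
    and 2: "r i < mm i \<Longrightarrow> (\<forall>p\<in>{1..rho i}. b p \<ominus> y (\<iota> i) \<otimes> a p \<in> P (cap (lam i) (r i))) \<and>
      (\<exists>p\<in>{1..rho i}. b p \<ominus> y (\<iota> i) \<otimes> a p \<notin> P (cap (lam i) (r i + 1)))"
  shows "row_solution i a b"
proof -
  have ik: "i \<in> {1..k}" using i by simp
  have yc: "y (\<iota> i) \<in> carrier R" by (rule y_iota_closed[OF ik])
  have iA: "(i, 1) \<in> A" using rho_pos[OF ik] ik by (simp add: summands_def)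
  let ?z = "\<lambda>p. b p \<ominus> y (\<iota> i) \<otimes> a p"
  have zc: "?z p \<in> carrier R" for p using ab yc by simp
  show ?thesis
  proof (cases "mm i \<le> r i")
    case True
    have z: "?z p \<in> P (cap (lam i) (mm i))" if p: "p \<in> {1..rho i}" for p
    proof (cases "enat (lam i - lam (\<iota> i) + s (\<iota> i)) < mm i")
      \<comment> \<open>Condition (iii): both blocks are divisible by the boundary power, and m_i
        does not exceed the boundary valuation.\<close>
      case False
      then have "cap (lam i) (mm i) \<le> cap (lam i) (enat (lam i - lam (\<iota> i) + s (\<iota> i)))"
        by (intro cap_mono) simp
      moreover have "?z p \<in> P (cap (lam i) (enat (lam i - lam (\<iota> i) + s (\<iota> i))))"
        using a[OF p] b[OF p] yc by simp
      ultimately show ?thesis by (rule P_mono_elem[rotated])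
    qed (rule 1[OF True _ p])
    \<comment> \<open>Any diagonal column with a unit entry would do: since m_i <= r_i, its
      contribution e can be absorbed along with the residual.\<close>
    define u where "u p = (if p = (1::nat) then \<one> else \<zero>)" for p
    have uc: "u p \<in> carrier R" for p by (simp add: u_def)
    define e where "e p = u p \<otimes> pi_pow R \<pi> (r i)" for p
    have ec: "e p \<in> carrier R" for p by (simp add: e_def uc)
    have "pi_pow R \<pi> (r i) \<in> P (cap (lam i) (mm i))"
      using True by (intro P_mono_elem[OF pi_pow_cap[of "r i" "lam i"]] cap_mono)
    then have "e p \<in> P (cap (lam i) (mm i))" for p using uc by (simp add: e_def)
    then have "?z p \<ominus> e p \<in> P (cap (lam i) (mm i))" if "p \<in> {1..rho i}" for p
      using z[OF that] by simp
    then obtain t d where td: "off_diagonal lam A i t d"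
      "\<And>p. p \<in> {1..rho i} \<Longrightarrow> d p \<otimes> (F t \<ominus> y (\<iota> i) \<otimes> E t) \<ominus> (?z p \<ominus> e p) \<in> P (lam i)"
      using off_diagonal_absorbs[OF ik, of "\<lambda>p. ?z p \<ominus> e p"] by blast
    have dc: "d p \<in> carrier R" for p by (rule off_diagonal_closed[OF td(1)])
    show ?thesis
    proof (rule row_solution_notin[OF i ab uc _ _ td(1) a, of 1])
      show "1 \<in> {1..rho i}" "u 1 \<in> Units R" using rho_pos[OF ik] by (simp_all add: u_def)
      fix p assume p: "p \<in> {1..rho i}"
      have "d p \<otimes> (F t \<ominus> y (\<iota> i) \<otimes> E t) \<oplus> e p \<ominus> ?z p =
          d p \<otimes> (F t \<ominus> y (\<iota> i) \<otimes> E t) \<ominus> (?z p \<ominus> e p)"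
        using dc[of p] ec[of p] ab(1)[of p] ab(2)[of p] yc E_closed[of t] F_closed[of t] by algebra
      then show "d p \<otimes> (F t \<ominus> y (\<iota> i) \<otimes> E t) \<oplus> u p \<otimes> pi_pow R \<pi> (r i) \<ominus> ?z p \<in> P (lam i)"
        using td(2)[OF p] by (simp add: e_def)
    qed
  next
    case False
    then obtain v where v: "r i = enat v" "v < lam i" using r(2) by (cases "r i") auto
    have z: "\<forall>p\<in>{1..rho i}. ?z p \<in> P v" "\<exists>p\<in>{1..rho i}. ?z p \<notin> P (Suc v)"
      using 2 False v by (simp_all add: min_def one_enat_def)
    have "\<exists>c. c \<in> carrier R \<and> (p \<in> {1..rho i} \<longrightarrow> ?z p = \<pi> [^] v \<otimes> c)" for p
      using z(1) by (cases "p \<in> {1..rho i}") (auto simp: P_iff)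
    then obtain u where u: "\<And>p. u p \<in> carrier R" "\<And>p. p \<in> {1..rho i} \<Longrightarrow> ?z p = \<pi> [^] v \<otimes> u p"
      by metis
    obtain p0 where p0: "p0 \<in> {1..rho i}" "?z p0 \<notin> P (Suc v)" using z(2) by blast
    have u0: "u p0 \<in> Units R"
      using p0(2) P_pow_mult[OF u(1)[of p0], of v "Suc v"] P_1_unit[OF u(1)[of p0]] unfolding u(2)[OF p0(1)] by simp
    show ?thesis
    proof (rule row_solution_notin[where u = u and ?p0.0 = p0 and a = a and b = b, OF i ab u(1) p0(1) u0 off_diagonal_zero[OF iA] a])
      fix p assume p: "p \<in> {1..rho i}"
      show "\<zero> \<otimes> (F (i, 1) \<ominus> y (\<iota> i) \<otimes> E (i, 1)) \<oplus> u p \<otimes> pi_pow R \<pi> (r i) \<ominus> ?z p \<in> P (lam i)"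
        unfolding u(2)[OF p] using u(1)[of p] yc v(1) by (simp add: pi_pow_def m_comm minus_eq r_neg)
    qed
  qed
qed

section \<open>Translation of the definitions into lifts\<close>

lemma canonical_form_clv: "canonical_form R \<pi> k lam rho S s = clv lam A E"
  by (auto simp: canonical_form_def clv_def E_def zero_Rn cl_def fun_eq_iff)

lemma orbit_representative_clv:
  "orbit_representative R \<pi> k lam rho S s y (characteristic_element R \<pi> k lam rho S r) = clv lam A F"
  by (auto simp: orbit_representative_def characteristic_element_def summands'_def summands''_def
      clv_def F_def zero_Rn cl_def fun_eq_iff)

lemma case_description_rows:
  assumes a: "\<And>t. a t \<in> carrier R" and b: "\<And>t. b t \<in> carrier R"
    and same: "same_case_description R \<pi> k lam rho S s y \<iota> r (clv lam A a) (clv lam A b)"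
    and i: "i \<in> {1..k}"
  defines "z \<equiv> \<lambda>p. b (i, p) \<ominus> y (\<iota> i) \<otimes> a (i, p)"
  shows "i \<in> S \<Longrightarrow> rho i = 1 \<or> mm i \<le> r i \<Longrightarrow> p \<in> {1..rho i} \<Longrightarrow> z p \<in> P (cap (lam i) (mm i))"
    and "i \<in> S \<Longrightarrow> 1 < rho i \<Longrightarrow> r i < mm i \<Longrightarrow> (\<forall>p\<in>{1..rho i}. z p \<in> P (cap (lam i) (r i))) \<and>
      lin_indep_pair R \<pi> (rho i)
        (leading_part R \<pi> (lam i) (rho i) (the_enat (r i)) (vec (lam i) (rho i) z))
        (leading_part R \<pi> (lam i) (rho i) (s i) (vec (lam i) (rho i) (\<lambda>p. a (i, p))))"
    and "i \<notin> S \<Longrightarrow> mm i \<le> r i \<Longrightarrow> boundary_val lam S s i < mm i \<Longrightarrow> p \<in> {1..rho i} \<Longrightarrow>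
      z p \<in> P (cap (lam i) (mm i))"
    and "i \<notin> S \<Longrightarrow> r i < mm i \<Longrightarrow> boundary_val lam S s i \<le> r i \<Longrightarrow>
      (\<forall>p\<in>{1..rho i}. z p \<in> P (cap (lam i) (r i))) \<and> (\<exists>p\<in>{1..rho i}. z p \<notin> P (cap (lam i) (r i + 1)))"
proof -
  let ?M = "Rn_pow R \<pi> (lam i) (rho i)"
  have yc: "y (\<iota> i) \<in> carrier R" by (rule y_iota_closed[OF i])
  have zc: "z p \<in> carrier R" for p using a b yc by (simp add: z_def)
  have blk: "block rho i (clv lam A c) = vec (lam i) (rho i) (\<lambda>p. c (i, p))" for c
    using i by (auto simp: block_def clv_def vec_def summands_def fun_eq_iff)
  have z: "vec (lam i) (rho i) (\<lambda>p. b (i, p)) \<ominus>\<^bsub>?M\<^esub> (y (\<iota> i) \<odot>\<^bsub>?M\<^esub> vec (lam i) (rho i) (\<lambda>p. a (i, p))) =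
      vec (lam i) (rho i) z"
    using a b yc by (simp add: vec_smult vec_minus z_def)
  note pm = pi_multiples_vec_iff[where X = z, OF zc]
  note D = same[unfolded same_case_description_def Let_def, rule_format, OF i, unfolded blk z, folded mm_def]
  have "rho i = 1 \<or> mm i \<le> r i \<longleftrightarrow> rho i = 1 \<or> rho i > 1 \<and> mm i \<le> r i"
    using rho_pos[OF i] by auto
  then show "i \<in> S \<Longrightarrow> rho i = 1 \<or> mm i \<le> r i \<Longrightarrow> p \<in> {1..rho i} \<Longrightarrow> z p \<in> P (cap (lam i) (mm i))"
    using D pm by blast
  show "i \<in> S \<Longrightarrow> 1 < rho i \<Longrightarrow> r i < mm i \<Longrightarrow> (\<forall>p\<in>{1..rho i}. z p \<in> P (cap (lam i) (r i))) \<and>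
      lin_indep_pair R \<pi> (rho i)
        (leading_part R \<pi> (lam i) (rho i) (the_enat (r i)) (vec (lam i) (rho i) z))
        (leading_part R \<pi> (lam i) (rho i) (s i) (vec (lam i) (rho i) (\<lambda>p. a (i, p))))"
    using D pm by blast
  show "i \<notin> S \<Longrightarrow> mm i \<le> r i \<Longrightarrow> boundary_val lam S s i < mm i \<Longrightarrow> p \<in> {1..rho i} \<Longrightarrow>
      z p \<in> P (cap (lam i) (mm i))"
    using D pm by blast
  show "i \<notin> S \<Longrightarrow> r i < mm i \<Longrightarrow> boundary_val lam S s i \<le> r i \<Longrightarrow>
      (\<forall>p\<in>{1..rho i}. z p \<in> P (cap (lam i) (r i))) \<and> (\<exists>p\<in>{1..rho i}. z p \<notin> P (cap (lam i) (r i + 1)))"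
    using D pm by blast
qed

lemma module_aut_of_row_solutions:
  assumes fin: "finite (carrier (R Quot PIdl \<pi>))"
    and a: "\<And>t. a t \<in> carrier R" and b: "\<And>t. b t \<in> carrier R"
    and rows: "\<And>i. i \<in> {1..k} \<Longrightarrow> row_solution i (\<lambda>p. a (i, p)) (\<lambda>p. b (i, p))"
  shows "\<exists>g\<in>module_aut R (Rlam R \<pi> k lam rho). g (clv lam A E) = clv lam A a \<and> g (clv lam A F) = clv lam A b"
proof -
  obtain G where G: "\<And>i. i \<in> {1..k} \<Longrightarrow> admissible_rows lam A i (rho i) (G i)"
    "\<And>i p. i \<in> {1..k} \<Longrightarrow> p \<in> {1..rho i} \<Longrightarrow>
      G i p E \<ominus> a (i, p) \<in> P (lam i) \<and> G i p F \<ominus> b (i, p) \<in> P (lam i)"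
    using rows unfolding row_solution_def by metis
  have eq: "clv lam A (\<lambda>t. G (fst t) (snd t) X) = clv lam A c"
    if X: "\<And>t. X t \<in> carrier R" and c: "\<And>t. c t \<in> carrier R"
      and Xc: "\<And>i p. i \<in> {1..k} \<Longrightarrow> p \<in> {1..rho i} \<Longrightarrow> G i p X \<ominus> c (i, p) \<in> P (lam i)" for X c
  proof
    fix t
    show "clv lam A (\<lambda>t. G (fst t) (snd t) X) t = clv lam A c t"
    proof (cases "t \<in> A")
      case True
      then have t: "fst t \<in> {1..k}" "snd t \<in> {1..rho (fst t)}" by (auto simp: summands_def)
      have "G (fst t) (snd t) X \<in> carrier R"
        by (rule linfunD(1)[OF admissible_rowsD(1)[OF G(1)[OF t(1)] t(2)]]) (rule X)
      then have "cl (lam (fst t)) (G (fst t) (snd t) X) = cl (lam (fst t)) (c t)"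
        using cl_eq_iff c Xc[OF t] by simp
      then show ?thesis using True by (simp add: clv_def)
    qed (simp add: clv_def)
  qed
  obtain g where g: "g \<in> module_aut R (Rlam R \<pi> k lam rho)"
    "\<And>X. \<forall>t. X t \<in> carrier R \<Longrightarrow> g (clv lam A X) = clv lam A (\<lambda>t. G (fst t) (snd t) X)"
    using module_aut_of_rows[OF fin part G(1)] by blast
  have "g (clv lam A E) = clv lam A a" "g (clv lam A F) = clv lam A b"
    using g(2)[of E] g(2)[of F] eq[of E a] eq[of F b] G(2) a b by simp_all
  then show ?thesis using g(1) by blast
qed

end

section \<open>The theorem\<close>

theorem theorem18:
  fixes R :: "('a, 'c) ring_scheme" and \<pi> :: 'a
    and k :: nat and lam rho s \<iota> :: "nat \<Rightarrow> nat" and S :: "nat set"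
    and I J K :: "(nat \<times> nat) set"
    and m x f a b :: "nat \<times> nat \<Rightarrow> 'a set"
    and r :: "nat \<Rightarrow> enat" and y :: "nat \<Rightarrow> 'a"
  assumes "discrete_valuation_ring R" and "uniformizer R \<pi>"
    and "finite (carrier (R Quot PIdl\<^bsub>R\<^esub> \<pi>))"
    and "partition_type k lam rho"
    and "I \<in> ideals_of_type k lam"
    and "S \<subseteq> {1..k}" and "S \<noteq> {}" and "max_elements I = {(s i, lam i) | i. i \<in> S}"
    and "m \<in> at_ideal R \<pi> (Rlam R \<pi> k lam rho) I"
    and "J = ideal_J R \<pi> k lam rho S s m" and "K = ideal_K R \<pi> k lam rho S m"
    and "r = r_exp lam J K"
    and "x = characteristic_element R \<pi> k lam rho S r"
    and "\<forall>i\<in>S. y i \<in> Units R"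
    and "f = orbit_representative R \<pi> k lam rho S s y x"
    and "f \<in> stab_orbit R \<pi> k lam rho S (restrict m (summands' S)) J K"
    and "boundary_choice k lam S s \<iota>"
    and "a \<in> at_ideal R \<pi> (Rlam R \<pi> k lam rho) I"
    and "b \<in> at_ideal R \<pi> (Rlam R \<pi> k lam rho) I"
    and "same_case_description R \<pi> k lam rho S s y \<iota> r a b"
  shows "\<exists>g\<in>module_aut R (Rlam R \<pi> k lam rho).
           (a, b) = (g (canonical_form R \<pi> k lam rho S s), g f)"
proof -
  note part = \<open>partition_type k lam rho\<close> and S = \<open>S \<subseteq> {1..k}\<close>
    and mx = \<open>max_elements I = {(s i, lam i) | i. i \<in> S}\<close>
    and bc = \<open>boundary_choice k lam S s \<iota>\<close>
    and aI = \<open>a \<in> at_ideal R \<pi> (Rlam R \<pi> k lam rho) I\<close>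
    and bI = \<open>b \<in> at_ideal R \<pi> (Rlam R \<pi> k lam rho) I\<close>
  interpret dvr R \<pi> by (rule dvr_of_discrete_valuation_ring) fact+
  have "a \<in> carrier (Rsum R \<pi> lam (summands k rho))" "b \<in> carrier (Rsum R \<pi> lam (summands k rho))"
    using aI bI by (simp_all add: at_ideal_def Rlam_def)
  then obtain a' b' where a': "\<And>t. a' t \<in> carrier R" "a = clv lam (summands k rho) a'"
    and b': "\<And>t. b' t \<in> carrier R" "b = clv lam (summands k rho) b'"
    by (elim RsumE) (rule that)
  note lifts_a = at_ideal_lifts[where X = a', OF part a'(1) aI[unfolded a'(2)] S mx]
  note lifts_b = at_ideal_lifts[where X = b', OF part b'(1) bI[unfolded b'(2)] S mx]
  define bnd where "bnd i = lam i - lam (\<iota> i) + s (\<iota> i)" for i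
  have bv: "boundary_val lam S s i = enat (bnd i)" if "i \<in> {1..k} - S" for i
    unfolding bnd_def by (rule boundary_val_choice[OF part S bc that])
  have bnd_le: "bnd i \<le> lam i - lam j + s j" if "i \<in> {1..k} - S" "j \<in> S" for i j
    using boundary_val_le[of i S j lam s] bv[OF that(1)] that by simp
  interpret pair_data R \<pi> k lam rho s \<iota> S y r
  proof
    show "partition_type k lam rho" "S \<subseteq> {1..k}" by fact+
    show "y j \<in> carrier R" if "j \<in> S" for j
      using that \<open>\<forall>i\<in>S. y i \<in> Units R\<close> by (simp add: Units_closed)
    show "s i < lam i - lam j + s j" if "i \<in> S" "j \<in> S" "i \<noteq> j" for i j
      by (rule max_elements_separated[OF part S lifts_a(1) mx that])
    show "\<iota> i = i" if "i \<in> S" for i using bc that by (simp add: boundary_choice_def)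
    show "\<iota> i \<in> S" if "i \<in> {1..k} - S" for i by (rule boundary_choice_in[OF bc that])
    show "lam i - lam (\<iota> i) + s (\<iota> i) \<le> lam i - lam j + s j" if "i \<in> {1..k} - S" "j \<in> S" for i j
      using bnd_le[OF that] by (simp add: bnd_def)
  qed
  have JK: "J \<union> K \<subseteq> I"
    using ideal_J_K_subset[OF part S \<open>m \<in> at_ideal R \<pi> (Rlam R \<pi> k lam rho) I\<close>] \<open>J = _\<close> \<open>K = _\<close> by simp
  \<comment> \<open>A finite infimum of naturals is attained, so (r_i, lam_i) itself lies in J or K,
    hence in I.\<close>
  have r_in: "(v, lam i) \<in> I" if "r i = enat v" for i v
  proof -
    have "(INF v\<in>{v. (v, lam i) \<in> J \<union> K}. enat v) = enat v" using that \<open>r = _\<close> by (simp add: r_exp_def)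
    then obtain j where "j \<in> {v. (v, lam i) \<in> J \<union> K}" "enat j = enat v" by (rule INF_enat_attained)
    then show ?thesis using JK by auto
  qed
  have r_less: "v < lam i" if "r i = enat v" for i v
    using r_in[OF that] lifts_a(1) by (auto simp: fund_poset_def)
  \<comment> \<open>A pair of I in the column of a block outside S lies below some (s j, lam j),
    hence is bounded by the boundary valuation.\<close>
  have bnd_r: "enat (bnd i) \<le> r i" if i: "i \<in> {1..k} - S" for i
  proof (cases "r i")
    case (enat v)
    then obtain j where "j \<in> S" "lam i - lam j + s j \<le> v" using lifts_a(4)[OF r_in i] by blast
    then show ?thesis using bnd_le[OF i, of j] enat by simp
  qed simp
  note rows = case_description_rows[where a = a' and b = b', OF a'(1) b'(1)
      \<open>same_case_description R \<pi> k lam rho S s y \<iota> r a b\<close>[unfolded a'(2) b'(2)]]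
  have "row_solution i (\<lambda>p. a' (i, p)) (\<lambda>p. b' (i, p))" if i: "i \<in> {1..k}" for i
  proof (cases "i \<in> S")
    case True
    obtain p0 where p0: "p0 \<in> {1..rho i}" "a' (i, p0) \<notin> P (Suc (s i))" using lifts_a(3)[OF True] by blast
    have \<iota>: "\<iota> i = i" using iota_S[OF True] .
    show ?thesis
    proof (rule row_solution_S[where a = "\<lambda>p. a' (i, p)" and b = "\<lambda>p. b' (i, p)" and ?p0.0 = p0, OF True a'(1) b'(1) lifts_a(2)[OF True] p0])
      show "b' (i, p) \<ominus>\<^bsub>R\<^esub> y i \<otimes>\<^bsub>R\<^esub> a' (i, p) \<in> P (cap (lam i) (mm i))"
        if "rho i = 1 \<or> mm i \<le> r i" "p \<in> {1..rho i}" for p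
        using rows(1)[OF i True that] by (simp add: \<iota>)
      assume rm: "1 < rho i" "r i < mm i"
      \<comment> \<open>r_i is finite because it is strictly below m_i, so \<open>the_enat\<close>
        in condition (B) has its intended value.\<close>
      then obtain v where v: "r i = enat v" by (cases "r i") auto
      have lam1: "1 \<le> lam i" using part i by (simp add: partition_type_def)
      let ?z = "\<lambda>p. b' (i, p) \<ominus>\<^bsub>R\<^esub> y i \<otimes>\<^bsub>R\<^esub> a' (i, p)"
      have zc: "?z p \<in> carrier R" for p using a' b' y_closed[OF True] by simp
      note B = rows(2)[OF i True rm, unfolded \<iota> v the_enat.simps cap_simps]
      obtain w where w: "\<And>p. w p \<in> carrier R"
        "leading_part R \<pi> (lam i) (rho i) v (vec (lam i) (rho i) ?z) = vec 1 (rho i) w"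
        "\<And>p. p \<in> {1..rho i} \<Longrightarrow> \<pi> [^]\<^bsub>R\<^esub> v \<otimes>\<^bsub>R\<^esub> w p \<ominus>\<^bsub>R\<^esub> ?z p \<in> P (lam i)"
        by (rule leading_part_vec[where X = ?z, OF lam1 zc, of "rho i" v]) (use B in blast)+
      obtain u where u: "\<And>p. u p \<in> carrier R"
        "leading_part R \<pi> (lam i) (rho i) (s i) (vec (lam i) (rho i) (\<lambda>p. a' (i, p))) = vec 1 (rho i) u"
        "\<And>p. p \<in> {1..rho i} \<Longrightarrow> \<pi> [^]\<^bsub>R\<^esub> s i \<otimes>\<^bsub>R\<^esub> u p \<ominus>\<^bsub>R\<^esub> a' (i, p) \<in> P (lam i)"
        by (rule leading_part_vec[where X = "\<lambda>p. a' (i, p)", OF lam1 a'(1), of "rho i" "s i"])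
          (use P_mono_elem[OF lifts_a(2)[OF True]] in auto)
      have "\<exists>p0\<in>{1..rho i}. \<exists>p1\<in>{1..rho i}. u p0 \<otimes>\<^bsub>R\<^esub> w p1 \<ominus>\<^bsub>R\<^esub> u p1 \<otimes>\<^bsub>R\<^esub> w p0 \<in> Units R"
        by (rule lin_indep_minor) (use B w(1,2) u(1,2) in simp_all)
      then show "\<exists>u w. (\<forall>p. u p \<in> carrier R) \<and> (\<forall>p. w p \<in> carrier R) \<and>
        (\<forall>p\<in>{1..rho i}. \<pi> [^]\<^bsub>R\<^esub> s i \<otimes>\<^bsub>R\<^esub> u p \<ominus>\<^bsub>R\<^esub> a' (i, p) \<in> P (lam i) \<and>
          pi_pow R \<pi> (r i) \<otimes>\<^bsub>R\<^esub> w p \<ominus>\<^bsub>R\<^esub> ?z p \<in> P (lam i)) \<and>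
        (\<exists>p0\<in>{1..rho i}. \<exists>p1\<in>{1..rho i}. u p0 \<otimes>\<^bsub>R\<^esub> w p1 \<ominus>\<^bsub>R\<^esub> u p1 \<otimes>\<^bsub>R\<^esub> w p0 \<in> Units R)"
        using u(1,3) w(1,3) v by (intro exI[of _ u] exI[of _ w]) (simp add: pi_pow_def)
    qed
  next
    case False
    then have iS: "i \<in> {1..k} - S" using i by simp
    have a: "a' (i, p) \<in> P (min (bnd i) (lam i))" if "p \<in> {1..rho i}" for p
      by (rule lifts_a(5)[OF iS bnd_le[OF iS] that])
    have b: "b' (i, p) \<in> P (min (bnd i) (lam i))" if "p \<in> {1..rho i}" for p
      by (rule lifts_b(5)[OF iS bnd_le[OF iS] that])
    show ?thesis
    proof (rule row_solution_not_S[where a = "\<lambda>p. a' (i, p)" and b = "\<lambda>p. b' (i, p)", OF iS a'(1) b'(1), folded bnd_def, OF a b bnd_r[OF iS]])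
      show "r i < enat (lam i)" if "r i \<noteq> \<infinity>" using that r_less by (cases "r i") auto
      show "b' (i, p) \<ominus>\<^bsub>R\<^esub> y (\<iota> i) \<otimes>\<^bsub>R\<^esub> a' (i, p) \<in> P (cap (lam i) (mm i))"
        if "mm i \<le> r i" "enat (bnd i) < mm i" "p \<in> {1..rho i}" for p
        using rows(3)[OF i False that(1) _ that(3)] that(2) bv[OF iS] by simp
      show "(\<forall>p\<in>{1..rho i}. b' (i, p) \<ominus>\<^bsub>R\<^esub> y (\<iota> i) \<otimes>\<^bsub>R\<^esub> a' (i, p) \<in> P (cap (lam i) (r i))) \<and>
        (\<exists>p\<in>{1..rho i}. b' (i, p) \<ominus>\<^bsub>R\<^esub> y (\<iota> i) \<otimes>\<^bsub>R\<^esub> a' (i, p) \<notin> P (cap (lam i) (r i + 1)))"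
        if "r i < mm i"
        using rows(4)[OF i False that] bnd_r[OF iS] bv[OF iS] by simp
    qed
  qed
  then obtain g where "g \<in> module_aut R (Rlam R \<pi> k lam rho)"
    "g (clv lam (summands k rho) E) = clv lam (summands k rho) a'"
    "g (clv lam (summands k rho) F) = clv lam (summands k rho) b'"
    using module_aut_of_row_solutions[of a' b'] \<open>finite _\<close> a'(1) b'(1) by blast
  then show ?thesis
    using \<open>f = _\<close> \<open>x = _\<close> a'(2) b'(2)
    by (intro bexI[of _ g]) (simp_all add: canonical_form_clv orbit_representative_clv)
qed

end
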